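(* Let $\mathcal{X}\subset\mathbb{R}^n$ be prox-regular, $f$ a $C^{0,1}$ vector field on $\mathcal{X}$, and $g$ a $C^{0,1}$ metric on $\mathcal{X}$. Then for every $x_0\in\mathcal{X}$ there exists $T>0$ such that the initial value problem $\dot x\in\Pi_{\mathcal{X}}^{g}[f](x)$, $x(0)=x_0$, has a unique Carathéodory solution $x:[0,T)\to\mathcal{X}$ (which is also the unique Krasovskii solution).
   Context: Uniqueness is understood in the sense that any two solutions are equal on the interval on which they are both defined. $C^{0,1}$ means locally Lipschitz (each point of $\mathcal{X}$ has a relative neighborhood on which the map is Lipschitz). Tangent cone: for $x\in\mathcal{X}$, $T_x\mathcal{X}$ is the set of all $v\in\mathbb{R}^n$ for which there exist $x_k\in\mathcal{X}$, $x_k\to x$, and $\delta_k\to 0^+$ with $(x_k-x)/\delta_k\to v$. Clarke tangent cone: $T^C_x\mathcal{X}:=\liminf_{y\to x}T_y\mathcal{X}$, i.e. the set of $v$ such that for every sequence $x_k\in\mathcal{X}$, $x_k\to x$, there are (for all large $k$) $v_k\in T_{x_k}\mathcal{X}$ with $v_k\to v$. $\mathcal{X}$ is Clarke regular if it is locally compact (the intersection of a closed and an open subset of $\mathbb{R}^n$) and $T_x\mathcal{X}=T_x^C\mathcal{X}$ for all $x\in\mathcal{X}$. Euclidean normal cone: $N_x\mathcal{X}:=\{\eta\mid\langle v,\eta\rangle\le 0\ \forall v\in T_x^C\mathcal{X}\}$. Prox-regularity: a Clarke regular set $\mathcal{X}$ is prox-regular if for every $x\in\mathcal{X}$ there is $L>0$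 such that for all $z,y\in\mathcal{X}$ in a neighborhood of $x$ and all $\eta\in N_y\mathcal{X}$ one has $\langle\eta,z-y\rangle\le L\|\eta\|\,\|z-y\|^2$. (This property does not depend on whether the Euclidean or another continuous metric is used.) Metric: a map $g$ assigning to every $x\in\mathcal{X}$ an inner product $\langle\cdot,\cdot\rangle_{g(x)}$ on $\mathbb{R}^n$, with norm $\|\cdot\|_{g(x)}$; it is $C^{0,1}$ if it is so as a map into the space of bilinear forms on $\mathbb{R}^n$. Projected vector field: $\Pi_{\mathcal{X}}^{g}[f](x):=\arg\min_{v\in T_x\mathcal{X}}\|v-f(x)\|^2_{g(x)}$. Krasovskii regularization of $F:\mathcal{X}\rightrightarrows\mathbb{R}^n$: $\mathrm{K}[F](x)$ is the closed convex hull of $\limsup_{y\to x}F(y)$, the set of all $v$ for which there are $x_k\in\mathcal{X}$, $x_k\to x$, and $v_k\in F(x_k)$ with $v_k\to v$. A Carathéodory (resp. Krasovskii) solution is an absolutely continuous $x:[0,T)\to\mathcal{X}$, $T>0$, with $x(0)=x_0$ and $\dot x(t)\in\Pi_{\mathcal{X}}^{g}[f](x(t))$ (resp. $\dot x(t)\in\mathrm{K}[\Pi_{\mathcal{X}}^{g}[f]](x(t))$) for almost all $t$. *)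

theory Defs
  imports "HOL-Analysis.Analysis"
begin

definition tangent_cone :: "'a::euclidean_space set \<Rightarrow> 'a \<Rightarrow> 'a set" where
  "tangent_cone X x = {v. \<exists>xs \<delta>. (\<forall>k. xs k \<in> X) \<and> xs \<longlonglongrightarrow> x \<and>
     (\<forall>k. \<delta> k > 0) \<and> \<delta> \<longlonglongrightarrow> (0::real) \<and>
     (\<lambda>k. (xs k - x) /\<^sub>R \<delta> k) \<longlonglongrightarrow> v}"

definition clarke_tangent_cone :: "'a::euclidean_space set \<Rightarrow> 'a \<Rightarrow> 'a set" where
  "clarke_tangent_cone X x = {v. \<forall>xs. (\<forall>k. xs k \<in> X) \<and> xs \<longlonglongrightarrow> x \<longrightarrow>
     (\<exists>vs. (\<forall>\<^sub>F k in sequentially. vs k \<in> tangent_cone X (xs k)) \<and> vs \<longlonglongrightarrow> v)}"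

text \<open>In a Euclidean space, local compactness means being the intersection of a closed and an
  open set, see \<open>locally_compact_closed_Int_open\<close>.\<close>

definition clarke_regular :: "'a::euclidean_space set \<Rightarrow> bool" where
  "clarke_regular X \<longleftrightarrow>
     locally compact X \<and> (\<forall>x\<in>X. tangent_cone X x = clarke_tangent_cone X x)"

definition normal_cone :: "'a::euclidean_space set \<Rightarrow> 'a \<Rightarrow> 'a set" where
  "normal_cone X x = {\<eta>. \<forall>v\<in>clarke_tangent_cone X x. v \<bullet> \<eta> \<le> 0}"

definition prox_regular :: "'a::euclidean_space set \<Rightarrow> bool" where
  "prox_regular X \<longleftrightarrow> clarke_regular X \<and>
     (\<forall>x\<in>X. \<exists>L>0. \<exists>U. open U \<and> x \<in> U \<and>
        (\<forall>z\<in>X \<inter> U. \<forall>y\<in>X \<inter> U. \<forall>\<eta>\<in>normal_cone X y.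
           \<eta> \<bullet> (z - y) \<le> L * norm \<eta> * (norm (z - y))\<^sup>2))"

definition locally_lipschitz_on :: "'a::metric_space set \<Rightarrow> ('a \<Rightarrow> 'b::metric_space) \<Rightarrow> bool" where
  "locally_lipschitz_on X h \<longleftrightarrow>
     (\<forall>x\<in>X. \<exists>U L. open U \<and> x \<in> U \<and> L-lipschitz_on (X \<inter> U) h)"

text \<open>Bilinear forms are curried bounded linear maps, so that the space of bilinear forms carries
  the operator norm.\<close>

type_synonym 'a bilinear_form = "'a \<Rightarrow>\<^sub>L 'a \<Rightarrow>\<^sub>L real"

definition inner_product_form :: "'a::euclidean_space bilinear_form \<Rightarrow> bool" where
  "inner_product_form b \<longleftrightarrow>
     (\<forall>u v. blinfun_apply (blinfun_apply b u) v = blinfun_apply (blinfun_apply b v) u) \<and>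
     (\<forall>u. u \<noteq> 0 \<longrightarrow> blinfun_apply (blinfun_apply b u) u > 0)"

definition form_norm :: "'a::euclidean_space bilinear_form \<Rightarrow> 'a \<Rightarrow> real" where
  "form_norm b u = sqrt (blinfun_apply (blinfun_apply b u) u)"

definition metric_on :: "'a::euclidean_space set \<Rightarrow> ('a \<Rightarrow> 'a bilinear_form) \<Rightarrow> bool" where
  "metric_on X g \<longleftrightarrow> (\<forall>x\<in>X. inner_product_form (g x))"

definition projected_field ::
  "'a::euclidean_space set \<Rightarrow> ('a \<Rightarrow> 'a bilinear_form) \<Rightarrow> ('a \<Rightarrow> 'a) \<Rightarrow> 'a \<Rightarrow> 'a set" where
  "projected_field X g f x =
     {v. is_arg_min (\<lambda>w. (form_norm (g x) (w - f x))\<^sup>2) (\<lambda>w. w \<in> tangent_cone X x) v}"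

definition outer_limit :: "'a::euclidean_space set \<Rightarrow> ('a \<Rightarrow> 'a set) \<Rightarrow> 'a \<Rightarrow> 'a set" where
  "outer_limit X F x = {v. \<exists>xs vs. (\<forall>k. xs k \<in> X) \<and> xs \<longlonglongrightarrow> x \<and>
     (\<forall>k. vs k \<in> F (xs k)) \<and> vs \<longlonglongrightarrow> v}"

definition krasovskii_regularization ::
  "'a::euclidean_space set \<Rightarrow> ('a \<Rightarrow> 'a set) \<Rightarrow> 'a \<Rightarrow> 'a set" where
  "krasovskii_regularization X F x = closure (convex hull (outer_limit X F x))"

text \<open>A finite family of non-overlapping subintervals is encoded by the set of pairs of its
  endpoints; the intervals may share endpoints.\<close>

definition absolutely_continuous_on :: "real set \<Rightarrow> (real \<Rightarrow> 'a::real_normed_vector) \<Rightarrow> bool" where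
  "absolutely_continuous_on S x \<longleftrightarrow>
     (\<forall>\<epsilon>>0. \<exists>\<delta>>0. \<forall>D. finite D \<and> (\<forall>(a, b)\<in>D. a \<le> b \<and> {a..b} \<subseteq> S) \<and>
        disjoint_family_on (\<lambda>(a, b). {a<..<b}) D \<and> (\<Sum>(a, b)\<in>D. b - a) < \<delta> \<longrightarrow>
        (\<Sum>(a, b)\<in>D. norm (x b - x a)) < \<epsilon>)"

text \<open>Only the values of \<open>x\<close> on \<open>[0, T)\<close> matter: the derivative is taken within this interval,
  which at interior points is the ordinary derivative.\<close>

definition inclusion_solution ::
  "'a::euclidean_space set \<Rightarrow> ('a \<Rightarrow> 'a set) \<Rightarrow> 'a \<Rightarrow> real \<Rightarrow> (real \<Rightarrow> 'a) \<Rightarrow> bool" where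
  "inclusion_solution X F x0 T x \<longleftrightarrow> T > 0 \<and> (\<forall>t\<in>{0..<T}. x t \<in> X) \<and>
     absolutely_continuous_on {0..<T} x \<and> x 0 = x0 \<and>
     (AE t in lebesgue_on {0..<T}.
        \<exists>v\<in>F (x t). (x has_vector_derivative v) (at t within {0..<T}))"

definition caratheodory_solution ::
  "'a::euclidean_space set \<Rightarrow> ('a \<Rightarrow> 'a bilinear_form) \<Rightarrow> ('a \<Rightarrow> 'a) \<Rightarrow> 'a \<Rightarrow> real \<Rightarrow>
     (real \<Rightarrow> 'a) \<Rightarrow> bool" where
  "caratheodory_solution X g f x0 T x \<longleftrightarrow>
     inclusion_solution X (projected_field X g f) x0 T x"

definition krasovskii_solution ::
  "'a::euclidean_space set \<Rightarrow> ('a \<Rightarrow> 'a bilinear_form) \<Rightarrow> ('a \<Rightarrow> 'a) \<Rightarrow> 'a \<Rightarrow> real \<Rightarrow>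
     (real \<Rightarrow> 'a) \<Rightarrow> bool" where
  "krasovskii_solution X g f x0 T x \<longleftrightarrow>
     inclusion_solution X (krasovskii_regularization X (projected_field X g f)) x0 T x"

end

theory Submission
  imports Defs
begin

text \<open>A velocity \<open>v\<close> of the projected field, or of its Krasovskii regularization, at \<open>x\<close> satisfies
  \<open>g x (f x - v) \<in> N x\<close> and is bounded, because normals have a closed graph on a Clarke regular set.
  For two solutions \<open>y\<close>, \<open>z\<close> prox-regularity bounds \<open>g y (y' - z') (y - z)\<close> by
  \<open>const * |y - z|^2\<close>, and \<open>g\<close> is Lipschitz along the Lipschitz curve \<open>y\<close>, so that
  \<open>g y (y - z) (y - z)\<close> satisfies a Gronwall inequality and vanishes.

  For existence, implicit Euler steps minimize \<open>|p - (x + h f x)|\<close> in the norm of \<open>g x\<close> over \<open>p \<in> X\<close>.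
  Their residuals are normals, and telescoping the prox inequality gives
  \<open>g (x s) ((t - s) f (x s) - (x t - x s)) (z - x s) \<le> Q (t - s) (|z - x s|^2 + (t - s))\<close>
  up to the mesh size for all \<open>z \<in> X\<close> near \<open>x s\<close>, which passes to a pointwise cluster point \<open>x\<close>. That limit is
  Lipschitz; wherever it is differentiable, with derivative \<open>v\<close>, both \<open>v\<close> and \<open>- v\<close> are tangent
  and \<open>g x (f x - v)\<close> is a normal, so that \<open>v\<close> is the projection of \<open>f x\<close>.\<close>

section \<open>Differentiability of Lipschitz curves\<close>

text \<open>The residual of \<open>y\<close> is a normal through \<open>g y\<close>, that of
  \<open>z\<close> through \<open>g z\<close>. Expressing both by the single form \<open>g y\<close>
  costs \<open>g y - g z\<close>, applied to a bounded residual and to \<open>y - z\<close>, which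
  is again quadratic; here the speed bound enters. Along \<open>y\<close> the form \<open>g\<close>
  need not be differentiable, so its variation is treated as a Lipschitz error, not by a product
  rule.

  Solutions are merely absolutely continuous, so velocity bounds that hold almost everywhere are
  turned into increments by a gauge argument.

  The velocities of the discrete scheme need not converge, so normality cannot be passed to the
  limit directly. It is replaced by an inequality tested against points of \<open>X\<close> instead
  of tangents, which is stable under pointwise limits. Its two errors are harmless: the one in
  \<open>t - s\<close> vanishes after division by \<open>t - s\<close>, the quadratic one to first
  order as \<open>z\<close> approaches \<open>x s\<close> along a tangent. Tangency of
  \<open>- v\<close> is what turns normality of the residual into minimality over the whole cone.

  Uniqueness is shown for Krasovskii solutions only, since every Caratheodory solution is
  one.\<close>

lemma emeasure_image_le_slope:
  fixes f h :: "real \<Rightarrow> real"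
  assumes mono: "strict_mono f" and hf: "\<And>x. h (f x) = x" and fh: "\<And>y. f (h y) = y"
    and lip: "K-lipschitz_on UNIV f" and conth: "continuous_on UNIV h"
    and E: "E \<in> sets borel" and p: "p > 0"
    and slope: "\<And>t \<delta>. t \<in> E \<Longrightarrow> \<delta> > 0 \<Longrightarrow> \<exists>u v. u < t \<and> t < v \<and> v - u < \<delta> \<and> f v - f u < p * (v - u)"
  shows "emeasure lborel (f ` E) \<le> ennreal p * emeasure lborel E"
proof -
  have vimage: "f ` S = h -` S" for S
    using hf fh by (auto simp: image_iff) metis
  have bor: "f ` S \<in> sets borel" if "S \<in> sets borel" for S
    unfolding vimage using borel_measurable_continuous_onI[OF conth] that
    by (metis measurable_sets_borel)
  have fball: "f ` ball c r = {f (c - r)<..<f (c + r)}" for c r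
    unfolding vimage
    using strict_mono_less[OF mono, of "c - r" "h _"] strict_mono_less[OF mono, of "h _" "c + r"]
    by (auto simp: fh dist_real_def abs_less_iff)
  \<comment> \<open>A Vitali covering by intervals of slope below \<open>p\<close>: a disjoint
    countable subfamily inside an open \<open>U\<close> close to \<open>E\<close> covers
    \<open>E\<close> up to a null set, which the Lipschitz map \<open>f\<close> sends to a null set.
    The image lengths then add up to at most \<open>p\<close> times the measure of
    \<open>U\<close>.\<close>
  have main: "emeasure lborel (f ` E) \<le> ennreal p * (emeasure lborel E + e)" if e: "e > 0" for e :: real
  proof -
    obtain U where U: "open U" "E \<subseteq> U" "emeasure lborel (U - E) < e"
      using outer_regular_lborel[OF E e] by metis
    define K' where "K' = {(c, r). r > 0 \<and> ball c r \<subseteq> U \<and> f (c + r) - f (c - r) < p * (2 * r)}"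
    have cov: "\<exists>i. i \<in> K' \<and> x \<in> ball (fst i) (snd i) \<and> snd i < d" if x: "x \<in> E" and d: "d > 0" for x d
    proof -
      obtain e' where e': "e' > 0" "ball x e' \<subseteq> U" using U x openE by blast
      obtain u v where uv: "u < x" "x < v" "v - u < min e' d" "f v - f u < p * (v - u)"
        using slope[OF x, of "min e' d"] e' d by auto
      define c r where "c = (u + v)/2" and "r = (v - u)/2"
      have cr: "c + r = v" "c - r = u" "2 * r = v - u" "r > 0" "r < d" "u < x" "x < v" "2 * r < e'"
        using uv by (auto simp: c_def r_def field_simps)
      then have "ball c r \<subseteq> ball x e'" "x \<in> ball c r"
        by (auto simp: dist_real_def abs_less_iff)
      then show ?thesis
        using uv(4) e' cr by (intro exI[of _ "(c, r)"]) (auto simp: K'_def)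
    qed
    obtain C where C: "countable C" "C \<subseteq> K'" "pairwise (\<lambda>i j. disjnt (ball (fst i) (snd i)) (ball (fst j) (snd j))) C"
      "negligible (E - (\<Union>i\<in>C. ball (fst i) (snd i)))"
      by (rule Vitali_covering_theorem_balls[of E K' fst snd, OF cov])
    let ?B = "\<lambda>i::real\<times>real. ball (fst i) (snd i)"
    have disj: "disjoint_family_on ?B C"
      using C(3) by (auto simp: disjoint_family_on_def pairwise_def disjnt_def)
    have disj': "disjoint_family_on (\<lambda>i. f ` ?B i) C"
      using disj image_Int[OF strict_mono_imp_inj_on[OF mono], symmetric]
      unfolding disjoint_family_on_def by (metis image_empty)
    define R where "R = f ` (E - (\<Union>i\<in>C. ?B i))"
    have UB: "(\<Union>i\<in>C. ?B i) \<in> sets borel" by (intro borel_open open_UN) simp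
    have Rb: "R \<in> sets borel" unfolding R_def using E UB by (intro bor) auto
    have "negligible R" unfolding R_def
      using C(4)
    proof (rule negligible_locally_Lipschitz_image[rotated])
      fix x assume "x \<in> E - (\<Union>i\<in>C. ?B i)"
      show "\<exists>T B. open T \<and> x \<in> T \<and> (\<forall>y\<in>(E - (\<Union>i\<in>C. ?B i)) \<inter> T. norm (f y - f x) \<le> B * norm (y - x))"
        using lip by (intro exI[of _ UNIV] exI[of _ K]) (auto simp: lipschitz_on_def dist_norm)
    qed simp
    then have R0: "emeasure lborel R = 0"
      using Rb by (simp add: negligible_iff_emeasure0 emeasure_completion)
    have FB: "(\<Union>i\<in>C. f ` ?B i) \<in> sets borel" using C(1) by (intro sets.countable_UN') (auto simp: fball)
    have "f ` E \<subseteq> R \<union> (\<Union>i\<in>C. f ` ?B i)" unfolding R_def by auto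
    then have "emeasure lborel (f ` E) \<le> emeasure lborel (R \<union> (\<Union>i\<in>C. f ` ?B i))"
      using Rb FB by (intro emeasure_mono) auto
    also have "\<dots> \<le> emeasure lborel R + emeasure lborel (\<Union>i\<in>C. f ` ?B i)"
      using Rb FB by (intro emeasure_subadditive) auto
    also have "\<dots> = emeasure lborel (\<Union>i\<in>C. f ` ?B i)" by (simp add: R0)
    also have "\<dots> = (\<integral>\<^sup>+i. emeasure lborel (f ` ?B i) \<partial>count_space C)"
      using disj' C(1) by (intro emeasure_UN_countable) (auto simp: fball)
    also have "\<dots> \<le> (\<integral>\<^sup>+i. ennreal p * emeasure lborel (?B i) \<partial>count_space C)"
    proof (rule nn_integral_mono)
      fix i assume "i \<in> space (count_space C)"
      then have i: "i \<in> K'" using C by auto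
      obtain c r where cr: "i = (c, r)" by fastforce
      have b: "ball c r = {c - r<..<c + r}" by (auto simp: dist_real_def abs_less_iff)
      have "r > 0" using i cr by (auto simp: K'_def)
      moreover have "f (c - r) < f (c + r)" using mono \<open>r > 0\<close> by (auto simp: strict_mono_def)
      ultimately show "emeasure lborel (f ` ?B i) \<le> ennreal p * emeasure lborel (?B i)"
        using i p fball[of c r] by (simp add: cr b K'_def ennreal_mult[symmetric] ennreal_leI)
    qed
    also have "\<dots> = ennreal p * (\<integral>\<^sup>+i. emeasure lborel (?B i) \<partial>count_space C)"
      by (rule nn_integral_cmult) auto
    also have "(\<integral>\<^sup>+i. emeasure lborel (?B i) \<partial>count_space C) = emeasure lborel (\<Union>i\<in>C. ?B i)"
      using disj C(1) by (intro emeasure_UN_countable[symmetric]) auto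
    also have "\<dots> \<le> emeasure lborel U"
      using U C(2) unfolding K'_def by (intro emeasure_mono) fastforce+
    also have "\<dots> \<le> emeasure lborel (E \<union> (U - E))"
      using U E by (intro emeasure_mono) auto
    also have "\<dots> \<le> emeasure lborel E + emeasure lborel (U - E)"
      using U E by (intro emeasure_subadditive) auto
    also have "\<dots> \<le> emeasure lborel E + e" using U(3) by (intro add_left_mono) auto
    finally show ?thesis by (simp add: mult_left_mono)
  qed
  show ?thesis
  proof (cases "emeasure lborel E = \<infinity>")
    case True then show ?thesis using p by (simp add: ennreal_mult_top)
  next
    case False
    then obtain m where m: "emeasure lborel E = ennreal m" "m \<ge> 0" by (cases "emeasure lborel E") auto
    show ?thesis
    proof (rule ennreal_le_epsilon)
      fix e :: real assume "e > 0"
      have "emeasure lborel (f ` E) \<le> ennreal p * (emeasure lborel E + ennreal (e/p))"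
        using main[of "e/p"] p \<open>e > 0\<close> by simp
      also have "\<dots> = ennreal p * emeasure lborel E + ennreal e"
        using p \<open>e > 0\<close> by (simp add: distrib_left ennreal_mult[symmetric])
      finally show "emeasure lborel (f ` E) \<le> ennreal p * emeasure lborel E + ennreal e" .
    qed
  qed
qed

text \<open>For each bound \<open>1 / Suc n\<close> the points straddled by an admissible interval
  form a union of open intervals. The set is a countable intersection of such open sets, whatever
  \<open>P\<close> is.\<close>

lemma borel_frequent_slope:
  fixes P :: "real \<Rightarrow> real \<Rightarrow> bool"
  shows "{t. \<forall>\<delta>>0. \<exists>u v. u < t \<and> t < v \<and> v - u < \<delta> \<and> P u v} \<in> sets borel"
proof -
  have "{t. \<forall>\<delta>>0. \<exists>u v. u < t \<and> t < v \<and> v - u < \<delta> \<and> P u v}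
     = (\<Inter>n::nat. \<Union>{{u<..<v} | u v. v - u < 1 / Suc n \<and> P u v})" (is "?L = ?R")
  proof (intro set_eqI iffI)
    fix t assume t: "t \<in> ?L"
    show "t \<in> ?R"
    proof
      fix n :: nat
      obtain u v where "u < t \<and> t < v \<and> v - u < 1 / Suc n \<and> P u v"
        using t by (auto dest!: spec[of _ "1 / real (Suc n)"])
      then show "t \<in> \<Union>{{u<..<v} | u v. v - u < 1 / Suc n \<and> P u v}"
        by (intro UnionI[of "{u<..<v}"]) auto
    qed
  next
    fix t assume t: "t \<in> ?R"
    show "t \<in> ?L"
    proof (intro CollectI allI impI)
      fix \<delta> :: real assume "\<delta> > 0"
      then obtain n where n: "1 / Suc n < \<delta>" using nat_approx_posE by blast
      from t have "t \<in> \<Union>{{u<..<v} | u v. v - u < 1 / Suc n \<and> P u v}" by blast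
      then obtain u v where "u < t" "t < v" "v - u < 1 / Suc n" "P u v" by auto
      then show "\<exists>u v. u < t \<and> t < v \<and> v - u < \<delta> \<and> P u v" using n
        by (intro exI[of _ u] exI[of _ v]) auto
    qed
  qed
  moreover have "open (\<Union>{{u<..<v} | u v. v - u < 1 / Suc n \<and> P u v})" for n by (auto intro: open_Union)
  ultimately show ?thesis by (auto intro!: sets.countable_INT)
qed

text \<open>Small straddling slopes on \<open>E\<close> contract the measure of \<open>E\<close> under \<open>f\<close>, large ones contract that
  of the image under the inverse; both together force measure zero.\<close>

lemma increasing_lipschitz_differentiable_AE:
  fixes f :: "real \<Rightarrow> real"
  assumes lip: "K-lipschitz_on UNIV f" and incr: "\<And>u v. u \<le> v \<Longrightarrow> v - u \<le> f v - f u"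
  shows "AE t in lborel. \<exists>c. (f has_real_derivative c) (at t)"
proof -
  have sm: "strict_mono f" unfolding strict_mono_def using incr by (smt (verit))
  have cont: "continuous_on UNIV f" using lip lipschitz_on_continuous_on by blast
  have surj: "\<exists>x. f x = y" for y
  proof -
    define M where "M = \<bar>y - f 0\<bar>"
    have M: "M \<ge> 0" "\<bar>y - f 0\<bar> \<le> M" by (auto simp: M_def)
    have "f (-M) \<le> y" "y \<le> f M" using incr[of "-M" 0] incr[of 0 M] M by auto
    then show ?thesis
      using IVT'[of f "-M" y M] M continuous_on_subset[OF cont] by auto
  qed
  define h where "h = inv f"
  have hf: "h (f x) = x" for x unfolding h_def by (simp add: strict_mono_imp_inj_on[OF sm] inv_f_f)
  have fh: "f (h y) = y" for y unfolding h_def using surj by (metis f_inv_into_f rangeI)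
  have hsm: "strict_mono h" unfolding strict_mono_def
    by (metis fh linorder_less_linear not_less_iff_gr_or_eq sm strict_mono_less)
  have hlip: "1-lipschitz_on UNIV h"
  proof (rule lipschitz_onI)
    fix x y :: real
    show "dist (h x) (h y) \<le> 1 * dist x y"
      using incr[of "h x" "h y"] incr[of "h y" "h x"] fh by (simp add: dist_real_def) (smt (verit))
  qed simp
  have conth: "continuous_on UNIV h" using hlip lipschitz_on_continuous_on by blast
  define lo where "lo p = {t. \<forall>\<delta>>0. \<exists>u v. u < t \<and> t < v \<and> v - u < \<delta> \<and> f v - f u < p * (v - u)}" for p
  define hi where "hi q = {t. \<forall>\<delta>>0. \<exists>u v. u < t \<and> t < v \<and> v - u < \<delta> \<and> q * (v - u) < f v - f u}" for q
  have lo_b: "lo p \<in> sets borel" and hi_b: "hi p \<in> sets borel" for p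
    unfolding lo_def hi_def by (rule borel_frequent_slope)+
  \<comment> \<open>The ball makes the measure of \<open>E\<close> finite, so that an estimate by
    \<open>p / q < 1\<close> times itself forces it to vanish.\<close>
  have null: "emeasure lborel (lo p \<inter> hi q \<inter> ball 0 n) = 0" if pq: "0 < p" "p < q" for p q and n :: real
  proof -
    define E where "E = lo p \<inter> hi q \<inter> ball 0 n"
    have Eb: "E \<in> sets borel" unfolding E_def using lo_b hi_b by auto
    have fE: "f ` E = h -` E" using hf fh by (auto simp: image_iff) metis
    have fEb: "f ` E \<in> sets borel"
      unfolding fE using borel_measurable_continuous_onI[OF conth] Eb by (metis measurable_sets_borel)
    have "emeasure lborel E \<le> emeasure lborel (ball (0::real) n)"
      unfolding E_def by (intro emeasure_mono) auto
    also have "\<dots> < \<infinity>" using emeasure_lborel_ball_finite by auto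
    finally have fin: "emeasure lborel E < \<infinity>" .
    have 1: "emeasure lborel (f ` E) \<le> ennreal p * emeasure lborel E"
      using emeasure_image_le_slope[OF sm hf fh lip conth Eb] pq by (auto simp: E_def lo_def)
    have "emeasure lborel (h ` (f ` E)) \<le> ennreal (1/q) * emeasure lborel (f ` E)"
    proof (rule emeasure_image_le_slope[OF hsm fh hf hlip cont fEb])
      show "1/q > 0" using pq by auto
      fix s \<delta> :: real assume s: "s \<in> f ` E" and d: "\<delta> > 0"
      then obtain t where t: "t \<in> E" "s = f t" by auto
      have K: "K \<ge> 0" using lip lipschitz_on_nonneg by blast
      \<comment> \<open>As \<open>f\<close> stretches lengths by at most \<open>K\<close>, an
        interval shorter than \<open>\<delta> / (K + 1)\<close> has an image shorter than
        \<open>\<delta>\<close>.\<close>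
      obtain u v where uv: "u < t" "t < v" "v - u < \<delta> / (K + 1)" "q * (v - u) < f v - f u"
        using t d K unfolding E_def hi_def by (auto dest!: spec[of _ "\<delta>/(K+1)"])
      have "\<bar>f v - f u\<bar> \<le> K * \<bar>v - u\<bar>" using lip by (auto simp: lipschitz_on_def dist_real_def)
      also have "\<dots> \<le> (K + 1) * (v - u)" using uv by (auto simp: algebra_simps)
      also have "\<dots> < \<delta>" using uv(3) K by (simp add: field_simps)
      finally have "f v - f u < \<delta>" by simp
      moreover have "f u < s" "s < f v" using uv t sm by (auto simp: strict_mono_def)
      moreover have "h (f v) - h (f u) < 1/q * (f v - f u)" using uv(4) pq by (simp add: hf field_simps)
      ultimately show "\<exists>u v. u < s \<and> s < v \<and> v - u < \<delta> \<and> h v - h u < 1/q * (v - u)" by blast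
    qed
    moreover have "h ` (f ` E) = E" by (auto simp: image_image hf)
    ultimately have "emeasure lborel E \<le> ennreal (1/q) * (ennreal p * emeasure lborel E)"
      using 1 by (metis order_trans mult_left_mono zero_le)
    also have "\<dots> = ennreal (p/q) * emeasure lborel E"
      using pq by (simp add: mult.assoc[symmetric] ennreal_mult[symmetric])
    finally have 2: "emeasure lborel E \<le> ennreal (p/q) * emeasure lborel E" .
    obtain m where m: "emeasure lborel E = ennreal m" "m \<ge> 0" using fin by (cases "emeasure lborel E") auto
    have "m \<le> p/q * m" using 2 pq m by (simp add: ennreal_mult[symmetric])
    then have "q * m \<le> p * m" using pq by (simp add: field_simps)
    then have "m \<le> 0" using pq m by (smt (verit) mult_right_less_imp_less mult_less_cancel_right)
    then show ?thesis using m E_def by simp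
  qed
  define N where "N = (\<Union>p\<in>{p\<in>\<rat>. 0 < p}. \<Union>q\<in>{q\<in>\<rat>. p < q}. \<Union>n::nat. lo p \<inter> hi q \<inter> ball 0 (real n))"
  have "N \<in> null_sets lborel"
    unfolding N_def using null lo_b hi_b countable_rat
    by (intro null_sets_UN' ) (auto simp: null_sets_def intro: countable_subset[of _ \<rat>])
  moreover have "\<exists>c. (f has_real_derivative c) (at t)" if tN: "t \<notin> N" for t
  proof -
    \<comment> \<open>Rational \<open>p'\<close> and \<open>q'\<close> between \<open>p\<close> and
      \<open>q\<close> reduce arbitrary pairs of slopes to the countably many pairs in
      \<open>N\<close>.\<close>
    have noE: False if pq: "0 < p" "p < q" and tlo: "t \<in> lo p" and thi: "t \<in> hi q" for p q
    proof -
      define d where "d = (q - p)/3"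
      have d: "d > 0" "p + d < q - d" using pq by (auto simp: d_def field_simps)
      obtain p' where p': "p' \<in> \<rat>" "p < p'" "p' < p + d" using Rats_dense_in_real[of p "p + d"] d by auto
      obtain q' where q': "q' \<in> \<rat>" "q - d < q'" "q' < q" using Rats_dense_in_real[of "q - d" q] d by auto
      have "t \<in> lo p'" unfolding lo_def
      proof (intro CollectI allI impI)
        fix \<delta> :: real assume "\<delta> > 0"
        then obtain u v where uv: "u < t" "t < v" "v - u < \<delta>" "f v - f u < p * (v - u)" 
          using tlo unfolding lo_def by blast
        moreover have "p * (v - u) \<le> p' * (v - u)" using p' uv by (intro mult_right_mono) auto
        ultimately show "\<exists>u v. u < t \<and> t < v \<and> v - u < \<delta> \<and> f v - f u < p' * (v - u)"
            by (intro exI[of _ u] exI[of _ v]) linarith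
      qed
      moreover have "t \<in> hi q'" unfolding hi_def
      proof (intro CollectI allI impI)
        fix \<delta> :: real assume "\<delta> > 0"
        then obtain u v where uv: "u < t" "t < v" "v - u < \<delta>" "q * (v - u) < f v - f u" 
          using thi unfolding hi_def by blast
        moreover have "q' * (v - u) \<le> q * (v - u)" using q' uv by (intro mult_right_mono) auto
        ultimately show "\<exists>u v. u < t \<and> t < v \<and> v - u < \<delta> \<and> q' * (v - u) < f v - f u"
            by (intro exI[of _ u] exI[of _ v]) linarith
      qed
      moreover obtain n :: nat where "\<bar>t\<bar> < n" using reals_Archimedean2 by blast
      ultimately have "t \<in> lo p' \<inter> hi q' \<inter> ball 0 (real n)" by simp
      moreover have "0 < p'" "p' < q'" using p' q' d pq by linarith+
      ultimately have "t \<in> N" unfolding N_def using p'(1) q'(1) by blast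
      then show False using tN by simp
    qed
    \<comment> \<open>The candidate derivative is a cluster point of symmetric difference quotients,
      which lie in \<open>{1..K}\<close> by the growth and Lipschitz bounds.\<close>
    define d where "d n = inverse (real (Suc n))" for n
    have d: "d n > 0" for n by (simp add: d_def)
    define s where "s n = (f (t + d n) - f (t - d n)) / (2 * d n)" for n
    have slip: "\<bar>f x - f y\<bar> \<le> K * \<bar>x - y\<bar>" for x y using lip by (auto simp: lipschitz_on_def dist_real_def)
    have s: "s n \<in> {1..K}" for n
    proof -
      have "2 * d n \<le> f (t + d n) - f (t - d n)" using incr[of "t - d n" "t + d n"] d[of n] by simp
      moreover have "f (t + d n) - f (t - d n) \<le> K * (2 * d n)"
        using slip[of "t + d n" "t - d n"] d[of n] by simp
      ultimately show ?thesis using d[of n] by (simp add: s_def divide_le_eq le_divide_eq)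
    qed
    then obtain c r where c: "c \<in> {1..K}" "strict_mono r" "(s \<circ> r) \<longlonglongrightarrow> c"
      using compact_Icc[of 1 K] unfolding compact_def by metis
    have freq: "\<exists>u v. u < t \<and> t < v \<and> v - u < \<delta> \<and> \<bar>(f v - f u) / (v - u) - c\<bar> < \<epsilon>" if "\<delta> > 0" "\<epsilon> > 0" for \<delta> \<epsilon>
    proof -
      have "\<forall>\<^sub>F n in sequentially. \<bar>s (r n) - c\<bar> < \<epsilon>"
        using c(3) that by (auto simp: tendsto_iff dist_real_def)
      moreover have "(\<lambda>n. 2 * d (r n)) \<longlonglongrightarrow> 2 * 0"
        unfolding d_def
        by (intro tendsto_intros LIMSEQ_subseq_LIMSEQ[OF LIMSEQ_inverse_real_of_nat c(2), unfolded o_def])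
      then have "\<forall>\<^sub>F n in sequentially. 2 * d (r n) < \<delta>"
        using that by (intro order_tendstoD(2)) auto
      ultimately obtain n where n: "\<bar>s (r n) - c\<bar> < \<epsilon>" "2 * d (r n) < \<delta>"
        using eventually_happens'[OF sequentially_bot eventually_conj] by blast
      then show ?thesis using d[of "r n"]
        by (intro exI[of _ "t - d (r n)"] exI[of _ "t + d (r n)"]) (auto simp: s_def)
    qed
    have unslope: "a < (c + \<epsilon>) * w \<and> (c - \<epsilon>) * w < a" if "\<bar>a / w - c\<bar> < \<epsilon>" "0 < w" for a w \<epsilon>
    proof -
      have "a / w < c + \<epsilon>" "c - \<epsilon> < a / w" using that(1) by linarith+
      then show ?thesis using that(2) by (simp add: pos_divide_less_eq pos_less_divide_eq)
    qed
    \<comment> \<open>Otherwise slopes above \<open>c + e\<close>, or slopes below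
      \<open>c - e\<close>, occur at arbitrarily small scales, while slopes close to
      \<open>c\<close> do so as well. Two separated slopes are excluded by
      \<open>noE\<close>.\<close>
    have key: "\<exists>\<delta>>0. \<forall>u v. u < t \<and> t < v \<and> v - u < \<delta> \<longrightarrow> \<bar>(f v - f u) - c * (v - u)\<bar> \<le> \<epsilon> * (v - u)" if e: "\<epsilon> > 0" for \<epsilon>
    proof (rule ccontr)
      assume neg: "\<not> ?thesis"
      have "c \<ge> 1" using c by auto
      \<comment> \<open>Since \<open>c \<ge> 1\<close>, the cap \<open>1/2\<close> keeps
        \<open>c - e\<close> positive, as \<open>noE\<close> requires.\<close>
      define e where "e = min \<epsilon> (1/2)"
      have e: "e > 0" "e \<le> \<epsilon>" "e \<le> 1/2" using e by (auto simp: e_def)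
      have bad: "\<exists>u v. u < t \<and> t < v \<and> v - u < \<delta> \<and> \<bar>(f v - f u) - c * (v - u)\<bar> > \<epsilon> * (v - u)" if "\<delta> > 0" for \<delta>
        using neg that by (auto simp: not_le)
      have "t \<in> hi (c + e) \<or> t \<in> lo (c - e)"
      proof (rule ccontr)
        assume "\<not> ?thesis"
        then obtain d1 d2 where d: "d1 > 0" "d2 > 0"
           "\<And>u v. u < t \<and> t < v \<and> v - u < d1 \<Longrightarrow> \<not> (c + e) * (v - u) < f v - f u"
           "\<And>u v. u < t \<and> t < v \<and> v - u < d2 \<Longrightarrow> \<not> (c - e) * (v - u) > f v - f u"
          unfolding hi_def lo_def by blast
        obtain u v where uv: "u < t" "t < v" "v - u < min d1 d2" "\<bar>(f v - f u) - c * (v - u)\<bar> > \<epsilon> * (v - u)"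
          using bad[of "min d1 d2"] d by auto
        have "e * (v - u) \<le> \<epsilon> * (v - u)" using e uv by (intro mult_right_mono) auto
        then show False using d(3)[of u v] d(4)[of u v] uv by (auto simp: algebra_simps abs_if split: if_splits)
      qed
      then show False
      proof
        assume h: "t \<in> hi (c + e)"
        have "t \<in> lo (c + e/2)" unfolding lo_def
        proof (intro CollectI allI impI)
          fix \<delta> :: real assume "\<delta> > 0"
          then obtain u v where uv: "u < t" "t < v" "v - u < \<delta>" "\<bar>(f v - f u) / (v - u) - c\<bar> < e/2"
            using freq[of \<delta> "e/2"] e by auto
          then have "f v - f u < (c + e/2) * (v - u)" using unslope by auto
          then show "\<exists>u v. u < t \<and> t < v \<and> v - u < \<delta> \<and> f v - f u < (c + e/2) * (v - u)" using uv by blast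
        qed
        then show False using noE[of "c + e/2" "c + e"] h e \<open>c \<ge> 1\<close> by auto
      next
        assume h: "t \<in> lo (c - e)"
        have "t \<in> hi (c - e/2)" unfolding hi_def
        proof (intro CollectI allI impI)
          fix \<delta> :: real assume "\<delta> > 0"
          then obtain u v where uv: "u < t" "t < v" "v - u < \<delta>" "\<bar>(f v - f u) / (v - u) - c\<bar> < e/2"
            using freq[of \<delta> "e/2"] e by auto
          then have "f v - f u > (c - e/2) * (v - u)" using unslope by auto
          then show "\<exists>u v. u < t \<and> t < v \<and> v - u < \<delta> \<and> (c - e/2) * (v - u) < f v - f u" using uv by blast
        qed
        then show False using noE[of "c - e" "c - e/2"] h e \<open>c \<ge> 1\<close> by auto
      qed
    qed
    have contf: "(f \<longlongrightarrow> f t) (at t within S)" for S 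
      using cont by (metis continuous_on_eq_continuous_at continuous_within tendsto_within_subset open_UNIV UNIV_I subset_UNIV)
    have "(f has_derivative (*) c) (at t)"
      unfolding has_derivative_at_alt
    proof (intro conjI allI impI)
      show "bounded_linear ((*) c)" by (rule bounded_linear_mult_right)
      fix \<epsilon> :: real assume "\<epsilon> > 0"
      from key[OF this] obtain \<delta> where d: "\<delta> > 0" 
        "\<And>u v. u < t \<Longrightarrow> t < v \<Longrightarrow> v - u < \<delta> \<Longrightarrow> \<bar>(f v - f u) - c * (v - u)\<bar> \<le> \<epsilon> * (v - u)" by blast
      have "norm (f y - f t - c * (y - t)) \<le> \<epsilon> * norm (y - t)" if y: "norm (y - t) < \<delta>" for y
      proof -
        \<comment> \<open>So far \<open>t\<close> lies strictly inside the interval. Letting the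
          endpoint on the other side of \<open>t\<close> tend to \<open>t\<close> yields the
          one-sided quotients.\<close>
        consider "y = t" | "y > t" | "y < t" by linarith
        then show ?thesis
        proof cases
          case 2
          have ev: "\<forall>\<^sub>F u in at_left t. \<bar>(f y - f u) - c * (y - u)\<bar> \<le> \<epsilon> * (y - u)"
            unfolding eventually_at_left_field
            using d 2 y by (intro exI[of _ "y - \<delta>"]) auto
          have "((\<lambda>u. \<bar>(f y - f u) - c * (y - u)\<bar>) \<longlongrightarrow> \<bar>(f y - f t) - c * (y - t)\<bar>) (at_left t)"
            "((\<lambda>u. \<epsilon> * (y - u)) \<longlongrightarrow> \<epsilon> * (y - t)) (at_left t)"
            by (intro tendsto_intros contf)+
          from tendsto_le[OF _ this(2,1) ev] show ?thesis using 2 by auto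
        next
          case 3
          have ev: "\<forall>\<^sub>F v in at_right t. \<bar>(f v - f y) - c * (v - y)\<bar> \<le> \<epsilon> * (v - y)"
            unfolding eventually_at_right_field
            using d 3 y by (intro exI[of _ "y + \<delta>"]) auto
          have "((\<lambda>v. \<bar>(f v - f y) - c * (v - y)\<bar>) \<longlongrightarrow> \<bar>(f t - f y) - c * (t - y)\<bar>) (at_right t)"
            "((\<lambda>v. \<epsilon> * (v - y)) \<longlongrightarrow> \<epsilon> * (t - y)) (at_right t)"
            by (intro tendsto_intros contf)+
          from tendsto_le[OF _ this(2,1) ev] show ?thesis using 3 by (auto simp: abs_if algebra_simps split: if_splits)
        qed simp
      qed
      then show "\<exists>\<delta>>0. \<forall>y. norm (y - t) < \<delta> \<longrightarrow> norm (f y - f t - c * (y - t)) \<le> \<epsilon> * norm (y - t)"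
        using d(1) by blast
    qed
    then show ?thesis by (auto simp: has_field_derivative_def)
  qed
  ultimately show ?thesis by (intro AE_I'[of N]) auto
qed

text \<open>Adding \<open>(L + 1) * t\<close> to a coordinate makes its slopes at least 1 and keeps
  it Lipschitz, so that the increasing case applies; the linear term is subtracted afterwards.
  Finitely many coordinates share one null set.\<close>

lemma lipschitz_differentiable_AE:
  fixes x :: "real \<Rightarrow> 'a::euclidean_space"
  assumes lip: "L-lipschitz_on UNIV x"
  shows "AE t in lborel. \<exists>v. (x has_vector_derivative v) (at t)"
proof -
  have L: "L \<ge> 0" using lip lipschitz_on_nonneg by blast
  have 1: "AE t in lborel. \<exists>c. ((\<lambda>t. x t \<bullet> b) has_real_derivative c) (at t)" if b: "b \<in> Basis" for b
  proof -
    have xb: "\<bar>x u \<bullet> b - x v \<bullet> b\<bar> \<le> L * \<bar>u - v\<bar>" for u v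
    proof -
      have "\<bar>(x u - x v) \<bullet> b\<bar> \<le> norm (x u - x v)" using Basis_le_norm[OF b] by auto
      also have "\<dots> \<le> L * \<bar>u - v\<bar>" using lip by (auto simp: lipschitz_on_def dist_norm)
      finally show ?thesis by (simp add: inner_diff_left)
    qed
    let ?f = "\<lambda>t. x t \<bullet> b + (L + 1) * t"
    have "AE t in lborel. \<exists>c. (?f has_real_derivative c) (at t)"
    proof (rule increasing_lipschitz_differentiable_AE)
      show "(2 * L + 1)-lipschitz_on UNIV ?f"
      proof (rule lipschitz_onI)
        fix u v :: real
        have "?f u - ?f v = (x u \<bullet> b - x v \<bullet> b) + (L + 1) * (u - v)" by (simp add: algebra_simps)
        then have "\<bar>?f u - ?f v\<bar> \<le> L * \<bar>u - v\<bar> + (L + 1) * \<bar>u - v\<bar>"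
          using xb[of u v] L abs_triangle_ineq[of "x u \<bullet> b - x v \<bullet> b" "(L + 1) * (u - v)"] by (simp add: abs_mult)
        then show "dist (?f u) (?f v) \<le> (2 * L + 1) * dist u v" by (simp add: dist_real_def algebra_simps)
      qed (use L in simp)
      fix u v :: real assume "u \<le> v"
      then show "v - u \<le> ?f v - ?f u" using xb[of u v] by (simp add: algebra_simps abs_le_iff)
    qed
    then show ?thesis
    proof (eventually_elim)
      case (elim t)
      then obtain c where "(?f has_real_derivative c) (at t)" by blast
      then have "((\<lambda>s. ?f s - (L + 1) * s) has_real_derivative (c - (L + 1) * 1)) (at t)"
        by (intro derivative_intros) auto
      then show ?case by auto
    qed
  qed
  have "AE t in lborel. \<forall>b\<in>Basis. \<exists>c. ((\<lambda>t. x t \<bullet> b) has_real_derivative c) (at t)"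
    using 1 by (intro AE_finite_allI) auto
  then show ?thesis
  proof eventually_elim
    case (elim t)
    then obtain c where c: "\<And>b. b \<in> Basis \<Longrightarrow> ((\<lambda>t. x t \<bullet> b) has_real_derivative c b) (at t)" by metis
    have "((\<lambda>t. \<Sum>b\<in>Basis. (x t \<bullet> b) *\<^sub>R b) has_vector_derivative (\<Sum>b\<in>Basis. c b *\<^sub>R b)) (at t)"
      using c by (auto intro!: has_vector_derivative_sum derivative_eq_intros simp: )
    then show ?case by (auto simp: euclidean_representation)
  qed
qed

section \<open>Absolutely continuous functions\<close>

lemma absolutely_continuous_on_subset:
  assumes "absolutely_continuous_on S x" "T \<subseteq> S"
  shows "absolutely_continuous_on T x"
  unfolding absolutely_continuous_on_def
proof (intro allI impI)
  fix \<epsilon> :: real assume "\<epsilon> > 0"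
  then obtain \<delta> where d: "\<delta> > 0" "\<And>D. finite D \<and> (\<forall>(a, b)\<in>D. a \<le> b \<and> {a..b} \<subseteq> S) \<and>
        disjoint_family_on (\<lambda>(a, b). {a<..<b}) D \<and> (\<Sum>(a, b)\<in>D. b - a) < \<delta> \<Longrightarrow>
        (\<Sum>(a, b)\<in>D. norm (x b - x a)) < \<epsilon>"
    using assms(1) unfolding absolutely_continuous_on_def by blast
  show "\<exists>\<delta>>0. \<forall>D. finite D \<and> (\<forall>(a, b)\<in>D. a \<le> b \<and> {a..b} \<subseteq> T) \<and>
        disjoint_family_on (\<lambda>(a, b). {a<..<b}) D \<and> (\<Sum>(a, b)\<in>D. b - a) < \<delta> \<longrightarrow>
        (\<Sum>(a, b)\<in>D. norm (x b - x a)) < \<epsilon>"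
  proof (intro exI conjI allI impI)
    fix D assume D: "finite D \<and> (\<forall>(a, b)\<in>D. a \<le> b \<and> {a..b} \<subseteq> T) \<and>
        disjoint_family_on (\<lambda>(a, b). {a<..<b}) D \<and> (\<Sum>(a, b)\<in>D. b - a) < \<delta>"
    then have "\<forall>(a, b)\<in>D. a \<le> b \<and> {a..b} \<subseteq> S" using assms(2) by fast
    then show "(\<Sum>(a, b)\<in>D. norm (x b - x a)) < \<epsilon>" using D by (intro d) simp
  qed (fact d)
qed

lemma absolutely_continuous_on_Lipschitz_compose:
  assumes "absolutely_continuous_on S x" and C: "C > 0"
    and h: "\<And>s t. norm (y t - y s) \<le> C * norm (x t - x s)"
  shows "absolutely_continuous_on S y"
  unfolding absolutely_continuous_on_def
proof (intro allI impI)
  fix \<epsilon> :: real assume "\<epsilon> > 0"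
  then have "\<epsilon> / C > 0" using C by simp
  then obtain \<delta> where d: "\<delta> > 0" "\<And>D. finite D \<and> (\<forall>(a, b)\<in>D. a \<le> b \<and> {a..b} \<subseteq> S) \<and>
        disjoint_family_on (\<lambda>(a, b). {a<..<b}) D \<and> (\<Sum>(a, b)\<in>D. b - a) < \<delta> \<Longrightarrow>
        (\<Sum>(a, b)\<in>D. norm (x b - x a)) < \<epsilon> / C"
    using assms(1) unfolding absolutely_continuous_on_def by blast
  show "\<exists>\<delta>>0. \<forall>D. finite D \<and> (\<forall>(a, b)\<in>D. a \<le> b \<and> {a..b} \<subseteq> S) \<and>
        disjoint_family_on (\<lambda>(a, b). {a<..<b}) D \<and> (\<Sum>(a, b)\<in>D. b - a) < \<delta> \<longrightarrow>
        (\<Sum>(a, b)\<in>D. norm (y b - y a)) < \<epsilon>"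
  proof (intro exI conjI allI impI)
    fix D assume D: "finite D \<and> (\<forall>(a, b)\<in>D. a \<le> b \<and> {a..b} \<subseteq> S) \<and>
        disjoint_family_on (\<lambda>(a, b). {a<..<b}) D \<and> (\<Sum>(a, b)\<in>D. b - a) < \<delta>"
    have "(\<Sum>(a, b)\<in>D. norm (y b - y a)) \<le> (\<Sum>(a, b)\<in>D. C * norm (x b - x a))"
      by (intro sum_mono) (auto simp: h)
    also have "\<dots> = C * (\<Sum>(a, b)\<in>D. norm (x b - x a))"
      by (simp add: sum_distrib_left case_prod_unfold)
    also have "\<dots> < \<epsilon>" using d(2)[OF D] C by (simp add: pos_less_divide_eq mult.commute)
    finally show "(\<Sum>(a, b)\<in>D. norm (y b - y a)) < \<epsilon>" .
  qed (fact d)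
qed

lemma lipschitz_imp_absolutely_continuous_on:
  assumes lip: "L-lipschitz_on S x"
  shows "absolutely_continuous_on S x"
  unfolding absolutely_continuous_on_def
proof (intro allI impI)
  fix \<epsilon> :: real assume e: "\<epsilon> > 0"
  have L: "L \<ge> 0" using lip lipschitz_on_nonneg by blast
  show "\<exists>\<delta>>0. \<forall>D. finite D \<and> (\<forall>(a, b)\<in>D. a \<le> b \<and> {a..b} \<subseteq> S) \<and>
        disjoint_family_on (\<lambda>(a, b). {a<..<b}) D \<and> (\<Sum>(a, b)\<in>D. b - a) < \<delta> \<longrightarrow>
        (\<Sum>(a, b)\<in>D. norm (x b - x a)) < \<epsilon>"
  proof (intro exI[of _ "\<epsilon> / (L + 1)"] conjI allI impI)
    show "\<epsilon> / (L + 1) > 0" using e L by simp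
    fix D :: "(real \<times> real) set" assume D: "finite D \<and> (\<forall>(a, b)\<in>D. a \<le> b \<and> {a..b} \<subseteq> S) \<and>
        disjoint_family_on (\<lambda>(a, b). {a<..<b}) D \<and> (\<Sum>(a, b)\<in>D. b - a) < \<epsilon> / (L + 1)"
    have 1: "norm (x b - x a) \<le> (L + 1) * (b - a)" if "(a, b) \<in> D" for a b
    proof -
      have ab: "a \<le> b" "a \<in> S" "b \<in> S" using D that by fastforce+
      then have "norm (x b - x a) \<le> L * (b - a)"
        using lipschitz_onD[OF lip, of b a] by (simp add: dist_norm)
      also have "\<dots> \<le> (L + 1) * (b - a)" using ab by (auto simp: mult_right_mono)
      finally show ?thesis .
    qed
    have "(\<Sum>(a, b)\<in>D. norm (x b - x a)) \<le> (\<Sum>(a, b)\<in>D. (L + 1) * (b - a))"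
      using 1 by (intro sum_mono) auto
    also have "\<dots> = (L + 1) * (\<Sum>(a, b)\<in>D. b - a)"
      by (simp add: sum_distrib_left case_prod_unfold)
    also have "\<dots> < \<epsilon>" using D L by (simp add: pos_less_divide_eq mult.commute)
    finally show "(\<Sum>(a, b)\<in>D. norm (x b - x a)) < \<epsilon>" .
  qed
qed

lemma absolutely_continuous_on_imp_continuous_on:
  assumes "absolutely_continuous_on {a..b} x"
  shows "continuous_on {a..b} x"
  unfolding continuous_on_iff
proof (intro ballI allI impI)
  fix t \<epsilon> :: real assume t: "t \<in> {a..b}" and "\<epsilon> > 0"
  then obtain \<delta> where d: "\<delta> > 0" "\<And>D. finite D \<and> (\<forall>(c, d)\<in>D. c \<le> d \<and> {c..d} \<subseteq> {a..b}) \<and>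
        disjoint_family_on (\<lambda>(a, b). {a<..<b}) D \<and> (\<Sum>(a, b)\<in>D. b - a) < \<delta> \<Longrightarrow>
        (\<Sum>(a, b)\<in>D. norm (x b - x a)) < \<epsilon>"
    using assms unfolding absolutely_continuous_on_def by blast
  have "dist (x s) (x t) < \<epsilon>" if "s \<in> {a..b}" "dist s t < \<delta>" for s
  proof (cases "s \<le> t")
    case True
    then show ?thesis using d(2)[of "{(s, t)}"] t that
      by (auto simp: disjoint_family_on_def dist_real_def dist_norm norm_minus_commute)
  next
    case False
    then show ?thesis using d(2)[of "{(t, s)}"] t that
      by (auto simp: disjoint_family_on_def dist_real_def dist_norm)
  qed
  then show "\<exists>d>0. \<forall>s\<in>{a..b}. dist s t < d \<longrightarrow> dist (x s) (x t) < \<epsilon>" using d(1) by blast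
qed

text \<open>Integrates a derivative bound that may fail on a null set. In a fine tagged division the
  intervals tagged outside \<open>N\<close> obey the straddle estimate; those tagged in
  \<open>N\<close> have small total length, so absolute continuity makes their increments
  small.\<close>

lemma absolutely_continuous_increment_le:
  fixes \<phi> :: "real \<Rightarrow> real"
  assumes ac: "absolutely_continuous_on {a..b} \<phi>" and ab: "a \<le> b" and N: "negligible N" and M: "M \<ge> 0"
    and straddle: "\<And>t \<epsilon>. t \<in> {a..b} - N \<Longrightarrow> \<epsilon> > 0 \<Longrightarrow>
      \<exists>\<delta>>0. \<forall>u v. a \<le> u \<and> u \<le> t \<and> t \<le> v \<and> v \<le> b \<and> v - u < \<delta> \<longrightarrow> \<phi> v - \<phi> u \<le> (M + \<epsilon>) * (v - u)"
  shows "\<phi> b - \<phi> a \<le> M * (b - a)"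
proof -
  have main: "\<phi> b - \<phi> a \<le> (M + \<epsilon>) * (b - a) + \<epsilon>" if e: "\<epsilon> > 0" for \<epsilon>
  proof -
    obtain d where d: "d > 0" "\<And>D. finite D \<and> (\<forall>(c, d)\<in>D. c \<le> d \<and> {c..d} \<subseteq> {a..b}) \<and>
        disjoint_family_on (\<lambda>(a, b). {a<..<b}) D \<and> (\<Sum>(a, b)\<in>D. b - a) < d \<Longrightarrow>
        (\<Sum>(a, b)\<in>D. norm (\<phi> b - \<phi> a)) < \<epsilon>"
      using ac e unfolding absolutely_continuous_on_def by blast
    \<comment> \<open>Negligibility is used as a vanishing integral: its gauge bounds the total
      length of the intervals tagged in \<open>N\<close> by \<open>d\<close>.\<close>
    have "(indicat_real N has_integral 0) {a..b}"
      using N unfolding negligible_def by (metis box_real(2))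
    from this[unfolded has_integral_real, rule_format, OF d(1)]
    obtain \<gamma> where \<gamma>: "gauge \<gamma>" and \<gamma>_sum: "\<And>p. p tagged_division_of {a..b} \<and> \<gamma> fine p \<Longrightarrow>
       norm ((\<Sum>(t, K)\<in>p. measure lborel K *\<^sub>R indicat_real N t) - 0) < d"
      by auto
    have "\<forall>t. \<exists>\<delta>>0. t \<in> {a..b} - N \<longrightarrow> (\<forall>u v. a \<le> u \<and> u \<le> t \<and> t \<le> v \<and> v \<le> b \<and> v - u < \<delta> \<longrightarrow> \<phi> v - \<phi> u \<le> (M + \<epsilon>) * (v - u))"
      using straddle[OF _ e] by (metis zero_less_one)
    then obtain \<delta> where \<delta>: "\<And>t. \<delta> t > 0" "\<And>t u v. t \<in> {a..b} - N \<Longrightarrow> a \<le> u \<Longrightarrow> u \<le> t \<Longrightarrow> t \<le> v \<Longrightarrow> v \<le> b \<Longrightarrow> v - u < \<delta> t \<Longrightarrow> \<phi> v - \<phi> u \<le> (M + \<epsilon>) * (v - u)"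
      by metis
    \<comment> \<open>Both ends of an interval lie within \<open>\<delta> t / 2\<close> of its tag,
      so its length stays below \<open>\<delta> t\<close>.\<close>
    define \<gamma>' where "\<gamma>' t = \<gamma> t \<inter> ball t (\<delta> t / 2)" for t
    have "gauge \<gamma>'" unfolding \<gamma>'_def using \<gamma> \<delta>(1) by (intro gauge_Int gauge_ball_dependent) auto
    then obtain p where p: "p tagged_division_of {a..b}" "\<gamma>' fine p" using fine_division_exists_real by blast
    have pc: "p tagged_division_of cbox a b" using p by simp
    have fin: "finite p" using p by blast
    have pK: "\<exists>u v. K = {u..v} \<and> u \<le> t \<and> t \<le> v \<and> a \<le> u \<and> v \<le> b" if tK: "(t, K) \<in> p" for t K
    proof -
      obtain u v where K: "K = {u..v}" using tagged_division_ofD(4)[OF pc tK] by auto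
      moreover have "t \<in> K" "K \<subseteq> {a..b}" using tagged_division_ofD(2,3)[OF pc tK] by auto
      ultimately show ?thesis by fastforce
    qed
    \<comment> \<open>Degenerate intervals go into \<open>rest\<close>, where increments vanish. The
      remaining bad ones have nonempty and pairwise disjoint interiors, which makes the passage to
      pairs of endpoints injective.\<close>
    define bad where "bad = {(t, K)\<in>p. t \<in> N \<and> Inf K < Sup K}"
    define good where "good = {(t, K)\<in>p. t \<notin> N}"
    define rest where "rest = {(t, K)\<in>p. t \<in> N \<and> \<not> Inf K < Sup K}"
    let ?inc = "\<lambda>(t::real, K). \<phi> (Sup K) - \<phi> (Inf K)"
    have fins: "finite bad" "finite good" "finite rest"
      unfolding bad_def good_def rest_def by (rule finite_subset[OF _ fin], force)+
    have part: "p = bad \<union> good \<union> rest" "bad \<inter> good = {}" "(bad \<union> good) \<inter> rest = {}"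
      unfolding bad_def good_def rest_def by auto
    have split: "sum F p = sum F bad + sum F good + sum F rest" for F :: "real \<times> real set \<Rightarrow> real"
      using fins part by (simp add: sum.union_disjoint)
    have total: "sum ?inc p = \<phi> b - \<phi> a" using additive_tagged_division_1[OF ab p(1)] .
    have len: "(\<Sum>(t, K)\<in>p. Sup K - Inf K) = b - a" using additive_tagged_division_1[OF ab p(1), of "\<lambda>x. x"] .
    have nonneg: "0 \<le> Sup K - Inf K" if "(t, K) \<in> p" for t K using pK[OF that] by auto
    have restz: "sum ?inc rest = 0"
    proof (intro sum.neutral ballI)
      fix z assume "z \<in> rest"
      then obtain t K where z: "z = (t, K)" "(t, K) \<in> p" "\<not> Inf K < Sup K" by (auto simp: rest_def)
      obtain u v where K: "K = {u..v}" "u \<le> t" "t \<le> v" using pK[OF z(2)] by blast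
      then have "u = v" using z(3) by auto
      then show "?inc z = 0" using z(1) K by simp
    qed
    have "sum ?inc good \<le> (\<Sum>(t, K)\<in>good. (M + \<epsilon>) * (Sup K - Inf K))"
    proof (intro sum_mono)
      fix z assume "z \<in> good"
      then obtain t K where z: "z = (t, K)" "(t, K) \<in> p" "t \<notin> N" by (auto simp: good_def)
      obtain u v where K: "K = {u..v}" "u \<le> t" "t \<le> v" "a \<le> u" "v \<le> b" using pK[OF z(2)] by blast
      have "K \<subseteq> ball t (\<delta> t / 2)" using p(2) z(2) unfolding fine_def \<gamma>'_def by blast
      moreover have "u \<in> K" "v \<in> K" using K by auto
      ultimately have "u \<in> ball t (\<delta> t / 2)" "v \<in> ball t (\<delta> t / 2)" by blast+
      then have "v - u < \<delta> t" using K by (auto simp: dist_real_def)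
      then show "?inc z \<le> (\<lambda>(t, K). (M + \<epsilon>) * (Sup K - Inf K)) z" using \<delta>(2)[of t u v] K z by auto
    qed
    also have "\<dots> \<le> (\<Sum>(t, K)\<in>p. (M + \<epsilon>) * (Sup K - Inf K))"
      using M e nonneg by (intro sum_mono2 fin) (auto simp: good_def)
    also have "\<dots> = (M + \<epsilon>) * (b - a)"
      using len by (simp add: sum_distrib_left[symmetric] case_prod_unfold)
    finally have goodle: "sum ?inc good \<le> (M + \<epsilon>) * (b - a)" .
    define J where "J = (\<lambda>(t::real, K::real set). (Inf K, Sup K))"
    have badK: "\<exists>u v. z = (t, {u..v}) \<and> u < v \<and> u \<le> t \<and> t \<le> v \<and> a \<le> u \<and> v \<le> b \<and> z \<in> p \<and> t \<in> N" if zb: "z \<in> bad" "fst z = t" for z t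
    proof -
      obtain K where z: "z = (t, K)" "(t, K) \<in> p" "t \<in> N" "Inf K < Sup K" using zb by (auto simp: bad_def)
      then show ?thesis using pK[OF z(2)] by auto
    qed
    have badint: "z = z'" if zz: "z \<in> bad" "z' \<in> bad" and s: "s \<in> interior (snd z)" "s \<in> interior (snd z')" for z z' s
    proof (rule ccontr)
      assume "z \<noteq> z'"
      moreover have "(fst z, snd z) \<in> p" "(fst z', snd z') \<in> p" using zz by (auto simp: bad_def)
      ultimately have "interior (snd z) \<inter> interior (snd z') = {}"
        using tagged_division_ofD(5)[OF pc] by (metis prod.collapse)
      then show False using s by blast
    qed
    have int: "interior (snd z) = {fst (J z)<..<snd (J z)}" "fst (J z) < snd (J z)" if zb: "z \<in> bad" for z
    proof -
      obtain u v where "z = (fst z, {u..v})" "u < v" using badK[OF zb refl] by blast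
      then have "snd z = {u..v}" "u < v" by (metis snd_conv)+
      then show "interior (snd z) = {fst (J z)<..<snd (J z)}" "fst (J z) < snd (J z)"
        by (auto simp: J_def case_prod_unfold)
    qed
    have inj: "inj_on J bad"
    proof (rule inj_onI)
      fix z z' assume z: "z \<in> bad" "z' \<in> bad" "J z = J z'"
      show "z = z'"
        using badint[OF z(1,2), of "(fst (J z) + snd (J z)) / 2"] int[OF z(1)] int[OF z(2)] z(3) by auto
    qed
    have "(\<Sum>(c, d)\<in>J ` bad. norm (\<phi> d - \<phi> c)) < \<epsilon>"
    proof (rule d(2), intro conjI)
      show "finite (J ` bad)" using fins by simp
      show "\<forall>(c, d)\<in>J ` bad. c \<le> d \<and> {c..d} \<subseteq> {a..b}"
        using badK by (fastforce simp: J_def)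
      show "disjoint_family_on (\<lambda>(a, b). {a<..<b}) (J ` bad)"
        unfolding disjoint_family_on_def
      proof (intro ballI impI)
        fix c d assume "c \<in> J ` bad" "d \<in> J ` bad" "c \<noteq> d"
        then obtain z z' where z: "z \<in> bad" "z' \<in> bad" "c = J z" "d = J z'" "z \<noteq> z'" by blast
        then have "interior (snd z) \<inter> interior (snd z') = {}" using badint by blast
        then show "(case c of (a, b) \<Rightarrow> {a<..<b}) \<inter> (case d of (a, b) \<Rightarrow> {a<..<b}) = {}"
          using z int by (simp add: case_prod_unfold)
      qed
      have "(\<Sum>(c, d)\<in>J ` bad. d - c) = (\<Sum>(t, K)\<in>bad. Sup K - Inf K)"
        using inj by (subst sum.reindex) (auto simp: J_def case_prod_unfold o_def)
      also have "\<dots> = (\<Sum>(t, K)\<in>bad. measure lborel K *\<^sub>R indicat_real N t)"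
        using badK by (intro sum.cong) fastforce+
      also have "\<dots> \<le> (\<Sum>(t, K)\<in>p. measure lborel K *\<^sub>R indicat_real N t)"
        using part by (intro sum_mono2 fin) auto
      also have "\<dots> < d"
      proof -
        have "\<gamma> fine p" using p(2) unfolding fine_def \<gamma>'_def by blast
        then show ?thesis using \<gamma>_sum[of p] p(1) by simp
      qed
      finally show "(\<Sum>(c, d)\<in>J ` bad. d - c) < d" .
    qed
    moreover have "(\<Sum>(c, d)\<in>J ` bad. norm (\<phi> d - \<phi> c)) = (\<Sum>(t, K)\<in>bad. norm (\<phi> (Sup K) - \<phi> (Inf K)))"
      using inj by (subst sum.reindex) (auto simp: J_def case_prod_unfold o_def)
    moreover have "sum ?inc bad \<le> (\<Sum>(t, K)\<in>bad. norm (\<phi> (Sup K) - \<phi> (Inf K)))"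
      by (intro sum_mono) auto
    ultimately have "sum ?inc bad \<le> \<epsilon>" by linarith
    then show ?thesis using total split[of ?inc] restz goodle by linarith
  qed
  have "((\<lambda>\<epsilon>. (M + \<epsilon>) * (b - a) + \<epsilon>) \<longlongrightarrow> (M + 0) * (b - a) + 0) (at_right 0)"
    by (intro tendsto_intros)
  moreover have "\<forall>\<^sub>F \<epsilon> in at_right 0. \<phi> b - \<phi> a \<le> (M + \<epsilon>) * (b - a) + \<epsilon>"
    using main by (auto simp: eventually_at_right_field intro: exI[of _ 1])
  ultimately show ?thesis using tendsto_lowerbound[OF _ _ trivial_limit_at_right_real] by fastforce
qed

text \<open>The straddle lemma: splitting at \<open>t\<close> adds the errors of two one-sided
  expansions, whose lengths add up to \<open>v - u\<close>.\<close>

lemma has_vector_derivative_straddle: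
  assumes "(x has_vector_derivative x') (at t within S)" and "\<epsilon> > 0" and t: "t \<in> S"
  obtains \<delta> where "\<delta> > 0"
    "\<And>u v. u \<in> S \<Longrightarrow> v \<in> S \<Longrightarrow> u \<le> t \<Longrightarrow> t \<le> v \<Longrightarrow> v - u < \<delta> \<Longrightarrow> norm (x v - x u - (v - u) *\<^sub>R x') \<le> \<epsilon> * (v - u)"
proof -
  obtain \<delta> where d: "\<delta> > 0" "\<And>y. y \<in> S \<Longrightarrow> norm (y - t) < \<delta> \<Longrightarrow> norm (x y - x t - (y - t) *\<^sub>R x') \<le> \<epsilon> * norm (y - t)"
    using assms unfolding has_vector_derivative_def has_derivative_within_alt by blast
  show thesis
  proof (rule that[OF d(1)])
    fix u v assume uv: "u \<in> S" "v \<in> S" "u \<le> t" "t \<le> v" "v - u < \<delta>"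
    have eq: "x v - x u - (v - u) *\<^sub>R x' = (x v - x t - (v - t) *\<^sub>R x') - (x u - x t - (u - t) *\<^sub>R x')"
      by (simp add: algebra_simps)
    have "norm (x v - x u - (v - u) *\<^sub>R x') \<le> norm (x v - x t - (v - t) *\<^sub>R x') + norm (x u - x t - (u - t) *\<^sub>R x')"
      unfolding eq by (rule norm_triangle_ineq4)
    also have "\<dots> \<le> \<epsilon> * norm (v - t) + \<epsilon> * norm (u - t)"
      using uv by (intro add_mono d) auto
    also have "\<dots> = \<epsilon> * (v - u)" using uv by (simp add: algebra_simps)
    finally show "norm (x v - x u - (v - u) *\<^sub>R x') \<le> \<epsilon> * (v - u)" .
  qed
qed

text \<open>The scalar case is applied to the component along the direction \<open>e\<close> of the
  total increment, which recovers its full norm.\<close>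

lemma absolutely_continuous_increment_norm_le:
  fixes x :: "real \<Rightarrow> 'a::real_inner"
  assumes ac: "absolutely_continuous_on {a..b} x" and ab: "a \<le> b" and N: "negligible N" and M: "M \<ge> 0"
    and S: "{a..b} \<subseteq> S"
    and der: "\<And>t. t \<in> {a..b} - N \<Longrightarrow> \<exists>v. norm v \<le> M \<and> (x has_vector_derivative v) (at t within S)"
  shows "norm (x b - x a) \<le> M * (b - a)"
proof -
  define e where "e = sgn (x b - x a)"
  have e: "norm e \<le> 1" by (simp add: e_def norm_sgn)
  have ee: "w \<bullet> e \<le> norm w" for w
    using norm_cauchy_schwarz[of w e] mult_left_mono[OF e, of "norm w"] by simp
  have "(x b - x a) \<bullet> e = norm (x b - x a)"
    by (cases "x b = x a") (auto simp: e_def sgn_div_norm power2_norm_eq_inner[symmetric] power2_eq_square)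
  moreover have "x b \<bullet> e - x a \<bullet> e \<le> M * (b - a)"
  proof (rule absolutely_continuous_increment_le[OF _ ab N M])
    show "absolutely_continuous_on {a..b} (\<lambda>t. x t \<bullet> e)"
    proof (rule absolutely_continuous_on_Lipschitz_compose[OF ac, of 1])
      fix s t
      have "\<bar>(x t - x s) \<bullet> e\<bar> \<le> norm (x t - x s) * norm e" by (rule Cauchy_Schwarz_ineq2)
      also have "\<dots> \<le> norm (x t - x s) * 1" using e by (intro mult_left_mono) auto
      finally show "norm (x t \<bullet> e - x s \<bullet> e) \<le> 1 * norm (x t - x s)" by (simp add: inner_diff_left)
    qed simp
    fix t \<epsilon> :: real assume t: "t \<in> {a..b} - N" and "\<epsilon> > 0"
    obtain x' where x': "norm x' \<le> M" "(x has_vector_derivative x') (at t within S)" using der[OF t] by blast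
    obtain \<delta> where d: "\<delta> > 0" 
       "\<And>u v. u \<in> S \<Longrightarrow> v \<in> S \<Longrightarrow> u \<le> t \<Longrightarrow> t \<le> v \<Longrightarrow> v - u < \<delta> \<Longrightarrow> norm (x v - x u - (v - u) *\<^sub>R x') \<le> \<epsilon> * (v - u)"
      using has_vector_derivative_straddle[OF x'(2) \<open>\<epsilon> > 0\<close>] t S by blast
    have "x v \<bullet> e - x u \<bullet> e \<le> (M + \<epsilon>) * (v - u)" if uv: "a \<le> u \<and> u \<le> t \<and> t \<le> v \<and> v \<le> b \<and> v - u < \<delta>" for u v
    proof -
      have "x v \<bullet> e - x u \<bullet> e = (x v - x u - (v - u) *\<^sub>R x') \<bullet> e + (v - u) * (x' \<bullet> e)"
        by (simp add: inner_diff_left)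
      also have "\<dots> \<le> \<epsilon> * (v - u) + (v - u) * M"
      proof (intro add_mono mult_left_mono)
        show "(x v - x u - (v - u) *\<^sub>R x') \<bullet> e \<le> \<epsilon> * (v - u)"
          using ee d(2)[of u v] uv S t by (meson atLeastAtMost_iff order_trans subsetD DiffD1)
        show "x' \<bullet> e \<le> M" using ee[of x'] x' by linarith
      qed (use uv in auto)
      finally show ?thesis by (simp add: algebra_simps)
    qed
    then show "\<exists>\<delta>>0. \<forall>u v. a \<le> u \<and> u \<le> t \<and> t \<le> v \<and> v \<le> b \<and> v - u < \<delta> \<longrightarrow> x v \<bullet> e - x u \<bullet> e \<le> (M + \<epsilon>) * (v - u)"
      using d(1) by blast
  qed
  ultimately show ?thesis by (simp add: inner_diff_left)
qed

section \<open>Tangents and normals of prox-regular sets\<close>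

lemma tangent_cone_scale:
  assumes "v \<in> tangent_cone X x" "c > 0"
  shows "c *\<^sub>R v \<in> tangent_cone X x"
proof -
  obtain xs \<delta> where h: "\<forall>k. xs k \<in> X" "xs \<longlonglongrightarrow> x" "\<forall>k. \<delta> k > 0" "\<delta> \<longlonglongrightarrow> (0::real)"
     "(\<lambda>k. (xs k - x) /\<^sub>R \<delta> k) \<longlonglongrightarrow> v"
    using assms unfolding tangent_cone_def by blast
  have eq: "(\<lambda>k. (xs k - x) /\<^sub>R (\<delta> k / c)) = (\<lambda>k. c *\<^sub>R ((xs k - x) /\<^sub>R \<delta> k))"
    by (auto simp: field_simps)
  have "(\<lambda>k. (xs k - x) /\<^sub>R (\<delta> k / c)) \<longlonglongrightarrow> c *\<^sub>R v"
    unfolding eq by (intro tendsto_intros h(5))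
  moreover have "(\<lambda>k. \<delta> k / c) \<longlonglongrightarrow> 0" using tendsto_divide[OF h(4) tendsto_const[of c]] assms by simp
  ultimately show ?thesis using h assms unfolding tangent_cone_def
    by (intro CollectI exI[of _ xs] exI[of _ "\<lambda>k. \<delta> k / c"]) auto
qed

lemma zero_in_tangent_cone:
  assumes "x \<in> X"
  shows "0 \<in> tangent_cone X x"
  unfolding tangent_cone_def
proof (rule CollectI, rule exI[of _ "\<lambda>_. x"], rule exI[of _ "\<lambda>k. inverse (real (Suc k))"], intro conjI allI)
  show "(\<lambda>k. inverse (real (Suc k))) \<longlonglongrightarrow> 0" by (rule LIMSEQ_inverse_real_of_nat)
qed (use assms in simp_all)

text \<open>Normals are encoded as functionals, so that the residual \<open>g x (f x - v)\<close> of a projection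
  with respect to \<open>g\<close> is itself a normal.\<close>

definition tangent_polar :: "'a::euclidean_space set \<Rightarrow> 'a \<Rightarrow> ('a \<Rightarrow>\<^sub>L real) set" where
  "tangent_polar X x = {\<phi>. \<forall>w\<in>tangent_cone X x. blinfun_apply \<phi> w \<le> 0}"

lemma prox_regular_tangent_eq:
  assumes "prox_regular X" "x \<in> X"
  shows "tangent_cone X x = clarke_tangent_cone X x"
proof -
  have "\<forall>x\<in>X. tangent_cone X x = clarke_tangent_cone X x"
    using assms(1) unfolding prox_regular_def clarke_regular_def by (elim conjE)
  then show ?thesis using assms(2) by (rule bspec)
qed

text \<open>The Riesz representative \<open>\<eta>\<close> of \<open>\<phi>\<close> is a Euclidean
  normal because tangents and Clarke tangents agree, and its norm does not exceed that of
  \<open>\<phi>\<close>.\<close>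

lemma prox_regular_functional:
  fixes X :: "'a::euclidean_space set"
  assumes X: "prox_regular X" and x: "x \<in> X"
  obtains L r where "L > 0" "r > 0"
    "\<And>y z \<phi>. y \<in> X \<inter> cball x r \<Longrightarrow> z \<in> X \<inter> cball x r \<Longrightarrow> \<phi> \<in> tangent_polar X y \<Longrightarrow>
      blinfun_apply \<phi> (z - y) \<le> L * norm \<phi> * (norm (z - y))\<^sup>2"
proof -
  obtain L U where L: "L > 0" "open U" "x \<in> U"
    "\<And>y z \<eta>. z\<in>X \<inter> U \<Longrightarrow> y\<in>X \<inter> U \<Longrightarrow> \<eta>\<in>normal_cone X y \<Longrightarrow>
           \<eta> \<bullet> (z - y) \<le> L * norm \<eta> * (norm (z - y))\<^sup>2"
  proof -
    have "\<forall>x\<in>X. \<exists>L>0. \<exists>U. open U \<and> x \<in> U \<and>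
        (\<forall>z\<in>X \<inter> U. \<forall>y\<in>X \<inter> U. \<forall>\<eta>\<in>normal_cone X y.
           \<eta> \<bullet> (z - y) \<le> L * norm \<eta> * (norm (z - y))\<^sup>2)"
      using X unfolding prox_regular_def by (rule conjunct2)
    from bspec[OF this x] show thesis using that by blast
  qed
  obtain r where r: "r > 0" "cball x r \<subseteq> U" using L(2,3) open_contains_cball by blast
  show thesis
  proof (rule that[OF L(1) r(1)])
    fix y z and \<phi> :: "'a \<Rightarrow>\<^sub>L real"
    assume y: "y \<in> X \<inter> cball x r" and z: "z \<in> X \<inter> cball x r" and \<phi>: "\<phi> \<in> tangent_polar X y"
    define \<eta> where "\<eta> = (\<Sum>b\<in>Basis. blinfun_apply \<phi> b *\<^sub>R b)"
    have \<eta>: "\<eta> \<bullet> w = blinfun_apply \<phi> w" for w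
    proof -
      have "blinfun_apply \<phi> w = blinfun_apply \<phi> (\<Sum>b\<in>Basis. (w \<bullet> b) *\<^sub>R b)"
        by (simp add: euclidean_representation)
      also have "\<dots> = \<eta> \<bullet> w"
        by (simp only: \<eta>_def blinfun.sum_right blinfun.scaleR_right inner_sum_left inner_scaleR_left)
          (simp add: inner_commute mult.commute)
      finally show ?thesis by simp
    qed
    have "norm \<eta> * norm \<eta> = blinfun_apply \<phi> \<eta>" by (simp add: \<eta>[symmetric] power2_norm_eq_inner[symmetric] power2_eq_square)
    also have "\<dots> \<le> norm \<phi> * norm \<eta>" using norm_blinfun[of \<phi> \<eta>] by simp
    finally have n: "norm \<eta> \<le> norm \<phi>" by (cases "\<eta> = 0") auto
    have "\<eta> \<in> normal_cone X y"
      using \<phi> y prox_regular_tangent_eq[OF X, of y]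
      by (auto simp: normal_cone_def tangent_polar_def inner_commute[of _ \<eta>] \<eta>)
    then have "\<eta> \<bullet> (z - y) \<le> L * norm \<eta> * (norm (z - y))\<^sup>2" using L(4) y z r by blast
    also have "\<dots> \<le> L * norm \<phi> * (norm (z - y))\<^sup>2"
      using n L(1) by (intro mult_right_mono mult_left_mono) auto
    finally show "blinfun_apply \<phi> (z - y) \<le> L * norm \<phi> * (norm (z - y))\<^sup>2" by (simp add: \<eta>)
  qed
qed

text \<open>By Clarke regularity a tangent \<open>w\<close> at \<open>x\<close> is a limit of
  tangents \<open>ws k\<close> at the given points \<open>xs k\<close>. The pairings of
  \<open>\<phi>s k\<close> with \<open>ws k\<close> are nonpositive and converge.\<close>

lemma tangent_polar_closed_graph:
  fixes X :: "'a::euclidean_space set"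
  assumes X: "prox_regular X" and x: "x \<in> X" "\<And>k. xs k \<in> X" "xs \<longlonglongrightarrow> x"
    and \<phi>: "\<forall>\<^sub>F k in sequentially. \<phi>s k \<in> tangent_polar X (xs k)" "\<phi>s \<longlonglongrightarrow> \<phi>"
  shows "\<phi> \<in> tangent_polar X x"
  unfolding tangent_polar_def
proof (intro CollectI ballI)
  fix w assume "w \<in> tangent_cone X x"
  then have "w \<in> clarke_tangent_cone X x" using prox_regular_tangent_eq[OF X x(1)] by simp
  then obtain ws where ws: "\<forall>\<^sub>F k in sequentially. ws k \<in> tangent_cone X (xs k)" "ws \<longlonglongrightarrow> w"
    using x unfolding clarke_tangent_cone_def by blast
  have "(\<lambda>k. blinfun_apply (\<phi>s k) (ws k)) \<longlonglongrightarrow> blinfun_apply \<phi> w"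
    by (rule blinfun.tendsto[OF \<phi>(2) ws(2)])
  moreover have "\<forall>\<^sub>F k in sequentially. blinfun_apply (\<phi>s k) (ws k) \<le> 0"
    using ws(1) \<phi>(1) by eventually_elim (auto simp: tangent_polar_def)
  ultimately show "blinfun_apply \<phi> w \<le> 0" by (rule tendsto_upperbound) simp
qed

text \<open>First-order condition at a local minimum: expanding the square gives
  \<open>2 * b (c - p) (z - p) \<le> b (z - p) (z - p)\<close> for \<open>z\<close> near
  \<open>p\<close>. After division by \<open>\<delta> k\<close> along a tangent sequence, the right
  side still has a factor \<open>z - p\<close> that tends to zero.\<close>

lemma nearest_point_residual_polar:
  fixes b :: "'a::euclidean_space bilinear_form"
  assumes sym: "\<And>u v. blinfun_apply (blinfun_apply b u) v = blinfun_apply (blinfun_apply b v) u"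
    and U: "open U" "p \<in> U"
    and min: "\<And>z. z \<in> X \<inter> U \<Longrightarrow> b (c - p) (c - p) \<le> b (c - z) (c - z)"
  shows "b (c - p) \<in> tangent_polar X p"
  unfolding tangent_polar_def
proof (intro CollectI ballI)
  fix w assume "w \<in> tangent_cone X p"
  then obtain xs \<delta> where h: "\<forall>k. xs k \<in> X" "xs \<longlonglongrightarrow> p" "\<forall>k. \<delta> k > 0" "\<delta> \<longlonglongrightarrow> (0::real)"
     "(\<lambda>k. (xs k - p) /\<^sub>R \<delta> k) \<longlonglongrightarrow> w"
    unfolding tangent_cone_def by blast
  have "\<forall>\<^sub>F k in sequentially. xs k \<in> U" using h(2) U topological_tendstoD by blast
  then have "\<forall>\<^sub>F k in sequentially. 2 * b (c - p) ((xs k - p) /\<^sub>R \<delta> k) \<le> b ((xs k - p) /\<^sub>R \<delta> k) (xs k - p)"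
  proof eventually_elim
    case (elim k)
    then have "b (c - p) (c - p) \<le> b (c - xs k) (c - xs k)" using min h by blast
    also have "c - xs k = (c - p) - (xs k - p)" by simp
    also have "b ((c - p) - (xs k - p)) ((c - p) - (xs k - p)) = b (c - p) (c - p) - 2 * b (c - p) (xs k - p) + b (xs k - p) (xs k - p)"
      using sym[of "xs k - p" "c - p"] by (simp only: blinfun.diff_left blinfun.diff_right) simp
    finally have "2 * b (c - p) (xs k - p) \<le> b (xs k - p) (xs k - p)" by simp
    then have "(2 * b (c - p) (xs k - p)) / \<delta> k \<le> b (xs k - p) (xs k - p) / \<delta> k"
      using h(3) by (intro divide_right_mono) (auto simp: less_imp_le)
    then show ?case by (simp add: blinfun.scaleR_right blinfun.scaleR_left divide_inverse mult.commute mult.left_commute)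
  qed
  moreover have "(\<lambda>k. 2 * b (c - p) ((xs k - p) /\<^sub>R \<delta> k)) \<longlonglongrightarrow> 2 * b (c - p) w"
    by (intro tendsto_intros h(5))
  moreover have "(\<lambda>k. b ((xs k - p) /\<^sub>R \<delta> k) (xs k - p)) \<longlonglongrightarrow> b w (p - p)"
    by (intro tendsto_intros h(5) h(2))
  ultimately have "2 * b (c - p) w \<le> b w (p - p)" by (intro tendsto_le[OF sequentially_bot]) 
  then show "blinfun_apply (b (c - p)) w \<le> 0" by (simp add: blinfun.zero_right)
qed

section \<open>Bipolarity of the tangent cone and residuals of the projected field\<close>

lemma locally_compact_cball:
  fixes X :: "'a::euclidean_space set"
  assumes "locally compact X" "x \<in> X"
  obtains r where "r > 0" "\<And>s. s \<le> r \<Longrightarrow> compact (X \<inter> cball x s)"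
proof -
  obtain r where r: "r > 0" "closed (cball x r \<inter> X)" using assms locally_compact_Int_cball by blast
  have "compact (X \<inter> cball x s)" if "s \<le> r" for s
  proof -
    have "X \<inter> cball x s = (cball x r \<inter> X) \<inter> cball x s" using that by auto
    then show ?thesis using r(2) by (metis closed_Int_compact compact_cball)
  qed
  then show thesis using that r by blast
qed

text \<open>The projections \<open>p k\<close> of \<open>x + \<delta> k v\<close> onto \<open>X\<close> have normal residuals; their directions
  accumulate at a normal at \<open>x\<close>, on which \<open>v\<close> is nonpositive, so the residuals are of order
  \<open>o(\<delta> k)\<close> and \<open>p k\<close> realizes \<open>v\<close> as a tangent.\<close>

lemma tangent_cone_bipolar:
  fixes X :: "'a::euclidean_space set"
  assumes X: "prox_regular X" and x: "x \<in> X" and v: "\<And>\<phi>. \<phi> \<in> tangent_polar X x \<Longrightarrow> blinfun_apply \<phi> v \<le> 0"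
  shows "v \<in> tangent_cone X x"
proof -
  obtain L r1 where L: "L > 0" "r1 > 0"
    "\<And>y z \<phi>. y \<in> X \<inter> cball x r1 \<Longrightarrow> z \<in> X \<inter> cball x r1 \<Longrightarrow> \<phi> \<in> tangent_polar X y \<Longrightarrow>
      blinfun_apply \<phi> (z - y) \<le> L * norm \<phi> * (norm (z - y))\<^sup>2"
    using prox_regular_functional[OF X x] by blast
  have "locally compact X" using X by (auto simp: prox_regular_def clarke_regular_def)
  then obtain r2 where r2: "r2 > 0" "\<And>s. s \<le> r2 \<Longrightarrow> compact (X \<inter> cball x s)"
    using locally_compact_cball x by blast
  define r where "r = min r1 r2"
  have r: "r > 0" "compact (X \<inter> cball x r)" using L r2 by (auto simp: r_def)
  \<comment> \<open>The factor ensures \<open>2 * (\<delta> k * norm v) < r\<close>, so the nearest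
    points in the closed ball lie in the open one and are locally nearest in
    \<open>X\<close>.\<close>
  define \<delta> where "\<delta> k = r / (2 * norm v + 2) * inverse (real (Suc k))" for k
  have \<delta>: "\<delta> k > 0" for k using r by (auto simp: \<delta>_def intro!: mult_pos_pos divide_pos_pos add_nonneg_pos)
  have \<delta>0: "\<delta> \<longlonglongrightarrow> 0" unfolding \<delta>_def by (intro tendsto_mult_right_zero LIMSEQ_inverse_real_of_nat)
  have \<delta>r: "2 * (\<delta> k * norm v) < r" for k
  proof -
    have "\<delta> k \<le> r / (2 * norm v + 2) * 1" unfolding \<delta>_def using r
      by (intro mult_left_mono) (auto simp: inverse_eq_divide)
    then have "2 * (\<delta> k * norm v) \<le> 2 * (r / (2 * norm v + 2) * norm v)"
      by (intro mult_left_mono mult_right_mono) auto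
    also have "\<dots> = r * (2 * norm v) / (2 * norm v + 2)" by simp
    also have "\<dots> < r"
    proof -
      have "0 < 2 * norm v + 2" using norm_ge_zero[of v] by linarith
      then show ?thesis using r by (simp add: pos_divide_less_eq)
    qed
    finally show ?thesis .
  qed
  define q where "q k = x + \<delta> k *\<^sub>R v" for k
  have "\<exists>p\<in>X \<inter> cball x r. \<forall>z\<in>X \<inter> cball x r. dist (q k) p \<le> dist (q k) z" for k
    using distance_attains_inf[of "X \<inter> cball x r" "q k"] compact_imp_closed[OF r(2)] x r(1) by (metis Int_iff centre_in_cball empty_iff less_imp_le)
  then obtain p where p: "\<And>k. p k \<in> X \<inter> cball x r" "\<And>k z. z \<in> X \<inter> cball x r \<Longrightarrow> dist (q k) (p k) \<le> dist (q k) z"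
    by metis
  have pd: "norm (q k - p k) \<le> \<delta> k * norm v" for k
    using p(2)[of x k] x r(1) \<delta>[of k] by (simp add: q_def dist_norm)
  have px: "norm (p k - x) \<le> 2 * (\<delta> k * norm v)" for k
  proof -
    have "p k - x = \<delta> k *\<^sub>R v - (q k - p k)" by (simp add: q_def)
    then have "norm (p k - x) \<le> norm (\<delta> k *\<^sub>R v) + norm (q k - p k)" by (metis norm_triangle_ineq4)
    then show ?thesis using pd[of k] \<delta>[of k] by simp
  qed
  have plim: "p \<longlonglongrightarrow> x"
  proof -
    have "(\<lambda>k. 2 * (\<delta> k * norm v)) \<longlonglongrightarrow> 0" using \<delta>0 by (intro tendsto_mult_right_zero tendsto_mult_left_zero)
    then have "(\<lambda>k. p k - x) \<longlonglongrightarrow> 0" by (rule Lim_null_comparison[rotated]) (auto simp: px)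
    then show ?thesis by (simp add: LIM_zero_iff)
  qed
  define \<phi> where "\<phi> k = blinfun_inner_right (sgn (q k - p k))" for k
  \<comment> \<open>The Euclidean inner product as a bilinear form, to which
    \<open>nearest_point_residual_polar\<close> applies.\<close>
  define I :: "'a bilinear_form" where "I = Blinfun blinfun_inner_right"
  have I: "blinfun_apply (blinfun_apply I u) w = u \<bullet> w" for u w
    by (simp add: I_def bounded_linear_Blinfun_apply bounded_linear_blinfun_inner_right)
  have \<phi>pol: "\<phi> k \<in> tangent_polar X (p k)" for k
  proof -
    have "I (q k - p k) \<in> tangent_polar X (p k)"
    proof (rule nearest_point_residual_polar[of I "ball x r"])
      show "p k \<in> ball x r" using px[of k] \<delta>r[of k] by (simp add: dist_norm norm_minus_commute)
      fix z assume "z \<in> X \<inter> ball x r"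
      then have "dist (q k) (p k) \<le> dist (q k) z" by (intro p) auto
      then show "I (q k - p k) (q k - p k) \<le> I (q k - z) (q k - z)"
        by (simp add: I dist_norm power2_norm_eq_inner[symmetric] power_mono)
    qed (auto simp: I inner_commute)
    then show ?thesis by (auto simp: tangent_polar_def \<phi>_def I sgn_div_norm mult_nonneg_nonpos)
  qed
  have \<phi>n: "norm (\<phi> k) \<le> 1" for k
    unfolding \<phi>_def
  proof (rule norm_blinfun_bound)
    fix w :: 'a
    have "\<bar>sgn (q k - p k) \<bullet> w\<bar> \<le> norm (sgn (q k - p k)) * norm w" by (rule Cauchy_Schwarz_ineq2)
    also have "\<dots> \<le> 1 * norm w" by (intro mult_right_mono) (auto simp: norm_sgn)
    finally show "norm (blinfun_apply (blinfun_inner_right (sgn (q k - p k))) w) \<le> 1 * norm w" by simp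
  qed simp
  \<comment> \<open>The normalized residual is paired with
    \<open>q k - p k = \<delta> k *\<^sub>R v + (x - p k)\<close>. Prox-regularity at
    \<open>p k\<close> bounds the second part quadratically in \<open>\<delta> k\<close>, because
    \<open>x - p k\<close> is of order \<open>\<delta> k\<close>.\<close>
  have est: "norm (q k - p k) / \<delta> k \<le> \<phi> k v + 4 * L * \<delta> k * (norm v)\<^sup>2" for k
  proof -
    have "norm (q k - p k) = \<phi> k (q k - p k)"
      by (cases "q k = p k") (auto simp: \<phi>_def sgn_div_norm power2_norm_eq_inner[symmetric] power2_eq_square)
    also have "\<phi> k (q k - p k) = \<phi> k (\<delta> k *\<^sub>R v + (x - p k))" by (simp add: q_def algebra_simps)
    also have "\<dots> = \<delta> k * \<phi> k v + \<phi> k (x - p k)"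
      by (simp only: blinfun.add_right blinfun.scaleR_right) simp
    also have "\<phi> k (x - p k) \<le> L * norm (\<phi> k) * (norm (x - p k))\<^sup>2"
      using p(1)[of k] x r by (intro L(3) \<phi>pol) (auto simp: r_def)
    also have "\<dots> \<le> L * 1 * (2 * (\<delta> k * norm v))\<^sup>2"
      using px[of k] \<phi>n[of k] L(1) by (intro mult_mono power_mono) (auto simp: norm_minus_commute)
    finally have "norm (q k - p k) \<le> \<delta> k * (\<phi> k v + 4 * L * \<delta> k * (norm v)\<^sup>2)"
      by (simp add: algebra_simps power2_eq_square)
    then show ?thesis using \<delta>[of k] by (simp add: pos_divide_le_eq mult.commute)
  qed
  have "(\<lambda>k. norm (q k - p k) / \<delta> k) \<longlonglongrightarrow> 0"
  proof (rule ccontr)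
    assume "\<not> ?thesis"
    then obtain e where e: "e > 0" "\<not> (\<forall>\<^sub>F k in sequentially. dist (norm (q k - p k) / \<delta> k) 0 < e)"
      unfolding tendsto_iff by blast
    obtain s :: "nat \<Rightarrow> nat" where s: "strict_mono s" "\<forall>k. \<not> dist (norm (q (s k) - p (s k)) / \<delta> (s k)) 0 < e"
      using not_eventually_sequentiallyD[OF e(2)] by blast
    have s2: "norm (q (s k) - p (s k)) / \<delta> (s k) \<ge> e" for k
      using s(2)[rule_format, of k] \<delta>[of "s k"] by (simp add: dist_real_def)
    obtain \<phi>' t where t: "strict_mono t" "(\<lambda>k. \<phi> (s (t k))) \<longlonglongrightarrow> \<phi>'"
      using compact_cball[of "0 :: 'a \<Rightarrow>\<^sub>L real" 1, unfolded compact_def, rule_format, of "\<phi> \<circ> s"] \<phi>n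
      by (auto simp: o_def)
    define st where "st = s \<circ> t"
    have st: "strict_mono st" unfolding st_def using s t by (simp add: strict_mono_o)
    have lim: "(\<lambda>k. \<phi> (st k)) \<longlonglongrightarrow> \<phi>'" using t by (simp add: st_def)
    have "\<phi>' \<in> tangent_polar X x"
      using p(1) LIMSEQ_subseq_LIMSEQ[OF plim st] \<phi>pol lim
      by (intro tangent_polar_closed_graph[OF X x, of "p \<circ> st" "\<lambda>k. \<phi> (st k)"]) auto
    then have "\<phi>' v \<le> 0" by (rule v)
    moreover have "(\<lambda>k. \<phi> (st k) v + 4 * L * \<delta> (st k) * (norm v)\<^sup>2) \<longlonglongrightarrow> \<phi>' v + 4 * L * 0 * (norm v)\<^sup>2"
      using LIMSEQ_subseq_LIMSEQ[OF \<delta>0 st] by (intro tendsto_intros lim) (simp add: o_def)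
    moreover have "e \<le> \<phi> (st k) v + 4 * L * \<delta> (st k) * (norm v)\<^sup>2" for k
      using s2[of "t k"] est[of "st k"] by (simp add: st_def)
    ultimately have "e \<le> \<phi>' v + 4 * L * 0 * (norm v)\<^sup>2"
      by (intro tendsto_lowerbound[OF _ always_eventually]) auto
    then show False using \<open>\<phi>' v \<le> 0\<close> e by simp
  qed
  moreover have "norm ((p k - x) /\<^sub>R \<delta> k - v) = norm (q k - p k) / \<delta> k" for k
  proof -
    have "(p k - x) /\<^sub>R \<delta> k - v = (- inverse (\<delta> k)) *\<^sub>R (q k - p k)"
      using \<delta>[of k] by (simp add: q_def algebra_simps)
    then show ?thesis using \<delta>[of k] by (simp only: norm_scaleR) (simp add: divide_inverse mult.commute)
  qed
  ultimately have "(\<lambda>k. (p k - x) /\<^sub>R \<delta> k - v) \<longlonglongrightarrow> 0" by (subst tendsto_norm_zero_iff[symmetric]) simp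
  then have "(\<lambda>k. (p k - x) /\<^sub>R \<delta> k) \<longlonglongrightarrow> v" by (simp add: LIM_zero_iff)
  then show ?thesis unfolding tangent_cone_def using p(1) plim \<delta> \<delta>0 by blast
qed

text \<open>Bipolarity exhibits the tangent cone as an intersection of half-spaces through the
  origin.\<close>

lemma tangent_cone_add:
  fixes X :: "'a::euclidean_space set"
  assumes X: "prox_regular X" and x: "x \<in> X" and "v \<in> tangent_cone X x" "w \<in> tangent_cone X x"
  shows "v + w \<in> tangent_cone X x"
proof (rule tangent_cone_bipolar[OF X x])
  fix \<phi> assume "\<phi> \<in> tangent_polar X x"
  then have "\<phi> v \<le> 0" "\<phi> w \<le> 0" using assms(3,4) unfolding tangent_polar_def by blast+
  then show "\<phi> (v + w) \<le> 0" by (simp add: blinfun.add_right)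
qed

text \<open>Sums of tangents are tangent, so \<open>v + \<epsilon> *\<^sub>R w\<close> competes with
  \<open>v\<close>. The expanded comparison is divided by \<open>\<epsilon>\<close>, which then
  tends to zero.\<close>

lemma projected_field_residual_polar:
  fixes X :: "'a::euclidean_space set"
  assumes X: "prox_regular X" and x: "x \<in> X" and g: "inner_product_form (g x)"
    and v: "v \<in> projected_field X g f x"
  shows "g x (f x - v) \<in> tangent_polar X x"
  unfolding tangent_polar_def
proof (intro CollectI ballI)
  fix w assume w: "w \<in> tangent_cone X x"
  let ?b = "\<lambda>u w. blinfun_apply (blinfun_apply (g x) u) w"
  have sym: "?b u w = ?b w u" for u w using g by (auto simp: inner_product_form_def)
  have nn: "?b u u \<ge> 0" for u using g by (cases "u = 0") (auto simp: inner_product_form_def blinfun.zero_left less_imp_le)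
  have v1: "v \<in> tangent_cone X x" "\<And>u. u \<in> tangent_cone X x \<Longrightarrow> ?b (v - f x) (v - f x) \<le> ?b (u - f x) (u - f x)"
    using v nn by (auto simp: projected_field_def is_arg_min_linorder form_norm_def)
  have "2 * ?b (f x - v) w \<le> \<epsilon> * ?b w w" if e: "\<epsilon> > 0" for \<epsilon>
  proof -
    have "v + \<epsilon> *\<^sub>R w \<in> tangent_cone X x" using e w v1 by (intro tangent_cone_add[OF X x] tangent_cone_scale)
    then have "?b (v - f x) (v - f x) \<le> ?b ((v - f x) + \<epsilon> *\<^sub>R w) ((v - f x) + \<epsilon> *\<^sub>R w)" using v1(2)[of "v + \<epsilon> *\<^sub>R w"] by (simp add: algebra_simps)
    also have "\<dots> = ?b (v - f x) (v - f x) + 2 * \<epsilon> * ?b (v - f x) w + \<epsilon> * \<epsilon> * ?b w w"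
      using sym[of w "v - f x"] by (simp only: blinfun.add_left blinfun.add_right blinfun.scaleR_left blinfun.scaleR_right) (simp add: algebra_simps)
    finally have "0 \<le> \<epsilon> * (2 * ?b (v - f x) w + \<epsilon> * ?b w w)" by (simp add: algebra_simps)
    then have "0 \<le> 2 * ?b (v - f x) w + \<epsilon> * ?b w w" using e by (simp add: zero_le_mult_iff)
    moreover have "?b (f x - v) w = - ?b (v - f x) w"
      by (metis blinfun.minus_left blinfun.minus_right minus_diff_eq)
    ultimately show ?thesis by linarith
  qed
  then have ev: "\<forall>\<^sub>F \<epsilon> in at_right 0. 2 * ?b (f x - v) w \<le> \<epsilon> * ?b w w"
    by (auto simp: eventually_at_right_field intro: exI[of _ 1])
  have "((\<lambda>\<epsilon>. \<epsilon> * ?b w w) \<longlongrightarrow> 0 * ?b w w) (at_right 0)" by (intro tendsto_intros)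
  from tendsto_lowerbound[OF this ev] show "blinfun_apply (g x (f x - v)) w \<le> 0" by simp
qed

text \<open>The zero vector is tangent and competes with \<open>v\<close>; this is the source of the
  speed bound.\<close>

lemma projected_field_residual_le:
  fixes X :: "'a::euclidean_space set"
  assumes x: "x \<in> X" and g: "inner_product_form (g x)"
    and v: "v \<in> projected_field X g f x"
  shows "g x (v - f x) (v - f x) \<le> g x (f x) (f x)"
proof -
  have nn: "g x u u \<ge> 0" for u using g by (cases "u = 0") (auto simp: inner_product_form_def blinfun.zero_left less_imp_le)
  show ?thesis
  proof -
    have "(form_norm (g x) (v - f x))\<^sup>2 \<le> (form_norm (g x) (0 - f x))\<^sup>2"
      using v zero_in_tangent_cone[OF x] unfolding projected_field_def is_arg_min_linorder by blast
    then show ?thesis using nn by (simp add: form_norm_def blinfun.minus_left blinfun.minus_right)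
  qed
qed

section \<open>Local bounds\<close>

lemma abs_form_le:
  fixes b :: "'a::euclidean_space bilinear_form"
  shows "\<bar>b u v\<bar> \<le> norm b * norm u * norm v"
proof -
  have "\<bar>b u v\<bar> \<le> norm (b u) * norm v" using norm_blinfun[of "b u" v] by simp
  also have "\<dots> \<le> norm b * norm u * norm v" by (intro mult_right_mono norm_blinfun) auto
  finally show ?thesis .
qed

lemma form_le:
  fixes b :: "'a::euclidean_space bilinear_form"
  assumes "norm b \<le> B" "norm u \<le> U" "norm v \<le> V"
  shows "b u v \<le> B * U * V"
proof -
  have B: "B \<ge> 0" "U \<ge> 0" "V \<ge> 0" using assms norm_ge_zero by (meson order_trans)+
  have "b u v \<le> norm b * norm u * norm v" using abs_form_le[of b u v] by linarith
  also have "\<dots> \<le> B * U * V" using assms B by (intro mult_mono mult_nonneg_nonneg) auto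
  finally show ?thesis .
qed

text \<open>The local data near a point, with one constant \<open>C\<close> for all upper bounds so
  that the estimates need not track several. \<open>\<mu>\<close> compares the norms of all forms
  \<open>g y\<close> with the Euclidean one. In the applications \<open>K\<close> is the part of
  \<open>X\<close> in a small closed ball.\<close>

locale prox_chart =
  fixes X :: "'a::euclidean_space set" and f :: "'a \<Rightarrow> 'a" and g :: "'a \<Rightarrow> 'a bilinear_form"
    and K :: "'a set" and C \<mu> :: real
  assumes X: "prox_regular X" and metric: "metric_on X g"
    and KX: "K \<subseteq> X" and C: "C > 0" and \<mu>: "\<mu> > 0"
    and prox: "\<And>y z \<phi>. y \<in> K \<Longrightarrow> z \<in> K \<Longrightarrow> \<phi> \<in> tangent_polar X y \<Longrightarrow>
      blinfun_apply \<phi> (z - y) \<le> C * norm \<phi> * (norm (z - y))\<^sup>2"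
    and f_lip: "\<And>y z. y \<in> K \<Longrightarrow> z \<in> K \<Longrightarrow> norm (f y - f z) \<le> C * norm (y - z)"
    and g_lip: "\<And>y z. y \<in> K \<Longrightarrow> z \<in> K \<Longrightarrow> norm (g y - g z) \<le> C * norm (y - z)"
    and f_bound: "\<And>y. y \<in> K \<Longrightarrow> norm (f y) \<le> C"
    and g_bound: "\<And>y. y \<in> K \<Longrightarrow> norm (g y) \<le> C"
    and diam: "\<And>y z. y \<in> K \<Longrightarrow> z \<in> K \<Longrightarrow> norm (y - z) \<le> C"
    and coercive: "\<And>y u. y \<in> K \<Longrightarrow> \<mu> * (norm u)\<^sup>2 \<le> g y u u"

text \<open>The form has a positive minimum on the compact unit sphere, and homogeneity extends the
  bound to all vectors.\<close>

lemma inner_product_form_coercive: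
  fixes b :: "'a::euclidean_space bilinear_form"
  assumes "inner_product_form b"
  obtains \<mu> where "\<mu> > 0" "\<And>u. \<mu> * (norm u)\<^sup>2 \<le> b u u"
proof -
  have ne: "sphere (0::'a) 1 \<noteq> {}" by (simp add: sphere_eq_empty)
  have "continuous_on (sphere 0 1) (\<lambda>u. b u u)"
    by (intro continuous_intros)
  then obtain e where e: "e \<in> sphere 0 1" "\<And>u. u \<in> sphere 0 1 \<Longrightarrow> b e e \<le> b u u"
    using continuous_attains_inf[OF compact_sphere ne] by blast
  have "e \<noteq> 0" using e(1) by auto
  then have "b e e > 0" using assms unfolding inner_product_form_def by blast
  moreover have "b e e * (norm u)\<^sup>2 \<le> b u u" for u
  proof (cases "u = 0")
    case False
    have "b e e \<le> b (u /\<^sub>R norm u) (u /\<^sub>R norm u)" using False by (intro e) auto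
    also have "\<dots> = b u u / (norm u)\<^sup>2"
      by (simp add: blinfun.scaleR_left blinfun.scaleR_right divide_inverse power2_eq_square)
    finally show ?thesis using False by (simp add: pos_le_divide_eq)
  qed (simp add: blinfun.zero_right)
  ultimately show thesis using that by blast
qed

lemma prox_chart_exists:
  fixes X :: "'a::euclidean_space set"
  assumes X: "prox_regular X" and f: "locally_lipschitz_on X f"
    and metric: "metric_on X g" and g: "locally_lipschitz_on X g" and x: "x \<in> X"
  obtains r C \<mu> where "r > 0" "compact (X \<inter> cball x r)" "prox_chart X f g (X \<inter> cball x r) C \<mu>"
proof -
  have "locally compact X" using X by (auto simp: prox_regular_def clarke_regular_def)
  then obtain r1 where r1: "r1 > 0" "\<And>s. s \<le> r1 \<Longrightarrow> compact (X \<inter> cball x s)"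
    using locally_compact_cball x by blast
  obtain L r2 where L: "L > 0" "r2 > 0"
    "\<And>y z \<phi>. y \<in> X \<inter> cball x r2 \<Longrightarrow> z \<in> X \<inter> cball x r2 \<Longrightarrow> \<phi> \<in> tangent_polar X y \<Longrightarrow>
      blinfun_apply \<phi> (z - y) \<le> L * norm \<phi> * (norm (z - y))\<^sup>2"
    using prox_regular_functional[OF X x] by blast
  obtain U F where F: "open U" "x \<in> U" "F-lipschitz_on (X \<inter> U) f"
    using f x unfolding locally_lipschitz_on_def by blast
  obtain r3 where r3: "r3 > 0" "cball x r3 \<subseteq> U" using F open_contains_cball by blast
  obtain V G where G: "open V" "x \<in> V" "G-lipschitz_on (X \<inter> V) g"
    using g x unfolding locally_lipschitz_on_def by blast
  obtain r4 where r4: "r4 > 0" "cball x r4 \<subseteq> V" using G open_contains_cball by blast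
  have F0: "F \<ge> 0" and G0: "G \<ge> 0" using F(3) G(3) lipschitz_on_nonneg by blast+
  obtain \<nu> where \<nu>: "\<nu> > 0" "\<And>u. \<nu> * (norm u)\<^sup>2 \<le> g x u u"
    using inner_product_form_coercive metric x unfolding metric_on_def by blast
  \<comment> \<open>The last entry keeps \<open>G * r\<close> at most \<open>\<nu> / 2\<close>, so
    that moving away from \<open>x\<close> costs at most half of the coercivity of
    \<open>g x\<close>.\<close>
  define r where "r = Min {r1, r2, r3, r4, \<nu> / (2 * (G + 1))}"
  have r: "r > 0" "r \<le> r1" "r \<le> r2" "r \<le> r3" "r \<le> r4" "r \<le> \<nu> / (2 * (G + 1))"
    unfolding r_def using r1 r3 r4 L \<nu> G0 by auto
  define K where "K = X \<inter> cball x r"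
  have K: "K \<subseteq> X \<inter> cball x r2" "K \<subseteq> X \<inter> U" "K \<subseteq> X \<inter> V" "x \<in> K"
    using r r3 r4 x unfolding K_def by fastforce+
  have f_lip: "norm (f y - f z) \<le> F * norm (y - z)" if "y \<in> K" "z \<in> K" for y z
    using lipschitz_onD[OF F(3), of y z] K that by (auto simp: dist_norm)
  have g_lip: "norm (g y - g z) \<le> G * norm (y - z)" if "y \<in> K" "z \<in> K" for y z
    using lipschitz_onD[OF G(3), of y z] K that by (auto simp: dist_norm)
  have Kr: "norm (y - x) \<le> r" if "y \<in> K" for y
    using that by (simp add: K_def dist_norm norm_minus_commute)
  define C where "C = Max {L, F, G, norm (f x) + F * r, norm (g x) + G * r, 2 * r}"
  have C: "L \<le> C" "F \<le> C" "G \<le> C" "norm (f x) + F * r \<le> C" "norm (g x) + G * r \<le> C" "2 * r \<le> C"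
    unfolding C_def by (rule Max_ge; simp)+
  have "prox_chart X f g K C (\<nu> / 2)"
  proof (unfold_locales)
    show "K \<subseteq> X" "C > 0" "\<nu> / 2 > 0" using K_def C(1) L(1) \<nu>(1) by auto
  next
    fix y z and \<phi> :: "'a \<Rightarrow>\<^sub>L real"
    assume "y \<in> K" "z \<in> K" "\<phi> \<in> tangent_polar X y"
    then have "blinfun_apply \<phi> (z - y) \<le> L * norm \<phi> * (norm (z - y))\<^sup>2" using K by (intro L) auto
    also have "\<dots> \<le> C * norm \<phi> * (norm (z - y))\<^sup>2" using C by (intro mult_right_mono) auto
    finally show "blinfun_apply \<phi> (z - y) \<le> C * norm \<phi> * (norm (z - y))\<^sup>2" .
  next
    fix y z assume yz: "y \<in> K" "z \<in> K"
    show "norm (f y - f z) \<le> C * norm (y - z)"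
      using f_lip[OF yz] C(2) by (meson mult_right_mono norm_ge_zero order_trans)
    show "norm (g y - g z) \<le> C * norm (y - z)"
      using g_lip[OF yz] C(3) by (meson mult_right_mono norm_ge_zero order_trans)
    have "norm ((y - x) - (z - x)) \<le> norm (y - x) + norm (z - x)" by (rule norm_triangle_ineq4)
    then show "norm (y - z) \<le> C" using Kr[OF yz(1)] Kr[OF yz(2)] C(6) by simp
  next
    fix y assume y: "y \<in> K"
    have "norm (f y) \<le> norm (f x) + norm (f y - f x)" by (rule norm_triangle_sub)
    also have "norm (f y - f x) \<le> F * r"
      using f_lip[OF y K(4)] mult_left_mono[OF Kr[OF y] F0] by linarith
    finally show "norm (f y) \<le> C" using C by linarith
    have gr: "norm (g y - g x) \<le> G * r"
      using g_lip[OF y K(4)] mult_left_mono[OF Kr[OF y] G0] by linarith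
    have "norm (g y) \<le> norm (g x) + norm (g y - g x)" by (rule norm_triangle_sub)
    then show "norm (g y) \<le> C" using C gr by linarith
    fix u :: 'a
    have "G * r \<le> (G + 1) * (\<nu> / (2 * (G + 1)))" using r G0 by (intro mult_mono) auto
    also have "\<dots> = \<nu> / 2" using G0 by (simp add: field_simps)
    finally have "norm (g y - g x) \<le> \<nu> / 2" using gr by linarith
    then have "norm (g y - g x) * norm u * norm u \<le> \<nu> / 2 * norm u * norm u"
      by (intro mult_right_mono) auto
    then have "\<bar>(g y - g x) u u\<bar> \<le> \<nu> / 2 * (norm u)\<^sup>2"
      using abs_form_le[of "g y - g x" u u] by (simp add: power2_eq_square)
    moreover have "(g y - g x) u u = g y u u - g x u u" by (simp add: blinfun.diff_left)
    ultimately show "\<nu> / 2 * (norm u)\<^sup>2 \<le> g y u u" using \<nu>(2)[of u] unfolding abs_le_iff by linarith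
  qed (fact X metric)+
  then show thesis using r r1(2) that unfolding K_def by blast
qed

section \<open>Velocities with normal residual\<close>

context prox_chart
begin

text \<open>An a priori speed bound: \<open>C\<close> bounds \<open>f\<close>, and
  \<open>C * sqrt (C / \<mu>)\<close> bounds every vector that is no longer than \<open>f y\<close>
  in the form \<open>g y\<close>, such as the residual of a projection.\<close>

definition M :: real where "M = C + C * sqrt (C / \<mu>)"

text \<open>The speed bound makes this a bounded, closed and convex set with closed graph that contains
  the Krasovskii regularization.\<close>

definition slow_velocities :: "'a \<Rightarrow> 'a set" where
  "slow_velocities y = {v. g y (f y - v) \<in> tangent_polar X y \<and> norm v \<le> M}"

lemma M_bounds: "M > 0" "C \<le> M"
  using C \<mu> by (auto simp: M_def add_pos_nonneg)

lemma form_sym: "y \<in> K \<Longrightarrow> g y u v = g y v u"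
  using metric KX unfolding metric_on_def inner_product_form_def by blast

lemma inner_form: "y \<in> K \<Longrightarrow> inner_product_form (g y)"
  using metric KX unfolding metric_on_def by blast

text \<open>Coercivity bounds the left form from below, the bounds on \<open>g\<close> and
  \<open>f\<close> the right one from above. The scale \<open>h\<close> is 1 for the projected field
  and the step size for the Euler scheme.\<close>

lemma norm_le_of_form_le:
  assumes y: "y \<in> K" and le: "g y u u \<le> g y (h *\<^sub>R f y) (h *\<^sub>R f y)" and h: "h \<ge> 0"
  shows "norm u \<le> h * (C * sqrt (C / \<mu>))"
proof -
  have "\<mu> * (norm u)\<^sup>2 \<le> g y (h *\<^sub>R f y) (h *\<^sub>R f y)" using coercive[OF y, of u] le by linarith
  also have "\<dots> \<le> C * (h * C) * (h * C)"
    using g_bound[OF y] f_bound[OF y] h by (intro form_le) (auto simp: mult_left_mono)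
  finally have "(norm u)\<^sup>2 \<le> C * (h * C) * (h * C) / \<mu>" using \<mu> by (simp add: pos_le_divide_eq mult.commute)
  also have "\<dots> = (h * C)\<^sup>2 * (C / \<mu>)" by (simp add: power2_eq_square)
  also have "\<dots> = (h * (C * sqrt (C / \<mu>)))\<^sup>2"
    using C \<mu> by (simp add: power_mult_distrib)
  finally have "(norm u)\<^sup>2 \<le> (h * (C * sqrt (C / \<mu>)))\<^sup>2" .
  moreover have "0 \<le> h * (C * sqrt (C / \<mu>))" using h C \<mu> by simp
  ultimately show ?thesis by (rule power2_le_imp_le)
qed

lemma continuous_f: "continuous_on K f" and continuous_g: "continuous_on K g"
proof -
  have "C-lipschitz_on K f" "C-lipschitz_on K g"
    using f_lip g_lip C by (auto intro!: lipschitz_onI simp: dist_norm)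
  then show "continuous_on K f" "continuous_on K g" using lipschitz_on_continuous_on by blast+
qed

lemma projected_field_slow:
  assumes "y \<in> K" "v \<in> projected_field X g f y"
  shows "v \<in> slow_velocities y"
proof -
  have y: "y \<in> X" using assms KX by auto
  have "norm (v - f y) \<le> 1 * (C * sqrt (C / \<mu>))"
    using projected_field_residual_le[OF y inner_form[OF assms(1)] assms(2)]
    by (intro norm_le_of_form_le[OF assms(1)]) auto
  then have "norm v \<le> M" using norm_triangle_sub[of v "f y"] f_bound[OF assms(1)] by (simp add: M_def)
  then show ?thesis
    using projected_field_residual_polar[OF X y inner_form[OF assms(1)] assms(2)]
    by (simp add: slow_velocities_def)
qed

lemma slow_velocities_closed: "closed (slow_velocities y)"
proof -
  have "closed (tangent_polar X y)"
  proof -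
    have "tangent_polar X y = (\<Inter>w\<in>tangent_cone X y. {\<phi>. blinfun_apply \<phi> w \<le> 0})"
      by (auto simp: tangent_polar_def)
    then show ?thesis by (auto intro!: closed_INT closed_Collect_le continuous_intros)
  qed
  then have "closed ((\<lambda>v. g y (f y - v)) -` tangent_polar X y)"
    by (intro continuous_closed_vimage) (auto intro!: continuous_intros)
  moreover have "slow_velocities y = ((\<lambda>v. g y (f y - v)) -` tangent_polar X y) \<inter> cball 0 M"
    by (auto simp: slow_velocities_def)
  ultimately show ?thesis by (metis closed_Int closed_cball)
qed

lemma slow_velocities_convex: "convex (slow_velocities y)"
proof (rule convexI)
  fix v w and s t :: real
  assume h: "v \<in> slow_velocities y" "w \<in> slow_velocities y" "0 \<le> s" "0 \<le> t" "s + t = 1"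
  have "f y = s *\<^sub>R f y + t *\<^sub>R f y" using h by (simp add: scaleR_add_left[symmetric])
  then have eq: "f y - (s *\<^sub>R v + t *\<^sub>R w) = s *\<^sub>R (f y - v) + t *\<^sub>R (f y - w)"
    by (simp add: scaleR_diff_right)
  have "g y (f y - (s *\<^sub>R v + t *\<^sub>R w)) \<in> tangent_polar X y"
    unfolding tangent_polar_def eq
  proof (intro CollectI ballI)
    fix u assume u: "u \<in> tangent_cone X y"
    have "g y (f y - v) u \<le> 0" "g y (f y - w) u \<le> 0"
      using h u by (auto simp: slow_velocities_def tangent_polar_def)
    then have "s * g y (f y - v) u + t * g y (f y - w) u \<le> 0"
      using h by (intro add_nonpos_nonpos mult_nonneg_nonpos) auto
    then show "g y (s *\<^sub>R (f y - v) + t *\<^sub>R (f y - w)) u \<le> 0"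
      by (simp only: blinfun.add_right blinfun.add_left blinfun.scaleR_right blinfun.scaleR_left) simp
  qed
  moreover have "norm (s *\<^sub>R v + t *\<^sub>R w) \<le> s * M + t * M"
    using h by (intro norm_triangle_le add_mono) (auto simp: slow_velocities_def mult_left_mono)
  then have "norm (s *\<^sub>R v + t *\<^sub>R w) \<le> M" using h by (simp add: distrib_right[symmetric])
  ultimately show "s *\<^sub>R v + t *\<^sub>R w \<in> slow_velocities y" by (simp add: slow_velocities_def)
qed

text \<open>The neighborhood \<open>U\<close> forces sequences of \<open>X\<close> that tend to
  \<open>y\<close> into \<open>K\<close>, where \<open>f\<close> and \<open>g\<close> are continuous
  and projected velocities are bounded. Limits of velocities keep a normal residual by the closed
  graph.\<close>

lemma krasovskii_slow:
  assumes U: "open U" "y \<in> U" "X \<inter> U \<subseteq> K" and y: "y \<in> K"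
    and v: "v \<in> krasovskii_regularization X (projected_field X g f) y"
  shows "v \<in> slow_velocities y"
proof -
  have "outer_limit X (projected_field X g f) y \<subseteq> slow_velocities y"
  proof
    fix v assume "v \<in> outer_limit X (projected_field X g f) y"
    then obtain xs vs where xs: "\<forall>k. xs k \<in> X" "xs \<longlonglongrightarrow> y" 
      "\<forall>k. vs k \<in> projected_field X g f (xs k)" "vs \<longlonglongrightarrow> v"
      unfolding outer_limit_def by blast
    have "\<forall>\<^sub>F k in sequentially. xs k \<in> U" using topological_tendstoD[OF xs(2) U(1,2)] .
    then have inK: "\<forall>\<^sub>F k in sequentially. xs k \<in> K"
      by eventually_elim (use xs(1) U(3) in blast)
    then have slow: "\<forall>\<^sub>F k in sequentially. vs k \<in> slow_velocities (xs k)"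
      by eventually_elim (use xs(3) projected_field_slow in blast)
    have lim: "(\<lambda>k. g (xs k) (f (xs k) - vs k)) \<longlonglongrightarrow> g y (f y - v)"
      by (intro tendsto_intros xs(4) continuous_on_tendsto_compose[OF continuous_f xs(2) y inK]
          continuous_on_tendsto_compose[OF continuous_g xs(2) y inK])
    have "\<forall>\<^sub>F k in sequentially. g (xs k) (f (xs k) - vs k) \<in> tangent_polar X (xs k)"
      using slow by eventually_elim (simp add: slow_velocities_def)
    then have "g y (f y - v) \<in> tangent_polar X y"
      using xs(1) y KX by (intro tangent_polar_closed_graph[OF X _ _ xs(2) _ lim]) auto
    moreover have "\<forall>\<^sub>F k in sequentially. norm (vs k) \<le> M"
      using slow by eventually_elim (simp add: slow_velocities_def)
    then have "norm v \<le> M" by (intro tendsto_upperbound[OF tendsto_norm[OF xs(4)]]) auto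
    ultimately show "v \<in> slow_velocities y" by (simp add: slow_velocities_def)
  qed
  then have "krasovskii_regularization X (projected_field X g f) y \<subseteq> slow_velocities y"
    unfolding krasovskii_regularization_def
    by (intro closure_minimal hull_minimal slow_velocities_closed slow_velocities_convex)
  then show ?thesis using v by blast
qed

text \<open>Rests on \<open>v - w = (f y - f z) - (f y - v) + (f z - w)\<close>. The Lipschitz bound
  of \<open>f\<close> contributes \<open>C\<^sup>2\<close>; each residual is a normal at its own
  point and contributes \<open>C\<^sup>2 * (C + M)\<close> by prox-regularity; evaluating the second
  one in \<open>g y\<close> instead of \<open>g z\<close> costs \<open>C * (C + M)\<close>.\<close>

lemma slow_velocities_one_sided:
  assumes y: "y \<in> K" and z: "z \<in> K" and v: "v \<in> slow_velocities y" and w: "w \<in> slow_velocities z"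
  shows "g y (v - w) (y - z) \<le> (C\<^sup>2 + 2 * (C\<^sup>2 * (C + M)) + C * (C + M)) * (norm (y - z))\<^sup>2"
proof -
  define n where "n = norm (y - z)"
  have n: "n \<ge> 0" "norm (z - y) = n" by (auto simp: n_def norm_minus_commute)
  have res: "norm (f p - u) \<le> C + M" if "p \<in> K" "u \<in> slow_velocities p" for p u
    using norm_triangle_ineq4[of "f p" u] f_bound[OF that(1)] that(2) by (auto simp: slow_velocities_def)
  have polar: "g p (f p - u) (q - p) \<le> C\<^sup>2 * (C + M) * (norm (q - p))\<^sup>2" if p: "p \<in> K" "q \<in> K" and u: "u \<in> slow_velocities p" for p q u
  proof -
    have "g p (f p - u) (q - p) \<le> C * norm (g p (f p - u)) * (norm (q - p))\<^sup>2"
      using p u by (intro prox) (auto simp: slow_velocities_def)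
    also have "norm (g p (f p - u)) \<le> norm (g p) * norm (f p - u)" by (rule norm_blinfun)
    also have "\<dots> \<le> C * (C + M)" using g_bound[OF p(1)] res[OF p(1) u] C by (intro mult_mono) auto
    finally show ?thesis using C by (simp add: power2_eq_square mult.assoc mult_left_mono mult_right_mono)
  qed
  have 1: "g y (f y - f z) (y - z) \<le> C\<^sup>2 * n\<^sup>2"
    using form_le[OF g_bound[OF y] f_lip[OF y z] order_refl[of "norm (y - z)"]]
    by (simp add: n_def power2_eq_square mult.assoc)
  have 2: "g y (f y - v) (z - y) \<le> C\<^sup>2 * (C + M) * n\<^sup>2" using polar[OF y z v] n by simp
  have 3: "g z (f z - w) (y - z) \<le> C\<^sup>2 * (C + M) * n\<^sup>2" using polar[OF z y w] by (simp add: n_def)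
  have 4: "(g y - g z) (f z - w) (y - z) \<le> C * (C + M) * n\<^sup>2"
    using form_le[OF g_lip[OF y z] res[OF z w] order_refl[of "norm (y - z)"]]
    by (simp add: n_def power2_eq_square mult_ac)
  have "v - w = (f y - f z) - (f y - v) + (f z - w)" by simp
  then have "g y (v - w) (y - z) = g y (f y - f z) (y - z) - g y (f y - v) (y - z) + g y (f z - w) (y - z)"
    by (simp only: blinfun.diff_right blinfun.add_right blinfun.diff_left blinfun.add_left)
  also have "g y (f y - v) (y - z) = - g y (f y - v) (z - y)"
    by (metis blinfun.minus_right minus_diff_eq)
  also have "g y (f z - w) (y - z) = g z (f z - w) (y - z) + (g y - g z) (f z - w) (y - z)"
    by (simp add: blinfun.diff_left)
  finally show ?thesis using 1 2 3 4 by (simp add: n_def[symmetric] algebra_simps)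
qed

end

section \<open>Uniqueness\<close>

context prox_chart
begin

text \<open>Gronwall on a short interval: with \<open>s\<close> the maximal distance, attained at
  \<open>m\<close>, coercivity gives \<open>\<mu> * s\<^sup>2 \<le> \<phi> m\<close>, and the growth
  estimate bounds \<open>\<phi> m\<close> by a multiple of \<open>s\<^sup>2\<close> that
  \<open>short\<close> makes smaller than \<open>\<mu>\<close>. Hence \<open>s = 0\<close>.\<close>

lemma local_uniqueness:
  fixes y z :: "real \<Rightarrow> 'a"
  assumes ab: "a \<le> b" and y: "absolutely_continuous_on {a..b} y" and z: "absolutely_continuous_on {a..b} z"
    and yK: "y ` {a..b} \<subseteq> K" and zK: "z ` {a..b} \<subseteq> K" and N: "negligible N"
    and S: "{a..b} \<subseteq> S" "{a..b} \<subseteq> S'"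
    and yder: "\<And>t. t \<in> {a..b} - N \<Longrightarrow> \<exists>v\<in>slow_velocities (y t). (y has_vector_derivative v) (at t within S)"
    and zder: "\<And>t. t \<in> {a..b} - N \<Longrightarrow> \<exists>v\<in>slow_velocities (z t). (z has_vector_derivative v) (at t within S')"
    and init: "y a = z a"
    and short: "(2 * (C\<^sup>2 + 2 * (C\<^sup>2 * (C + M)) + C * (C + M)) + C * M) * (b - a) < \<mu>"
    and t: "t \<in> {a..b}"
  shows "y t = z t"
proof -
  define B where "B = C\<^sup>2 + 2 * (C\<^sup>2 * (C + M)) + C * (C + M)"
  have B: "B \<ge> 0" using C M_bounds by (simp add: B_def)
  have speed: "norm (x q - x p) \<le> M * (q - p)"
    if x: "absolutely_continuous_on {a..b} x" and S: "{a..b} \<subseteq> S"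
      and der: "\<And>t. t \<in> {a..b} - N \<Longrightarrow> \<exists>v\<in>slow_velocities (x t). (x has_vector_derivative v) (at t within S)"
      and pq: "a \<le> p" "p \<le> q" "q \<le> b" for x :: "real \<Rightarrow> 'a" and p q S
  proof (rule absolutely_continuous_increment_norm_le[OF _ pq(2) N _ order_refl])
    show "absolutely_continuous_on {p..q} x"
      using x pq by (elim absolutely_continuous_on_subset) auto
    fix t assume "t \<in> {p..q} - N"
    then have t: "t \<in> {a..b} - N" using pq by auto
    then obtain v where v: "v \<in> slow_velocities (x t)" "(x has_vector_derivative v) (at t within S)" using der by blast
    have "{p..q} \<subseteq> S" using S pq by auto
    then have "(x has_vector_derivative v) (at t within {p..q})"
      by (rule has_vector_derivative_within_subset[OF v(2)])
    then show "\<exists>v. norm v \<le> M \<and> (x has_vector_derivative v) (at t within {p..q})"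
      using v(1) unfolding slow_velocities_def by blast
  qed (use M_bounds in auto)
  have ysp: "norm (y q - y p) \<le> M * (q - p)" if "a \<le> p" "p \<le> q" "q \<le> b" for p q
    by (rule speed[OF y S(1) yder that])
  have zsp: "norm (z q - z p) \<le> M * (q - p)" if "a \<le> p" "p \<le> q" "q \<le> b" for p q
    by (rule speed[OF z S(2) zder that])
  define w where "w t = y t - z t" for t
  have wsp: "norm (w q - w p) \<le> 2 * M * (q - p)" if "a \<le> p" "p \<le> q" "q \<le> b" for p q
  proof -
    have "w q - w p = (y q - y p) - (z q - z p)" by (simp add: w_def)
    then have "norm (w q - w p) \<le> norm (y q - y p) + norm (z q - z p)" by (metis norm_triangle_ineq4)
    then show ?thesis using ysp[OF that] zsp[OF that] by simp
  qed
  have contw: "continuous_on {a..b} w"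
    unfolding w_def using y z by (intro continuous_intros absolutely_continuous_on_imp_continuous_on)
  have "{a..b} \<noteq> {}" "continuous_on {a..b} (\<lambda>t. norm (w t))"
    using ab contw by (auto intro: continuous_on_norm)
  then obtain m where m: "m \<in> {a..b}" "\<And>t. t \<in> {a..b} \<Longrightarrow> norm (w t) \<le> norm (w m)"
    using continuous_attains_sup[OF compact_Icc] by blast
  define s where "s = norm (w m)"
  have s: "s \<ge> 0" "\<And>t. t \<in> {a..b} \<Longrightarrow> norm (w t) \<le> s" using m by (auto simp: s_def)
  define \<phi> where "\<phi> t = g (y t) (w t) (w t)" for t
  have gsp: "norm (g (y q) - g (y p)) \<le> C * (M * (q - p))" if "a \<le> p" "p \<le> q" "q \<le> b" for p q
  proof -
    have "norm (g (y q) - g (y p)) \<le> C * norm (y q - y p)" using yK that by (intro g_lip) auto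
    also have "\<dots> \<le> C * (M * (q - p))" using ysp[OF that] C by (intro mult_left_mono) auto
    finally show ?thesis .
  qed
  have quad: "c u u - c v v = c (u - v) (u + v)" if "\<And>u v. c u v = c v u" for c :: "'a bilinear_form" and u v
    using that[of u v] by (simp add: blinfun.diff_left blinfun.diff_right blinfun.add_right)
  have "\<phi> m - \<phi> a \<le> (2 * B + C * M) * s\<^sup>2 * (m - a)"
  proof (rule absolutely_continuous_increment_le[OF _ _ N])
    \<comment> \<open>This constant serves absolute continuity only. It contains a term linear in
      \<open>s\<close> and would not close the argument; the rate quadratic in \<open>s\<close>
      comes from the derivatives below.\<close>
    have "\<bar>\<phi> q - \<phi> p\<bar> \<le> (C * M * s * s + C * (2 * M) * (s + s)) * (q - p)" if pq: "a \<le> p" "p \<le> q" "q \<le> m" for p q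
    proof -
      have pq': "p \<in> {a..b}" "q \<in> {a..b}" "q \<le> b" using pq m by auto
      have gp: "norm (g (y p)) \<le> C" using yK pq' by (intro g_bound) auto
      have "\<phi> q - \<phi> p = (g (y q) - g (y p)) (w q) (w q) + (g (y p) (w q) (w q) - g (y p) (w p) (w p))"
        by (simp add: \<phi>_def blinfun.diff_left)
      also have "g (y p) (w q) (w q) - g (y p) (w p) (w p) = g (y p) (w q - w p) (w q + w p)"
        using yK pq' by (intro quad form_sym) auto
      finally have "\<bar>\<phi> q - \<phi> p\<bar> \<le> \<bar>(g (y q) - g (y p)) (w q) (w q)\<bar> + \<bar>g (y p) (w q - w p) (w q + w p)\<bar>"
        by linarith
      also have "\<dots> \<le> norm (g (y q) - g (y p)) * norm (w q) * norm (w q) + norm (g (y p)) * norm (w q - w p) * norm (w q + w p)"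
        by (intro add_mono abs_form_le)
      also have "\<dots> \<le> (C * (M * (q - p))) * s * s + C * (2 * M * (q - p)) * (s + s)"
        using gsp[of p q] wsp[of p q] pq pq' s gp C M_bounds
        by (intro add_mono mult_mono norm_triangle_le) auto
      finally show ?thesis by (simp add: algebra_simps)
    qed
    then have "(C * M * s * s + C * (2 * M) * (s + s))-lipschitz_on {a..m} \<phi>"
    proof (intro lipschitz_onI)
      fix p q assume h: "\<And>p q. a \<le> p \<Longrightarrow> p \<le> q \<Longrightarrow> q \<le> m \<Longrightarrow> \<bar>\<phi> q - \<phi> p\<bar> \<le> (C * M * s * s + C * (2 * M) * (s + s)) * (q - p)"
        and pq: "p \<in> {a..m}" "q \<in> {a..m}"
      show "dist (\<phi> p) (\<phi> q) \<le> (C * M * s * s + C * (2 * M) * (s + s)) * dist p q"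
        using h[of p q] h[of q p] pq by (cases "p \<le> q") (auto simp: dist_real_def abs_minus_commute)
    qed (use C M_bounds s in auto)
    then show "absolutely_continuous_on {a..m} \<phi>" by (rule lipschitz_imp_absolutely_continuous_on)
    show "a \<le> m" using m by simp
    show "(2 * B + C * M) * s\<^sup>2 \<ge> 0" using B C M_bounds by simp
    fix t \<epsilon> :: real assume t: "t \<in> {a..m} - N" and e: "\<epsilon> > 0"
    then have tab: "t \<in> {a..b} - N" using m by auto
    obtain v where v: "v \<in> slow_velocities (y t)" "(y has_vector_derivative v) (at t within S)" using yder[OF tab] by blast
    obtain v' where v': "v' \<in> slow_velocities (z t)" "(z has_vector_derivative v') (at t within S')" using zder[OF tab] by blast
    \<comment> \<open>With the form frozen at time \<open>t\<close> the squared distance is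
      differentiable at \<open>t\<close>. Unfreezing it at \<open>p\<close> and \<open>q\<close>
      costs \<open>C * M * s\<^sup>2\<close> times \<open>t - p\<close> and \<open>q - t\<close>,
      which add up to \<open>q - p\<close>.\<close>
    define c where "c = g (y t)"
    have ytK: "y t \<in> K" "z t \<in> K" using yK zK tab by auto
    have "(w has_vector_derivative v - v') (at t within {a..b})"
      unfolding w_def using v(2) v'(2) S by (intro derivative_intros) (auto intro: has_vector_derivative_within_subset)
    then have "((\<lambda>t. c (w t)) has_vector_derivative c (v - v')) (at t within {a..b})"
      by (rule bounded_linear.has_vector_derivative[OF blinfun.bounded_linear_right])
    then have "((\<lambda>t. c (w t) (w t)) has_vector_derivative c (w t) (v - v') + c (v - v') (w t)) (at t within {a..b})"
      using \<open>(w has_vector_derivative v - v') (at t within {a..b})\<close>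
      by (rule blinfun.has_vector_derivative)
    moreover have "c (w t) (v - v') = c (v - v') (w t)" unfolding c_def using form_sym[OF ytK(1)] .
    ultimately have "((\<lambda>t. c (w t) (w t)) has_vector_derivative 2 * c (v - v') (w t)) (at t within {a..b})" by simp
    then obtain \<delta> where d: "\<delta> > 0" "\<And>p q. p \<in> {a..b} \<Longrightarrow> q \<in> {a..b} \<Longrightarrow> p \<le> t \<Longrightarrow> t \<le> q \<Longrightarrow> q - p < \<delta> \<Longrightarrow>
       norm (c (w q) (w q) - c (w p) (w p) - (q - p) *\<^sub>R (2 * c (v - v') (w t))) \<le> \<epsilon> * (q - p)"
      by (rule has_vector_derivative_straddle[OF _ e]) (use tab in auto)
    have "c (v - v') (w t) \<le> B * (norm (w t))\<^sup>2"
      using slow_velocities_one_sided[OF ytK v(1) v'(1)] by (simp add: B_def c_def w_def)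
    also have "\<dots> \<le> B * s\<^sup>2" using B s tab by (intro mult_left_mono power_mono) auto
    finally have D: "c (v - v') (w t) \<le> B * s\<^sup>2" .
    have "\<phi> q - \<phi> p \<le> ((2 * B + C * M) * s\<^sup>2 + \<epsilon>) * (q - p)"
      if pq: "a \<le> p" "p \<le> t" "t \<le> q" "q \<le> m" "q - p < \<delta>" for p q
    proof -
      have pq': "p \<in> {a..b}" "q \<in> {a..b}" "q \<le> b" "t \<le> b" "a \<le> t" using pq m by auto
      have "\<phi> q - \<phi> p = (c (w q) (w q) - c (w p) (w p)) + (g (y q) - c) (w q) (w q) + (c - g (y p)) (w p) (w p)"
        by (simp add: \<phi>_def blinfun.diff_left)
      moreover have "c (w q) (w q) - c (w p) (w p) \<le> \<epsilon> * (q - p) + (q - p) * (2 * c (v - v') (w t))"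
        using d(2)[of p q] pq pq' by (simp add: abs_le_iff)
      moreover have "(q - p) * (2 * c (v - v') (w t)) \<le> (q - p) * (2 * (B * s\<^sup>2))"
        using D pq by (intro mult_left_mono) auto
      moreover have "(g (y q) - c) (w q) (w q) \<le> C * (M * (q - t)) * s * s"
        unfolding c_def using pq pq' s by (intro form_le gsp) auto
      moreover have "(c - g (y p)) (w p) (w p) \<le> C * (M * (t - p)) * s * s"
        unfolding c_def using pq pq' s by (intro form_le gsp) auto
      ultimately show ?thesis by (simp add: algebra_simps power2_eq_square)
    qed
    then show "\<exists>\<delta>>0. \<forall>p q. a \<le> p \<and> p \<le> t \<and> t \<le> q \<and> q \<le> m \<and> q - p < \<delta> \<longrightarrow>
        \<phi> q - \<phi> p \<le> ((2 * B + C * M) * s\<^sup>2 + \<epsilon>) * (q - p)"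
      using d(1) by blast
  qed
  moreover have "\<phi> a = 0" using init by (simp add: \<phi>_def w_def blinfun.zero_right)
  moreover have "\<mu> * s\<^sup>2 \<le> \<phi> m"
    unfolding \<phi>_def s_def using m yK by (intro coercive) auto
  moreover have "(2 * B + C * M) * s\<^sup>2 * (m - a) \<le> (2 * B + C * M) * s\<^sup>2 * (b - a)"
    using B C M_bounds m by (intro mult_left_mono) auto
  ultimately have "\<mu> * s\<^sup>2 \<le> ((2 * B + C * M) * (b - a)) * s\<^sup>2" by (simp add: mult_ac)
  then have "s = 0" using short unfolding B_def[symmetric]
    by (metis mult_less_cancel_right_pos not_le zero_less_power2)
  then show "y t = z t" using s(2)[OF t] by (simp add: w_def)
qed

end

lemma inclusion_solution_restrict:
  assumes "inclusion_solution X F x0 T x"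
  obtains N where "negligible N" "\<And>t. t \<in> {0..<T} - N \<Longrightarrow> \<exists>v\<in>F (x t). (x has_vector_derivative v) (at t within {0..<T})"
proof -
  have "AE t in lebesgue_on {0..<T}. \<exists>v\<in>F (x t). (x has_vector_derivative v) (at t within {0..<T})"
    using assms unfolding inclusion_solution_def by (elim conjE)
  then obtain N where N: "N \<in> null_sets (lebesgue_on {0..<T})"
    "{t \<in> space (lebesgue_on {0..<T}). \<not> (\<exists>v\<in>F (x t). (x has_vector_derivative v) (at t within {0..<T}))} \<subseteq> N"
    unfolding eventually_ae_filter by blast
  have "negligible N" using N(1) by (simp add: null_sets_restrict_space negligible_iff_null_sets)
  moreover have "\<exists>v\<in>F (x t). (x has_vector_derivative v) (at t within {0..<T})" if "t \<in> {0..<T} - N" for t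
    using N(2) that by (auto simp: space_restrict_space)
  ultimately show thesis using that by blast
qed

text \<open>The curves may leave any single chart, so the first time of disagreement is examined. By
  continuity the solutions still agree there, and a chart around the common point yields agreement
  for a little longer.\<close>

lemma krasovskii_solution_unique:
  fixes X :: "'a::euclidean_space set"
  assumes X: "prox_regular X" and f: "locally_lipschitz_on X f"
    and metric: "metric_on X g" and g: "locally_lipschitz_on X g"
    and y: "krasovskii_solution X g f x0 T1 y" and z: "krasovskii_solution X g f x0 T2 z"
    and t: "t \<in> {0..<min T1 T2}"
  shows "y t = z t"
proof (rule ccontr)
  assume ne: "y t \<noteq> z t"
  let ?F = "krasovskii_regularization X (projected_field X g f)"
  have y': "inclusion_solution X ?F x0 T1 y" and z': "inclusion_solution X ?F x0 T2 z"
    using y z by (auto simp: krasovskii_solution_def)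
  have yX: "y s \<in> X" "z s \<in> X" if "s \<in> {0..t}" for s
    using y' z' t that by (auto simp: inclusion_solution_def)
  have ac: "absolutely_continuous_on {p..q} y" "absolutely_continuous_on {p..q} z" if "0 \<le> p" "q \<le> t" for p q
  proof -
    have "absolutely_continuous_on {0..<T1} y" "absolutely_continuous_on {0..<T2} z"
      using y' z' by (auto simp: inclusion_solution_def)
    moreover have "{p..q} \<subseteq> {0..<T1}" "{p..q} \<subseteq> {0..<T2}" using that t by auto
    ultimately show "absolutely_continuous_on {p..q} y" "absolutely_continuous_on {p..q} z"
      using absolutely_continuous_on_subset by blast+
  qed
  obtain N1 where N1: "negligible N1" "\<And>t. t \<in> {0..<T1} - N1 \<Longrightarrow> \<exists>v\<in>?F (y t). (y has_vector_derivative v) (at t within {0..<T1})"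
    using inclusion_solution_restrict[OF y'] by blast
  obtain N2 where N2: "negligible N2" "\<And>t. t \<in> {0..<T2} - N2 \<Longrightarrow> \<exists>v\<in>?F (z t). (z has_vector_derivative v) (at t within {0..<T2})"
    using inclusion_solution_restrict[OF z'] by blast
  have t0: "0 \<le> t" using t by auto
  have cy: "continuous_on {0..t} y" and cz: "continuous_on {0..t} z"
    using ac[of 0 t] absolutely_continuous_on_imp_continuous_on by auto
  define A where "A = {s \<in> {0..t}. y s \<noteq> z s}"
  define \<tau> where "\<tau> = Inf A"
  have A: "A \<noteq> {}" "bdd_below A" "\<And>s. s \<in> A \<Longrightarrow> 0 \<le> s" using ne t0 by (auto simp: A_def bdd_below_def)
  have \<tau>A: "\<tau> \<le> s" if "s \<in> A" for s unfolding \<tau>_def using that A by (intro cInf_lower)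
  have \<tau>0: "0 \<le> \<tau>" unfolding \<tau>_def using A by (intro cInf_greatest)
  have "t \<in> A" using ne t0 by (auto simp: A_def)
  then have \<tau>t: "\<tau> \<le> t" by (rule \<tau>A)
  have eq: "y \<tau> = z \<tau>"
  proof (cases "\<tau> = 0")
    case True then show ?thesis using y' z' by (auto simp: inclusion_solution_def)
  next
    case False
    show ?thesis
    proof (rule ccontr)
      assume "y \<tau> \<noteq> z \<tau>"
      then have pos: "norm (y \<tau> - z \<tau>) > 0" by simp
      have "continuous_on {0..t} (\<lambda>s. y s - z s)" by (intro continuous_intros cy cz)
      then obtain d where d: "d > 0" "\<And>s. s \<in> {0..t} \<Longrightarrow> dist s \<tau> < d \<Longrightarrow> dist (y s - z s) (y \<tau> - z \<tau>) < norm (y \<tau> - z \<tau>)"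
        using pos \<tau>0 \<tau>t unfolding continuous_on_iff by (meson atLeastAtMost_iff)
      define s where "s = max (\<tau> / 2) (\<tau> - d / 2)"
      have s: "s \<in> {0..t}" "dist s \<tau> < d" "s < \<tau>" using False \<tau>0 \<tau>t d(1) by (auto simp: s_def dist_real_def)
      have "y s \<noteq> z s" using d(2)[OF s(1,2)] by (auto simp: dist_norm norm_minus_commute)
      then show False using \<tau>A[of s] s by (auto simp: A_def)
    qed
  qed
  then have \<tau>t': "\<tau> < t" using ne \<tau>t by (cases "\<tau> = t") auto
  have \<tau>X: "y \<tau> \<in> X" using yX \<tau>0 \<tau>t by auto
  obtain r C \<mu> where r: "r > 0" "prox_chart X f g (X \<inter> cball (y \<tau>) r) C \<mu>"
    using prox_chart_exists[OF X f metric g \<tau>X] by blast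
  interpret prox_chart X f g "X \<inter> cball (y \<tau>) r" C \<mu> by (rule r(2))
  obtain d1 where d1: "d1 > 0" "\<And>s. s \<in> {0..t} \<Longrightarrow> dist s \<tau> < d1 \<Longrightarrow> dist (y s) (y \<tau>) < r"
    using cy r(1) \<tau>0 \<tau>t unfolding continuous_on_iff by (meson atLeastAtMost_iff)
  obtain d2 where d2: "d2 > 0" "\<And>s. s \<in> {0..t} \<Longrightarrow> dist s \<tau> < d2 \<Longrightarrow> dist (z s) (z \<tau>) < r"
    using cz r(1) \<tau>0 \<tau>t unfolding continuous_on_iff by (meson atLeastAtMost_iff)
  define Q where "Q = 2 * (C\<^sup>2 + 2 * (C\<^sup>2 * (C + M)) + C * (C + M)) + C * M"
  have Q: "Q > 0" unfolding Q_def using C M_bounds by (intro add_nonneg_pos) auto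
  \<comment> \<open>\<open>d1\<close> and \<open>d2\<close> keep both curves in the chart; the last
    entry gives \<open>Q * (b - \<tau>) \<le> \<mu> / 2\<close>, the shortness required by
    \<open>local_uniqueness\<close>.\<close>
  define b where "b = Min {t, \<tau> + d1 / 2, \<tau> + d2 / 2, \<tau> + \<mu> / (2 * Q)}"
  have b: "\<tau> < b" "b \<le> t" "b \<le> \<tau> + d1 / 2" "b \<le> \<tau> + d2 / 2" "b \<le> \<tau> + \<mu> / (2 * Q)"
    unfolding b_def using \<tau>t' d1(1) d2(1) Q \<mu> by auto
  have near: "dist (y s) (y \<tau>) < r" "dist (z s) (y \<tau>) < r" if "s \<in> {\<tau>..b}" for s
    using d1 d2 b \<tau>0 that eq by (auto simp: dist_real_def intro!: d1(2) d2(2)[folded eq])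
  have same: "y s = z s" if "s \<in> {\<tau>..b}" for s
  proof (rule local_uniqueness[where a = \<tau> and b = b and N = "N1 \<union> N2" and S = "{0..<T1}" and S' = "{0..<T2}"])
    show "y \<tau> = z \<tau>" "s \<in> {\<tau>..b}" by (fact eq that)+
    show "\<tau> \<le> b" using b by simp
    show "absolutely_continuous_on {\<tau>..b} y" "absolutely_continuous_on {\<tau>..b} z"
      using ac[of \<tau> b] \<tau>0 b by auto
    show "y ` {\<tau>..b} \<subseteq> X \<inter> cball (y \<tau>) r" "z ` {\<tau>..b} \<subseteq> X \<inter> cball (y \<tau>) r"
      using near yX \<tau>0 b by (force simp: dist_commute less_imp_le)+
    show "negligible (N1 \<union> N2)" using N1 N2 by simp
    show "{\<tau>..b} \<subseteq> {0..<T1}" "{\<tau>..b} \<subseteq> {0..<T2}" using \<tau>0 b t by auto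
    have "Q * (b - \<tau>) \<le> Q * (\<mu> / (2 * Q))" using b Q by (intro mult_left_mono) auto
    also have "\<dots> < \<mu>" using Q \<mu> by simp
    finally show "(2 * (C\<^sup>2 + 2 * (C\<^sup>2 * (C + M)) + C * (C + M)) + C * M) * (b - \<tau>) < \<mu>" by (simp add: Q_def)
    fix s assume s: "s \<in> {\<tau>..b} - (N1 \<union> N2)"
    have s12: "s \<in> {0..<T1} - N1" "s \<in> {0..<T2} - N2" "s \<in> {0..t}" using s \<tau>0 b t by auto
    have slow: "v \<in> slow_velocities x" if "v \<in> ?F x" "x \<in> X" "dist x (y \<tau>) < r" for x v
      using that by (intro krasovskii_slow[of "ball (y \<tau>) r"]) (auto simp: dist_commute less_imp_le)
    have n: "dist (y s) (y \<tau>) < r" "dist (z s) (y \<tau>) < r" using near s by auto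
    show "\<exists>v\<in>slow_velocities (y s). (y has_vector_derivative v) (at s within {0..<T1})"
      using N1(2)[OF s12(1)] slow[OF _ yX(1)[OF s12(3)] n(1)] by blast
    show "\<exists>v\<in>slow_velocities (z s). (z has_vector_derivative v) (at s within {0..<T2})"
      using N2(2)[OF s12(2)] slow[OF _ yX(2)[OF s12(3)] n(2)] by blast
  qed
  have "\<exists>a\<in>A. a < b"
    using b(1) A cInf_less_iff[OF A(1,2)] unfolding \<tau>_def by blast
  then obtain a where a: "a \<in> A" "a < b" by blast
  then have "a \<in> {\<tau>..b}" using \<tau>A by auto
  then show False using same a by (auto simp: A_def)
qed

section \<open>Existence\<close>

lemma tangent_coneI:
  assumes "\<And>k. xs k \<in> X" "xs \<longlonglongrightarrow> x" "\<And>k. \<delta> k > 0" "\<delta> \<longlonglongrightarrow> (0::real)"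
    "(\<lambda>k. (xs k - x) /\<^sub>R \<delta> k) \<longlonglongrightarrow> v"
  shows "v \<in> tangent_cone X x"
  unfolding tangent_cone_def
  by (rule CollectI, rule exI[of _ xs], rule exI[of _ \<delta>], intro conjI allI assms)

lemma has_vector_derivative_sequential:
  fixes x :: "real \<Rightarrow> 'a::real_normed_vector"
  assumes v: "(x has_vector_derivative v) (at t)" and \<delta>: "\<delta> \<longlonglongrightarrow> 0" "\<And>k. \<delta> k \<noteq> 0"
  shows "(\<lambda>k. (x (t + \<delta> k) - x t) /\<^sub>R \<delta> k) \<longlonglongrightarrow> v"
proof (rule tendstoI)
  fix e :: real assume "e > 0"
  then obtain d where d: "d > 0" "\<And>y. norm (y - t) < d \<Longrightarrow> norm (x y - x t - (y - t) *\<^sub>R v) \<le> e / 2 * norm (y - t)"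
    using v unfolding has_vector_derivative_def has_derivative_at_alt by (meson half_gt_zero)
  have "\<forall>\<^sub>F k in sequentially. dist (\<delta> k) 0 < d" using \<delta>(1) d(1) by (rule tendstoD)
  then show "\<forall>\<^sub>F k in sequentially. dist ((x (t + \<delta> k) - x t) /\<^sub>R \<delta> k) v < e"
  proof eventually_elim
    case (elim k)
    have "(x (t + \<delta> k) - x t) /\<^sub>R \<delta> k - v = (x (t + \<delta> k) - x t - \<delta> k *\<^sub>R v) /\<^sub>R \<delta> k"
      using \<delta>(2)[of k] by (simp add: scaleR_diff_right)
    then have "dist ((x (t + \<delta> k) - x t) /\<^sub>R \<delta> k) v = norm (x (t + \<delta> k) - x t - \<delta> k *\<^sub>R v) / \<bar>\<delta> k\<bar>"
      by (simp add: dist_norm divide_inverse mult.commute)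
    also have "\<dots> \<le> (e / 2 * \<bar>\<delta> k\<bar>) / \<bar>\<delta> k\<bar>"
      using d(2)[of "t + \<delta> k"] elim by (intro divide_right_mono) auto
    also have "\<dots> < e" using \<delta>(2)[of k] \<open>e > 0\<close> by simp
    finally show ?case .
  qed
qed

section \<open>The projected Euler scheme\<close>

locale prox_chart_ball = prox_chart +
  fixes x0 :: 'a and r :: real
  assumes compactK: "compact K" and x0: "x0 \<in> K" and nbhd: "X \<inter> ball x0 r \<subseteq> K"
begin

text \<open>Compactness of \<open>K\<close> provides a minimizer, which need not be unique, hence
  the choice. The form is frozen at the old point, while the residual will be a normal at the new
  one.\<close>

definition euler_step :: "real \<Rightarrow> 'a \<Rightarrow> 'a" where
  "euler_step h y = (SOME p. p \<in> K \<and> (\<forall>z\<in>K. g y (y + h *\<^sub>R f y - p) (y + h *\<^sub>R f y - p) \<le>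
     g y (y + h *\<^sub>R f y - z) (y + h *\<^sub>R f y - z)))"

lemma euler_step:
  assumes "y \<in> K"
  shows euler_step_in: "euler_step h y \<in> K"
    and euler_step_min: "z \<in> K \<Longrightarrow>
      g y (y + h *\<^sub>R f y - euler_step h y) (y + h *\<^sub>R f y - euler_step h y) \<le>
      g y (y + h *\<^sub>R f y - z) (y + h *\<^sub>R f y - z)"
proof -
  have "K \<noteq> {}" "continuous_on K (\<lambda>z. g y (y + h *\<^sub>R f y - z) (y + h *\<^sub>R f y - z))"
    using assms by (auto intro!: continuous_intros)
  then have "\<exists>p. p \<in> K \<and> (\<forall>z\<in>K. g y (y + h *\<^sub>R f y - p) (y + h *\<^sub>R f y - p) \<le>
     g y (y + h *\<^sub>R f y - z) (y + h *\<^sub>R f y - z))"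
    using continuous_attains_inf[OF compactK] by blast
  from someI_ex[OF this] show "euler_step h y \<in> K" and "z \<in> K \<Longrightarrow>
      g y (y + h *\<^sub>R f y - euler_step h y) (y + h *\<^sub>R f y - euler_step h y) \<le>
      g y (y + h *\<^sub>R f y - z) (y + h *\<^sub>R f y - z)"
    unfolding euler_step_def by blast+
qed

text \<open>Staying at \<open>y\<close> is an admissible competitor, with residual
  \<open>h *\<^sub>R f y\<close>.\<close>

lemma euler_step_bounds:
  assumes y: "y \<in> K" and h: "h \<ge> 0"
  shows euler_step_residual: "norm (y + h *\<^sub>R f y - euler_step h y) \<le> h * M"
    and euler_step_dist: "norm (euler_step h y - y) \<le> h * M"
proof -
  have "g y (y + h *\<^sub>R f y - euler_step h y) (y + h *\<^sub>R f y - euler_step h y) \<le> g y (h *\<^sub>R f y) (h *\<^sub>R f y)"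
    using euler_step_min[OF y y, of h] by simp
  then have 1: "norm (y + h *\<^sub>R f y - euler_step h y) \<le> h * (C * sqrt (C / \<mu>))"
    by (rule norm_le_of_form_le[OF y _ h])
  have 2: "norm (h *\<^sub>R f y) \<le> h * C" using f_bound[OF y] h by (simp add: mult_left_mono)
  have 3: "0 \<le> h * C" using h C by simp
  have eq: "h * M = h * C + h * (C * sqrt (C / \<mu>))" by (simp add: M_def distrib_left)
  show "norm (y + h *\<^sub>R f y - euler_step h y) \<le> h * M" using 1 3 eq by linarith
  have "euler_step h y - y = h *\<^sub>R f y - (y + h *\<^sub>R f y - euler_step h y)" by simp
  then have "norm (euler_step h y - y) \<le> norm (h *\<^sub>R f y) + norm (y + h *\<^sub>R f y - euler_step h y)"
    by (metis norm_triangle_ineq4)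
  then show "norm (euler_step h y - y) \<le> h * M" using 1 2 eq by linarith
qed

text \<open>The step minimizes over \<open>K\<close> only, but in the open ball \<open>K\<close>
  contains all of \<open>X\<close>, so there the minimum is a local one over
  \<open>X\<close>.\<close>

lemma euler_step_polar:
  assumes y: "y \<in> K" and p: "euler_step h y \<in> ball x0 r"
  shows "g y (y + h *\<^sub>R f y - euler_step h y) \<in> tangent_polar X (euler_step h y)"
proof (rule nearest_point_residual_polar[OF _ open_ball p])
  show "g y u v = g y v u" for u v by (rule form_sym[OF y])
  fix z assume "z \<in> X \<inter> ball x0 r"
  then show "g y (y + h *\<^sub>R f y - euler_step h y) (y + h *\<^sub>R f y - euler_step h y) \<le>
      g y (y + h *\<^sub>R f y - z) (y + h *\<^sub>R f y - z)"
    using nbhd by (intro euler_step_min[OF y]) auto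
qed

definition euler :: "real \<Rightarrow> nat \<Rightarrow> 'a" where
  "euler h n = (euler_step h ^^ n) x0"

lemma euler_0 [simp]: "euler h 0 = x0" and euler_Suc [simp]: "euler h (Suc n) = euler_step h (euler h n)"
  by (auto simp: euler_def)

lemma euler_in: "euler h n \<in> K"
  by (induction n) (auto simp: x0 euler_step_in)

lemma euler_dist:
  assumes "h \<ge> 0"
  shows "norm (euler h (i + n) - euler h i) \<le> real n * h * M"
proof (induction n)
  case (Suc n)
  have "euler h (i + Suc n) - euler h i = (euler_step h (euler h (i + n)) - euler h (i + n)) + (euler h (i + n) - euler h i)"
    by simp
  moreover have "norm (euler_step h (euler h (i + n)) - euler h (i + n)) \<le> h * M"
    by (rule euler_step_dist[OF euler_in assms])
  ultimately have "norm (euler h (i + Suc n) - euler h i) \<le> h * M + real n * h * M"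
    using Suc by (metis add_mono norm_triangle_le)
  then show ?case by (simp add: algebra_simps)
qed simp

text \<open>The sum of the coefficients of \<open>a\<^sup>2\<close> (first summand) and of
  \<open>d\<close> (the others) in the one-step error of \<open>euler_increment\<close>.\<close>

definition Q :: real where
  "Q = 2 * C\<^sup>2 * M + C ^ 3 * M + 2 * C ^ 3 * M\<^sup>2 + C * M\<^sup>2 + C\<^sup>2 * M\<^sup>2"

lemma Q_nonneg: "Q \<ge> 0"
  using C M_bounds by (simp add: Q_def)

text \<open>The step from \<open>y\<close> to \<open>p\<close> has a residual that is normal at
  \<open>p\<close> through \<open>g y\<close>, whereas the claim refers to the earlier point
  \<open>x\<close>. Passing from \<open>f y\<close>, \<open>g y\<close> and \<open>z - p\<close> to
  \<open>f x\<close>, \<open>g x\<close> and \<open>z - x\<close> costs \<open>h\<close> times order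
  \<open>d\<close>; prox-regularity at \<open>p\<close> adds \<open>h\<close> times order
  \<open>a\<^sup>2 + d\<close>.\<close>

lemma euler_increment:
  assumes h: "h \<ge> 0" and small: "real (i + Suc n) * h * M < r" and z: "z \<in> K"
  shows "g (euler h i) (h *\<^sub>R f (euler h i) - (euler h (i + Suc n) - euler h (i + n))) (z - euler h i) \<le>
    h * Q * ((norm (z - euler h i))\<^sup>2 + real (Suc n) * h)"
proof -
  define x where "x = euler h i"
  define y where "y = euler h (i + n)"
  define p where "p = euler_step h y"
  define e where "e = y + h *\<^sub>R f y - p"
  define d where "d = real (Suc n) * h"
  define a where "a = norm (z - x)"
  have K: "x \<in> K" "y \<in> K" "p \<in> K" unfolding x_def y_def p_def using euler_in euler_step_in by auto
  have d: "d \<ge> 0" "h \<ge> 0" using h by (auto simp: d_def)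
  have a: "0 \<le> a" "a \<le> C" unfolding a_def using diam[OF z K(1)] by auto
  have M0: "M \<ge> 0" "C \<ge> 0" using M_bounds C by auto
  have yx: "norm (y - x) \<le> d * M"
  proof -
    have "norm (y - x) \<le> real n * h * M" unfolding x_def y_def by (rule euler_dist[OF h])
    also have "\<dots> \<le> d * M" unfolding d_def using h M0 by (intro mult_right_mono) auto
    finally show ?thesis .
  qed
  have px: "norm (p - x) \<le> d * M"
    using euler_dist[OF h, of i "Suc n"] by (simp add: x_def y_def p_def d_def)
  have e: "norm e \<le> h * M" unfolding e_def p_def by (rule euler_step_residual[OF K(2) h])
  have "p \<in> ball x0 r"
    using euler_dist[OF h, of 0 "i + Suc n"] small by (simp add: p_def y_def dist_norm norm_minus_commute)
  then have pol: "g y e \<in> tangent_polar X p"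
    using euler_step_polar[OF K(2)] by (simp add: e_def p_def)
  have gye: "norm (g y e) \<le> C * (h * M)"
    using norm_blinfun[of "g y" e] mult_mono[OF g_bound[OF K(2)] e] M0 by auto
  have T1: "g x (h *\<^sub>R (f x - f y)) (z - x) \<le> C * (h * (C * (d * M))) * C"
  proof (intro form_le g_bound K diam z)
    have "norm (f x - f y) \<le> C * norm (y - x)" using f_lip[OF K(1,2)] by (simp add: norm_minus_commute)
    also have "\<dots> \<le> C * (d * M)" using yx M0 by (intro mult_left_mono)
    finally show "norm (h *\<^sub>R (f x - f y)) \<le> h * (C * (d * M))" using h by (simp add: mult_left_mono)
  qed
  have T2: "g y e (z - p) \<le> C * (C * (h * M)) * (2 * a\<^sup>2 + 2 * (d * M) * C)"
  proof -
    \<comment> \<open>One factor of \<open>b\<^sup>2\<close> is bounded by the diameter bound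
      \<open>C\<close>, so that the displacement enters linearly in \<open>d\<close>.\<close>
    define b where "b = norm (p - x)"
    have b: "0 \<le> b" "b \<le> d * M" "b \<le> C" unfolding b_def using px diam[OF K(3,1)] by auto
    have "z - p = (z - x) - (p - x)" by simp
    then have "norm (z - p) \<le> a + b" unfolding a_def b_def by (metis norm_triangle_ineq4)
    then have "(norm (z - p))\<^sup>2 \<le> (a + b)\<^sup>2" by (intro power_mono) auto
    also have "\<dots> \<le> 2 * a\<^sup>2 + 2 * b\<^sup>2" using sum_squares_bound[of a b] by (simp add: power2_sum)
    also have "b\<^sup>2 \<le> (d * M) * C" unfolding power2_eq_square using b d M0 by (intro mult_mono) auto
    finally have zp: "(norm (z - p))\<^sup>2 \<le> 2 * a\<^sup>2 + 2 * (d * M) * C" by simp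
    have "g y e (z - p) \<le> C * norm (g y e) * (norm (z - p))\<^sup>2" by (rule prox[OF K(3) z pol])
    also have "\<dots> \<le> C * (C * (h * M)) * (2 * a\<^sup>2 + 2 * (d * M) * C)"
      using gye zp M0 h by (intro mult_mono) auto
    finally show ?thesis .
  qed
  have T3: "g y e (p - x) \<le> C * (h * M) * (d * M)"
    by (intro form_le g_bound K e px)
  have T4: "(g x - g y) e (z - x) \<le> (C * (d * M)) * (h * M) * C"
  proof (intro form_le e diam z K)
    have "norm (g x - g y) \<le> C * norm (y - x)" using g_lip[OF K(1,2)] by (simp add: norm_minus_commute)
    also have "\<dots> \<le> C * (d * M)" using yx M0 by (intro mult_left_mono)
    finally show "norm (g x - g y) \<le> C * (d * M)" .
  qed
  have "h *\<^sub>R f x - (p - y) = h *\<^sub>R (f x - f y) + e" by (simp add: e_def scaleR_diff_right)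
  then have "g x (h *\<^sub>R f x - (p - y)) (z - x) = g x (h *\<^sub>R (f x - f y)) (z - x) + g x e (z - x)"
    by (simp only: blinfun.add_right blinfun.add_left)
  also have "g x e (z - x) = (g x - g y) e (z - x) + g y e (z - x)"
    by (simp add: blinfun.diff_left)
  also have "g y e (z - x) = g y e (z - p) + g y e (p - x)"
    by (simp add: blinfun.diff_right)
  finally have "g x (h *\<^sub>R f x - (p - y)) (z - x) \<le>
      C * (h * (C * (d * M))) * C + (C * (d * M)) * (h * M) * C + C * (C * (h * M)) * (2 * a\<^sup>2 + 2 * (d * M) * C) + C * (h * M) * (d * M)"
    using T1 T2 T3 T4 by linarith
  also have "\<dots> = h * ((2 * C\<^sup>2 * M) * a\<^sup>2 + (C ^ 3 * M + 2 * C ^ 3 * M\<^sup>2 + C * M\<^sup>2 + C\<^sup>2 * M\<^sup>2) * d)"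
    by (simp add: algebra_simps power2_eq_square power3_eq_cube)
  also have "\<dots> \<le> h * (Q * a\<^sup>2 + Q * d)"
    using M0 d by (intro mult_left_mono add_mono mult_right_mono) (auto simp: Q_def)
  finally show ?thesis by (simp add: x_def y_def p_def a_def d_def algebra_simps)
qed

lemma euler_inequality:
  assumes h: "h \<ge> 0" and small: "real (i + n) * h * M < r" and z: "z \<in> K"
  shows "g (euler h i) ((real n * h) *\<^sub>R f (euler h i) - (euler h (i + n) - euler h i)) (z - euler h i) \<le>
    Q * (real n * h) * ((norm (z - euler h i))\<^sup>2 + real n * h)"
  using small
proof (induction n)
  case 0
  then show ?case by (simp add: blinfun.zero_right)
next
  case (Suc n)
  define a where "a = (norm (z - euler h i))\<^sup>2"
  have "real (i + n) * h * M \<le> real (i + Suc n) * h * M"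
    using h M_bounds by (intro mult_right_mono) auto
  then have IH: "g (euler h i) ((real n * h) *\<^sub>R f (euler h i) - (euler h (i + n) - euler h i)) (z - euler h i) \<le>
    Q * (real n * h) * (a + real n * h)" using Suc by (simp add: a_def)
  have "(real (Suc n) * h) *\<^sub>R f (euler h i) - (euler h (i + Suc n) - euler h i) =
     ((real n * h) *\<^sub>R f (euler h i) - (euler h (i + n) - euler h i)) +
     (h *\<^sub>R f (euler h i) - (euler h (i + Suc n) - euler h (i + n)))"
    by (simp add: algebra_simps)
  then have "g (euler h i) ((real (Suc n) * h) *\<^sub>R f (euler h i) - (euler h (i + Suc n) - euler h i)) (z - euler h i) =
     g (euler h i) ((real n * h) *\<^sub>R f (euler h i) - (euler h (i + n) - euler h i)) (z - euler h i) +
     g (euler h i) (h *\<^sub>R f (euler h i) - (euler h (i + Suc n) - euler h (i + n))) (z - euler h i)"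
    by (simp only: blinfun.add_right blinfun.add_left)
  also have "\<dots> \<le> Q * (real n * h) * (a + real n * h) + h * Q * (a + real (Suc n) * h)"
    using IH euler_increment[OF h Suc.prems z] by (simp only: a_def add_mono)
  \<comment> \<open>Enlarging the elapsed time in the old bound lets both summands combine with the
    same constant \<open>Q\<close>.\<close>
  also have "Q * (real n * h) * (a + real n * h) \<le> Q * (real n * h) * (a + real (Suc n) * h)"
    using Q_nonneg h by (intro mult_left_mono add_mono mult_right_mono) auto
  also have "Q * (real n * h) * (a + real (Suc n) * h) + h * Q * (a + real (Suc n) * h) = Q * (real (Suc n) * h) * (a + real (Suc n) * h)"
    by (simp add: algebra_simps)
  finally show ?case by (simp add: a_def)
qed

section \<open>Passage to the limit as the mesh tends to zero\<close>

definition mesh :: "nat \<Rightarrow> real" where "mesh N = inverse (real (Suc N))"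

definition grid :: "nat \<Rightarrow> real \<Rightarrow> nat" where "grid N t = nat \<lfloor>t / mesh N\<rfloor>"

lemma mesh_pos: "mesh N > 0" by (simp add: mesh_def)

lemma grid:
  assumes "t \<ge> 0"
  shows "real (grid N t) * mesh N \<le> t" "t < real (grid N t) * mesh N + mesh N"
proof -
  have "t / mesh N \<ge> 0" using assms mesh_pos[of N] by simp
  then have "real (grid N t) = of_int \<lfloor>t / mesh N\<rfloor>" unfolding grid_def by simp
  then have "real (grid N t) \<le> t / mesh N" "t / mesh N < real (grid N t) + 1" by linarith+
  then show "real (grid N t) * mesh N \<le> t" "t < real (grid N t) * mesh N + mesh N"
    using mesh_pos[of N] by (auto simp: pos_le_divide_eq pos_divide_less_eq distrib_right)
qed

lemma grid_mono: "s \<le> t \<Longrightarrow> grid N s \<le> grid N t"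
  unfolding grid_def using mesh_pos[of N] by (intro nat_mono floor_mono divide_right_mono) auto

lemma grid_diff:
  assumes "0 \<le> s" "s \<le> t"
  shows "\<bar>(t - s) - real (grid N t - grid N s) * mesh N\<bar> \<le> mesh N"
proof -
  have "real (grid N t - grid N s) * mesh N = real (grid N t) * mesh N - real (grid N s) * mesh N"
    using grid_mono[OF assms(2)] by (simp add: of_nat_diff left_diff_distrib)
  then show ?thesis using grid[of s N] grid[of t N] assms by linarith
qed

lemma euler_grid_dist:
  assumes st: "0 \<le> s" "s \<le> t" and \<epsilon>: "mesh N \<le> \<epsilon>"
  shows "norm (euler (mesh N) (grid N t) - euler (mesh N) (grid N s)) \<le> (t - s + \<epsilon>) * M"
proof -
  let ?n = "grid N t - grid N s"
  have "norm (euler (mesh N) (grid N s + ?n) - euler (mesh N) (grid N s)) \<le> real ?n * mesh N * M"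
    using mesh_pos[of N] by (intro euler_dist) simp
  also have "\<dots> \<le> (t - s + \<epsilon>) * M"
    using grid_diff[OF st, of N] \<epsilon> M_bounds by (intro mult_right_mono) linarith+
  finally show ?thesis using grid_mono[OF st(2), of N] by simp
qed

text \<open>Rounding to the grid changes elapsed times by at most the mesh; the last term is the
  rounding error in the multiple of \<open>f y\<close>. A fixed \<open>\<epsilon>\<close> in place
  of the mesh keeps the bound independent of \<open>N\<close>, so that it passes to the limit before
  \<open>\<epsilon>\<close> tends to zero.\<close>

lemma euler_grid_inequality:
  assumes st: "0 \<le> s" "s \<le> t" "t * M < r" and \<epsilon>: "mesh N \<le> \<epsilon>" and z: "z \<in> K"
  defines "y \<equiv> euler (mesh N) (grid N s)"
  shows "g y ((t - s) *\<^sub>R f y - (euler (mesh N) (grid N t) - y)) (z - y) \<le>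
    Q * (t - s + \<epsilon>) * ((norm (z - y))\<^sup>2 + (t - s + \<epsilon>)) + C * (\<epsilon> * C) * C"
proof -
  define n where "n = grid N t - grid N s"
  define d where "d = real n * mesh N"
  have gt: "grid N s + n = grid N t" using grid_mono[OF st(2), of N] by (simp add: n_def)
  have y: "y \<in> K" unfolding y_def by (rule euler_in)
  have d: "d \<ge> 0" "\<bar>(t - s) - d\<bar> \<le> \<epsilon>" "d \<le> t - s + \<epsilon>"
    using grid_diff[OF st(1,2), of N] \<epsilon> mesh_pos[of N] by (auto simp: d_def n_def)
  have "real (grid N s + n) * mesh N * M \<le> t * M"
    unfolding gt using grid[of t N] st M_bounds by (intro mult_right_mono) auto
  then have small: "real (grid N s + n) * mesh N * M < r" using st by linarith
  have "(t - s) *\<^sub>R f y - (euler (mesh N) (grid N t) - y) =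
     (d *\<^sub>R f y - (euler (mesh N) (grid N s + n) - y)) + ((t - s) - d) *\<^sub>R f y"
    unfolding gt by (simp add: algebra_simps)
  then have "g y ((t - s) *\<^sub>R f y - (euler (mesh N) (grid N t) - y)) (z - y) =
     g y (d *\<^sub>R f y - (euler (mesh N) (grid N s + n) - y)) (z - y) + g y (((t - s) - d) *\<^sub>R f y) (z - y)"
    by (simp only: blinfun.add_right blinfun.add_left)
  also have "g y (d *\<^sub>R f y - (euler (mesh N) (grid N s + n) - y)) (z - y) \<le> Q * d * ((norm (z - y))\<^sup>2 + d)"
    unfolding y_def d_def using mesh_pos[of N] by (intro euler_inequality small z) simp
  also have "Q * d * ((norm (z - y))\<^sup>2 + d) \<le> Q * (t - s + \<epsilon>) * ((norm (z - y))\<^sup>2 + (t - s + \<epsilon>))"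
    using d Q_nonneg by (intro mult_mono add_mono mult_left_mono mult_nonneg_nonneg) auto
  also have "g y (((t - s) - d) *\<^sub>R f y) (z - y) \<le> C * (\<epsilon> * C) * C"
  proof (intro form_le g_bound y diam z)
    show "norm (((t - s) - d) *\<^sub>R f y) \<le> \<epsilon> * C"
      unfolding norm_scaleR using d f_bound[OF y] C by (intro mult_mono) auto
  qed
  finally show ?thesis by simp
qed

text \<open>The step functions take values in the compact set \<open>K\<close>, so by Tychonoff they have a pointwise
  cluster point; each of the estimates involves only two times and survives in it.\<close>

lemma euler_cluster_point:
  assumes T: "T \<ge> 0" "T * M < r"
  obtains x where "\<And>t. x t \<in> K" "x 0 = x0" "M-lipschitz_on UNIV x"
    "\<And>s t z. 0 \<le> s \<Longrightarrow> s \<le> t \<Longrightarrow> t \<le> T \<Longrightarrow> z \<in> K \<Longrightarrow>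
      g (x s) ((t - s) *\<^sub>R f (x s) - (x t - x s)) (z - x s) \<le> Q * (t - s) * ((norm (z - x s))\<^sup>2 + (t - s))"
proof -
  \<comment> \<open>Clamping times to \<open>[0, T]\<close> makes the limit curve Lipschitz on the
    whole line, as the differentiability theorem demands.\<close>
  define cl where "cl t = max 0 (min T t)" for t
  define Y where "Y N t = euler (mesh N) (grid N (cl t))" for N t
  define P where "P = PiE UNIV (\<lambda>_::real. K)"
  have "compactin (product_topology (\<lambda>_::real. euclidean) UNIV) P"
    unfolding P_def compactin_PiE using compactK by simp
  then have "compact P" unfolding euclidean_product_topology by simp
  moreover have YP: "Y N \<in> P" for N by (auto simp: P_def Y_def euler_in)
  ultimately obtain x where x: "x \<in> P" "inf (nhds x) (filtermap Y sequentially) \<noteq> bot"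
    unfolding compact_filter
    by (metis (mono_tags, lifting) eventually_filtermap always_eventually filtermap_bot_iff sequentially_bot)
  \<comment> \<open>A filter replaces a convergent subsequence, because an uncountable product of
    compact sets need not be sequentially compact. Along \<open>G\<close> every coordinate tends to
    that of \<open>x\<close>, and whatever holds for \<open>Y N\<close> eventually holds as
    well.\<close>
  define G where "G = inf (nhds x) (filtermap Y sequentially)"
  have Gbot: "G \<noteq> bot" using x(2) by (simp add: G_def)
  have xK: "x t \<in> K" for t using x(1) by (auto simp: P_def)
  have evG: "\<forall>\<^sub>F \<omega> in G. R \<omega>" if "\<forall>\<^sub>F N in sequentially. R (Y N)" for R
    using that unfolding G_def by (metis eventually_filtermap filter_leD inf_le2)
  have lim: "((\<lambda>\<omega>. \<omega> t) \<longlongrightarrow> x t) G" for t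
  proof -
    have "continuous_on UNIV (\<lambda>\<omega>::real \<Rightarrow> 'a. \<omega> t)" by simp
    then have "((\<lambda>\<omega>. \<omega> t) \<longlongrightarrow> x t) (at x)" unfolding continuous_on_def by blast
    then have "((\<lambda>\<omega>. \<omega> t) \<longlongrightarrow> x t) (nhds x)"
      by (rule tendsto_at_iff_tendsto_nhds[THEN iffD1])
    then show ?thesis unfolding G_def by (rule tendsto_mono[OF inf_le1])
  qed
  have inK: "\<forall>\<^sub>F \<omega> in G. \<omega> t \<in> K" for t by (rule evG) (simp add: Y_def euler_in)
  have small: "\<forall>\<^sub>F N in sequentially. mesh N \<le> \<epsilon>" if "\<epsilon> > 0" for \<epsilon>
    using order_tendstoD(2)[OF LIMSEQ_inverse_real_of_nat that]
    by eventually_elim (simp add: mesh_def)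
  have lip: "norm (x t - x s) \<le> M * \<bar>t - s\<bar>" for s t
  proof -
    have 1: "norm (x t - x s) \<le> (cl t - cl s + \<epsilon>) * M" if st: "s \<le> t" and e: "\<epsilon> > 0" for s t \<epsilon>
    proof -
      have "cl s \<le> cl t" "0 \<le> cl s" using st by (auto simp: cl_def)
      then have "\<forall>\<^sub>F \<omega> in G. norm (\<omega> t - \<omega> s) \<le> (cl t - cl s + \<epsilon>) * M"
        using small[OF e] by (intro evG) (auto simp: Y_def elim!: eventually_mono intro!: euler_grid_dist)
      then show ?thesis by (rule tendsto_upperbound[OF tendsto_norm[OF tendsto_diff[OF lim lim]] _ Gbot])
    qed
    have 2: "norm (x t - x s) \<le> (t - s) * M" if st: "s \<le> t" for s t
    proof -
      have "((\<lambda>\<epsilon>. (cl t - cl s + \<epsilon>) * M) \<longlongrightarrow> (cl t - cl s + 0) * M) (at_right 0)"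
        by (intro tendsto_intros)
      moreover have "\<forall>\<^sub>F \<epsilon> in at_right 0. norm (x t - x s) \<le> (cl t - cl s + \<epsilon>) * M"
        unfolding eventually_at_right_field using 1[OF st] by (intro exI[of _ 1]) auto
      ultimately have "norm (x t - x s) \<le> (cl t - cl s + 0) * M"
        by (rule tendsto_lowerbound) simp
      also have "\<dots> \<le> (t - s) * M" using st M_bounds T by (intro mult_right_mono) (auto simp: cl_def)
      finally show ?thesis .
    qed
    show ?thesis
    proof (cases "s \<le> t")
      case True then show ?thesis using 2[of s t] by (simp add: mult.commute)
    next
      case False then show ?thesis using 2[of t s] by (simp add: mult.commute norm_minus_commute)
    qed
  qed
  have ineq: "g (x s) ((t - s) *\<^sub>R f (x s) - (x t - x s)) (z - x s) \<le> Q * (t - s) * ((norm (z - x s))\<^sup>2 + (t - s))"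
    if st: "0 \<le> s" "s \<le> t" "t \<le> T" and z: "z \<in> K" for s t z
  proof -
    have cl: "cl s = s" "cl t = t" using st by (auto simp: cl_def)
    have "t * M \<le> T * M" using st M_bounds by (intro mult_right_mono) auto
    then have tr: "t * M < r" using T by linarith
    have 1: "g (x s) ((t - s) *\<^sub>R f (x s) - (x t - x s)) (z - x s) \<le>
        Q * (t - s + \<epsilon>) * ((norm (z - x s))\<^sup>2 + (t - s + \<epsilon>)) + C * (\<epsilon> * C) * C" if e: "\<epsilon> > 0" for \<epsilon>
    proof (rule tendsto_le[OF Gbot])
      show "((\<lambda>\<omega>. g (\<omega> s) ((t - s) *\<^sub>R f (\<omega> s) - (\<omega> t - \<omega> s)) (z - \<omega> s)) \<longlongrightarrow>
         g (x s) ((t - s) *\<^sub>R f (x s) - (x t - x s)) (z - x s)) G"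
        by (intro tendsto_intros lim continuous_on_tendsto_compose[OF continuous_f lim xK inK]
          continuous_on_tendsto_compose[OF continuous_g lim xK inK])
      show "((\<lambda>\<omega>. Q * (t - s + \<epsilon>) * ((norm (z - \<omega> s))\<^sup>2 + (t - s + \<epsilon>)) + C * (\<epsilon> * C) * C) \<longlongrightarrow>
         Q * (t - s + \<epsilon>) * ((norm (z - x s))\<^sup>2 + (t - s + \<epsilon>)) + C * (\<epsilon> * C) * C) G"
        by (intro tendsto_intros lim)
      show "\<forall>\<^sub>F \<omega> in G. g (\<omega> s) ((t - s) *\<^sub>R f (\<omega> s) - (\<omega> t - \<omega> s)) (z - \<omega> s) \<le>
         Q * (t - s + \<epsilon>) * ((norm (z - \<omega> s))\<^sup>2 + (t - s + \<epsilon>)) + C * (\<epsilon> * C) * C"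
      proof (rule evG)
        show "\<forall>\<^sub>F N in sequentially. g (Y N s) ((t - s) *\<^sub>R f (Y N s) - (Y N t - Y N s)) (z - Y N s) \<le>
         Q * (t - s + \<epsilon>) * ((norm (z - Y N s))\<^sup>2 + (t - s + \<epsilon>)) + C * (\<epsilon> * C) * C"
          using small[OF e]
        proof eventually_elim
          case (elim N)
          show ?case unfolding Y_def cl by (rule euler_grid_inequality[OF st(1,2) tr elim z])
        qed
      qed
    qed
    have "((\<lambda>\<epsilon>. Q * (t - s + \<epsilon>) * ((norm (z - x s))\<^sup>2 + (t - s + \<epsilon>)) + C * (\<epsilon> * C) * C) \<longlongrightarrow>
        Q * (t - s + 0) * ((norm (z - x s))\<^sup>2 + (t - s + 0)) + C * (0 * C) * C) (at_right 0)"
      by (intro tendsto_intros)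
    moreover have "\<forall>\<^sub>F \<epsilon> in at_right 0. g (x s) ((t - s) *\<^sub>R f (x s) - (x t - x s)) (z - x s) \<le>
        Q * (t - s + \<epsilon>) * ((norm (z - x s))\<^sup>2 + (t - s + \<epsilon>)) + C * (\<epsilon> * C) * C"
      unfolding eventually_at_right_field using 1 by (intro exI[of _ 1]) auto
    ultimately have "g (x s) ((t - s) *\<^sub>R f (x s) - (x t - x s)) (z - x s) \<le>
        Q * (t - s + 0) * ((norm (z - x s))\<^sup>2 + (t - s + 0)) + C * (0 * C) * C"
      by (rule tendsto_lowerbound) simp
    then show ?thesis by simp
  qed
  have "x 0 = x0"
  proof -
    have "\<forall>\<^sub>F \<omega> in G. \<omega> 0 = x0" by (rule evG) (use T in \<open>simp add: Y_def cl_def grid_def\<close>)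
    then have "((\<lambda>\<omega>. \<omega> 0) \<longlongrightarrow> x0) G" by (rule tendsto_eventually)
    then show ?thesis using lim[of 0] Gbot tendsto_unique by blast
  qed
  moreover have "M-lipschitz_on UNIV x" using lip M_bounds by (intro lipschitz_onI) (auto simp: dist_norm dist_real_def)
  ultimately show thesis using that xK ineq by blast
qed

text \<open>As \<open>- v\<close> is tangent, the residual pairs nonpositively with
  \<open>- v\<close>, hence with \<open>w - v\<close> for every tangent \<open>w\<close>. This
  variational inequality gives minimality after expanding the square.\<close>

lemma projected_fieldI:
  assumes y: "y \<in> K" and v: "v \<in> tangent_cone X y" "- v \<in> tangent_cone X y"
    and pol: "g y (f y - v) \<in> tangent_polar X y"
  shows "v \<in> projected_field X g f y"
proof -
  have nn: "g y u u \<ge> 0" for u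
    using coercive[OF y, of u] \<mu> by (meson less_imp_le mult_nonneg_nonneg order_trans zero_le_power2)
  have "g y (v - f y) (v - f y) \<le> g y (w - f y) (w - f y)" if w: "w \<in> tangent_cone X y" for w
  proof -
    have "g y (f y - v) w \<le> 0" "g y (f y - v) (- v) \<le> 0"
      using pol w v(2) unfolding tangent_polar_def by blast+
    then have le: "g y (f y - v) (w - v) \<le> 0"
      by (simp add: blinfun.diff_right blinfun.minus_right)
    have "w - f y = (w - v) - (f y - v)" by simp
    then have "g y (w - f y) (w - f y) = g y ((w - v) - (f y - v)) ((w - v) - (f y - v))" by simp
    also have "\<dots> = g y (w - v) (w - v) - 2 * g y (f y - v) (w - v) + g y (f y - v) (f y - v)"
      using form_sym[OF y, of "w - v" "f y - v"]
      by (simp only: blinfun.diff_left[of _ _ "_ - _"] blinfun.diff_right[of _ "w - v" "f y - v"])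
    also have "g y (f y - v) (f y - v) = g y (v - f y) (v - f y)"
      unfolding minus_diff_eq[of "v" "f y", symmetric] blinfun.minus_left blinfun.minus_right by simp
    finally show ?thesis using nn[of "w - v"] le by linarith
  qed
  then show ?thesis
    using v(1) nn by (simp add: projected_field_def is_arg_min_linorder form_norm_def)
qed

lemma caratheodory_solution_exists:
  assumes r: "r > 0"
  shows "\<exists>T x. caratheodory_solution X g f x0 T x"
proof -
  \<comment> \<open>With speed at most \<open>M\<close> the curve travels at most
    \<open>T * M = r / 2\<close>, hence stays strictly inside the ball of radius
    \<open>r\<close>.\<close>
  define T where "T = r / (2 * M)"
  have T: "T > 0" "T * M < r" using r M_bounds by (auto simp: T_def)
  obtain x where xK: "\<And>t. x t \<in> K" and init: "x 0 = x0" and lip: "M-lipschitz_on UNIV x"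
    and ineq: "\<And>s t z. 0 \<le> s \<Longrightarrow> s \<le> t \<Longrightarrow> t \<le> T \<Longrightarrow> z \<in> K \<Longrightarrow>
      g (x s) ((t - s) *\<^sub>R f (x s) - (x t - x s)) (z - x s) \<le> Q * (t - s) * ((norm (z - x s))\<^sup>2 + (t - s))"
    using euler_cluster_point[OF less_imp_le[OF T(1)] T(2)] by blast
  have sol: "v \<in> projected_field X g f (x t)"
    if t: "0 < t" "t < T" and v: "(x has_vector_derivative v) (at t)" for t v
  proof (rule projected_fieldI[OF xK])
    define c where "c = min t (T - t)"
    have c: "c > 0" "c \<le> t" "t + c \<le> T" using t by (auto simp: c_def)
    define \<delta> where "\<delta> k = c * inverse (real (Suc k))" for k
    have \<delta>: "\<delta> k > 0" "\<delta> k \<le> c" for k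
      using c mult_left_mono[of "inverse (real (Suc k))" 1 c] by (auto simp: \<delta>_def inverse_le_1_iff)
    have \<delta>0: "\<delta> \<longlonglongrightarrow> 0"
      unfolding \<delta>_def by (intro tendsto_mult_right_zero LIMSEQ_inverse_real_of_nat)
    have contx: "isCont x t" using v by (rule has_vector_derivative_continuous)
    have slope: "(\<lambda>k. (x (t + \<delta> k) - x t) /\<^sub>R \<delta> k) \<longlonglongrightarrow> v"
      using \<delta>(1) by (intro has_vector_derivative_sequential v \<delta>0) (metis less_irrefl)
    have xlim: "(\<lambda>k. x (t + \<delta> k)) \<longlonglongrightarrow> x t" "(\<lambda>k. x (t - \<delta> k)) \<longlonglongrightarrow> x t"
      using tendsto_add[OF tendsto_const \<delta>0, of t] tendsto_diff[OF tendsto_const \<delta>0, of t]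
      by (auto intro!: isCont_tendsto_compose[OF contx])
    have xX: "x s \<in> X" for s using xK KX by blast
    show "v \<in> tangent_cone X (x t)"
      by (rule tangent_coneI[OF xX xlim(1) \<delta>(1) \<delta>0 slope])
    have "\<delta> k \<noteq> 0" for k using \<delta>(1)[of k] by simp
    then have "(\<lambda>k. (x (t + - \<delta> k) - x t) /\<^sub>R (- \<delta> k)) \<longlonglongrightarrow> v"
      using tendsto_minus[OF \<delta>0] by (intro has_vector_derivative_sequential[OF v]) simp_all
    from tendsto_minus[OF this] have "(\<lambda>k. (x (t - \<delta> k) - x t) /\<^sub>R \<delta> k) \<longlonglongrightarrow> - v" by simp
    then show "- v \<in> tangent_cone X (x t)"
      by (rule tangent_coneI[OF xX xlim(2) \<delta>(1) \<delta>0])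
    \<comment> \<open>Dividing by the elapsed time \<open>\<delta> k\<close> and letting it tend to
      zero removes the time error; what remains is a proximal normal inequality at
      \<open>x t\<close>.\<close>
    have quad: "g (x t) (f (x t) - v) (z - x t) \<le> Q * ((norm (z - x t))\<^sup>2)" if z: "z \<in> K" for z
    proof -
      have le: "g (x t) (f (x t) - (x (t + \<delta> k) - x t) /\<^sub>R \<delta> k) (z - x t) \<le> Q * ((norm (z - x t))\<^sup>2 + \<delta> k)" for k
      proof -
        have "g (x t) (\<delta> k *\<^sub>R f (x t) - (x (t + \<delta> k) - x t)) (z - x t) \<le> Q * \<delta> k * ((norm (z - x t))\<^sup>2 + \<delta> k)"
          using ineq[of t "t + \<delta> k" z] t c \<delta>[of k] z by simp
        moreover have "\<delta> k *\<^sub>R f (x t) - (x (t + \<delta> k) - x t) = \<delta> k *\<^sub>R (f (x t) - (x (t + \<delta> k) - x t) /\<^sub>R \<delta> k)"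
          using \<delta>(1)[of k] by (simp add: scaleR_diff_right)
        ultimately have "\<delta> k * g (x t) (f (x t) - (x (t + \<delta> k) - x t) /\<^sub>R \<delta> k) (z - x t) \<le> \<delta> k * (Q * ((norm (z - x t))\<^sup>2 + \<delta> k))"
          by (simp only: blinfun.scaleR_right blinfun.scaleR_left) (simp add: mult_ac)
        then show ?thesis using \<delta>(1)[of k] by (simp only: mult_le_cancel_left_pos)
      qed
      have "g (x t) (f (x t) - v) (z - x t) \<le> Q * ((norm (z - x t))\<^sup>2 + 0)"
      proof (rule tendsto_le[OF sequentially_bot])
        show "(\<lambda>k. Q * ((norm (z - x t))\<^sup>2 + \<delta> k)) \<longlonglongrightarrow> Q * ((norm (z - x t))\<^sup>2 + 0)"
          by (intro tendsto_intros \<delta>0)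
        show "(\<lambda>k. g (x t) (f (x t) - (x (t + \<delta> k) - x t) /\<^sub>R \<delta> k) (z - x t)) \<longlonglongrightarrow> g (x t) (f (x t) - v) (z - x t)"
          by (intro tendsto_intros slope)
      qed (use le in simp)
      then show ?thesis by simp
    qed
    have inball: "x t \<in> ball x0 r"
    proof -
      have "dist (x 0) (x t) \<le> M * dist 0 t" using lipschitz_onD[OF lip] by blast
      also have "\<dots> \<le> T * M" using t M_bounds by (simp add: mult.commute mult_right_mono)
      finally show ?thesis using T init by simp
    qed
    show "g (x t) (f (x t) - v) \<in> tangent_polar X (x t)"
      unfolding tangent_polar_def
    proof (intro CollectI ballI)
      fix w assume "w \<in> tangent_cone X (x t)"
      then obtain zs \<eta> where zs: "\<forall>k. zs k \<in> X" "zs \<longlonglongrightarrow> x t" "\<forall>k. \<eta> k > 0" "\<eta> \<longlonglongrightarrow> (0::real)"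
        "(\<lambda>k. (zs k - x t) /\<^sub>R \<eta> k) \<longlonglongrightarrow> w"
        unfolding tangent_cone_def by blast
      have "\<forall>\<^sub>F k in sequentially. zs k \<in> ball x0 r"
        using topological_tendstoD[OF zs(2) open_ball inball] .
      \<comment> \<open>After division by \<open>\<eta> k\<close> the quadratic bound is
        \<open>norm (zs k - x t)\<close> times the norm of a convergent difference quotient, and so
        tends to zero.\<close>
      then have ev: "\<forall>\<^sub>F k in sequentially. g (x t) (f (x t) - v) ((zs k - x t) /\<^sub>R \<eta> k) \<le> Q * (norm (zs k - x t) * norm ((zs k - x t) /\<^sub>R \<eta> k))"
      proof eventually_elim
        case (elim k)
        then have "zs k \<in> K" using zs(1) nbhd by blast
        then have "g (x t) (f (x t) - v) (zs k - x t) / \<eta> k \<le> Q * (norm (zs k - x t))\<^sup>2 / \<eta> k"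
          using zs(3) by (intro divide_right_mono quad) (auto simp: less_imp_le)
        moreover have "\<bar>\<eta> k\<bar> = \<eta> k" using zs(3) by (simp add: less_imp_le)
        ultimately show ?case
          by (simp add: blinfun.scaleR_right divide_inverse power2_eq_square mult_ac)
      qed
      have "g (x t) (f (x t) - v) w \<le> Q * (norm (x t - x t) * norm w)"
        by (rule tendsto_le[OF sequentially_bot _ _ ev]; intro tendsto_intros zs(2,5))
      then show "g (x t) (f (x t) - v) w \<le> 0" by simp
    qed
  qed
  have "AE t in lborel. \<exists>v. (x has_vector_derivative v) (at t)"
    by (rule lipschitz_differentiable_AE[OF lip])
  then have "AE t in lebesgue. \<exists>v. (x has_vector_derivative v) (at t)" by (rule AE_completion)
  moreover have "AE t in lborel. t \<noteq> (0::real)" by (rule AE_lborel_singleton)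
  then have "AE t in lebesgue. t \<noteq> (0::real)" by (rule AE_completion)
  ultimately have "AE t in lebesgue. t \<in> {0..<T} \<longrightarrow>
      (\<exists>v\<in>projected_field X g f (x t). (x has_vector_derivative v) (at t within {0..<T}))"
  proof eventually_elim
    case (elim t)
    show ?case
    proof
      assume "t \<in> {0..<T}"
      then have t: "0 < t" "t < T" using elim by auto
      obtain v where v: "(x has_vector_derivative v) (at t)" using elim by blast
      show "\<exists>v\<in>projected_field X g f (x t). (x has_vector_derivative v) (at t within {0..<T})"
        using sol[OF t v] has_vector_derivative_at_within[OF v] by blast
    qed
  qed
  then have "AE t in lebesgue_on {0..<T}.
      \<exists>v\<in>projected_field X g f (x t). (x has_vector_derivative v) (at t within {0..<T})"
    by (subst AE_restrict_space_iff) auto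
  moreover have "absolutely_continuous_on {0..<T} x"
    by (rule lipschitz_imp_absolutely_continuous_on[OF lipschitz_on_subset[OF lip subset_UNIV]])
  moreover have "x t \<in> X" for t using xK KX by blast
  ultimately have "caratheodory_solution X g f x0 T x"
    using T(1) init unfolding caratheodory_solution_def inclusion_solution_def by blast
  then show ?thesis by blast
qed

end

text \<open>Constant sequences put the values of the field into its outer limit. Uniqueness of
  Krasovskii solutions therefore covers Caratheodory solutions.\<close>

lemma caratheodory_imp_krasovskii_solution:
  assumes "caratheodory_solution X g f x0 T x"
  shows "krasovskii_solution X g f x0 T x"
proof -
  let ?F = "projected_field X g f"
  have sub: "?F y \<subseteq> krasovskii_regularization X ?F y" if "y \<in> X" for y
  proof -
    have "?F y \<subseteq> outer_limit X ?F y"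
    proof
      fix v assume "v \<in> ?F y"
      then show "v \<in> outer_limit X ?F y"
        using that unfolding outer_limit_def
        by (intro CollectI exI[of _ "\<lambda>_. y"] exI[of _ "\<lambda>_. v"]) simp
    qed
    also have "\<dots> \<subseteq> krasovskii_regularization X ?F y"
      unfolding krasovskii_regularization_def using hull_subset closure_subset by (rule subset_trans)
    finally show ?thesis .
  qed
  have sol: "inclusion_solution X ?F x0 T x" using assms by (simp add: caratheodory_solution_def)
  then have xX: "x t \<in> X" if "t \<in> {0..<T}" for t using that by (simp add: inclusion_solution_def)
  have "AE t in lebesgue_on {0..<T}. \<exists>v\<in>?F (x t). (x has_vector_derivative v) (at t within {0..<T})"
    using sol by (simp add: inclusion_solution_def)
  then have "AE t in lebesgue_on {0..<T}. \<exists>v\<in>krasovskii_regularization X ?F (x t).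
      (x has_vector_derivative v) (at t within {0..<T})"
  proof (rule AE_mp, intro AE_I2 impI)
    fix t assume "t \<in> space (lebesgue_on {0..<T})"
      and "\<exists>v\<in>?F (x t). (x has_vector_derivative v) (at t within {0..<T})"
    moreover from this have "t \<in> {0..<T}" by (simp add: space_restrict_space)
    ultimately show "\<exists>v\<in>krasovskii_regularization X ?F (x t). (x has_vector_derivative v) (at t within {0..<T})"
      using sub[OF xX] by blast
  qed
  then show ?thesis using sol by (simp add: krasovskii_solution_def inclusion_solution_def)
qed

theorem theorem6p13:
  fixes X :: "(real ^ 'n) set"
    and f :: "real ^ 'n \<Rightarrow> real ^ 'n"
    and g :: "real ^ 'n \<Rightarrow> (real ^ 'n) bilinear_form"
  assumes "prox_regular X"
    and "locally_lipschitz_on X f"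
    and "metric_on X g"
    and "locally_lipschitz_on X g"
  shows "\<forall>x0\<in>X. \<exists>T>0.
    (\<exists>x. caratheodory_solution X g f x0 T x \<and> krasovskii_solution X g f x0 T x) \<and>
    (\<forall>T1 T2 y z. caratheodory_solution X g f x0 T1 y \<and> caratheodory_solution X g f x0 T2 z \<longrightarrow>
       (\<forall>t\<in>{0..<min T1 T2}. y t = z t)) \<and>
    (\<forall>T1 T2 y z. krasovskii_solution X g f x0 T1 y \<and> krasovskii_solution X g f x0 T2 z \<longrightarrow>
       (\<forall>t\<in>{0..<min T1 T2}. y t = z t))"
proof
  fix x0 assume x0: "x0 \<in> X"
  obtain r C \<mu> where r: "r > 0" "compact (X \<inter> cball x0 r)" "prox_chart X f g (X \<inter> cball x0 r) C \<mu>"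
    using prox_chart_exists[OF assms x0] by blast
  interpret prox_chart_ball X f g "X \<inter> cball x0 r" C \<mu> x0 r
    using r x0 by (intro prox_chart_ball.intro prox_chart_ball_axioms.intro) auto
  obtain T x where sol: "caratheodory_solution X g f x0 T x"
    using caratheodory_solution_exists[OF r(1)] by blast
  then have "T > 0" by (simp add: caratheodory_solution_def inclusion_solution_def)
  moreover have "krasovskii_solution X g f x0 T x"
    using sol by (rule caratheodory_imp_krasovskii_solution)
  moreover have "y t = z t"
    if "krasovskii_solution X g f x0 T1 y" "krasovskii_solution X g f x0 T2 z" "t \<in> {0..<min T1 T2}"
    for T1 T2 y z t
    using that by (rule krasovskii_solution_unique[OF assms])
  ultimately show "\<exists>T>0.
    (\<exists>x. caratheodory_solution X g f x0 T x \<and> krasovskii_solution X g f x0 T x) \<and>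
    (\<forall>T1 T2 y z. caratheodory_solution X g f x0 T1 y \<and> caratheodory_solution X g f x0 T2 z \<longrightarrow>
       (\<forall>t\<in>{0..<min T1 T2}. y t = z t)) \<and>
    (\<forall>T1 T2 y z. krasovskii_solution X g f x0 T1 y \<and> krasovskii_solution X g f x0 T2 z \<longrightarrow>
       (\<forall>t\<in>{0..<min T1 T2}. y t = z t))"
    using sol caratheodory_imp_krasovskii_solution by (intro exI[of _ T]) blast
qed

end
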